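(* Let $T$ be a Calderón-Zygmund operator on $\mathbb{R}^d$ whose kernel satisfies the Dini condition. There exists $\eta_*\in(0,1)$, depending only on $d$, such that for every $0<\eta<\eta_*$ there is a constant $C>0$, depending only on $d$, $\eta$ and $T$ (through its $L^2$ norm, its kernel constants and $\omega$), with the following property. For every dyadic cube $Q_0\in\mathscr{D}$ and every pair $(f_1,f_2)$ of nonnegative, bounded functions supported on $Q_0$, there exists an $\eta$-sparse family $\mathcal{S}$ of cubes (with respect to Lebesgue measure) such that $$ \left|\langle Tf_1,f_2\rangle\right|\le C\sum_{Q\in\mathcal{S}}\langle f_1\rangle_Q\,\langle f_2\rangle_Q\,|Q|. $$
   Context: All cubes in $\mathbb{R}^d$ are half-open with sides parallel to the coordinate axes; $\mathscr{D}$ is the standard dyadic system of half-open cubes. $|E|$ is Lebesgue measure, $\langle f\rangle_Q=\frac1{|Q|}\int_Q f$, and $\langle f,g\rangle=\int_{\mathbb{R}^d} f g$. Sparse family: for $0<\eta<1$, a family $\mathcal{S}$ of cubes is $\eta$-sparse if for each $Q\in\mathcal{S}$ there is a measurable $E_Q\subset Q$ with $|E_Q|\ge\eta|Q|$, and $E_Q\cap E_R=\varnothing$ whenever $Q\ne R$ are in $\mathcal{S}$. Calderón-Zygmund operator with Dini kernel: a linear operator $T$, initially defined on Schwartz functions, such that (1) $T$ extends to a bounded linear operator on $L^2(\mathbb{R}^d)$; (2) there is a kernel $K:\mathbb{R}^d\times\mathbb{R}^d\setminus\{x=y\}\to\mathbb{C}$ such that for every bounded compactly supported $f$, $Tf(x)=\int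 K(x,y)f(y)\,dy$ for $x\notin\operatorname{supp}(f)$; (3) $|K(x,y)|\le C_K|x-y|^{-d}$ for $x\ne y$; (4) there is a modulus of continuity $\omega:[0,1]\to\mathbb{R}^+$, continuous and non-decreasing, satisfying the Dini condition $\int_0^1\omega(t)\frac{dt}{t}<\infty$, such that whenever $2|x-x'|\le|x-y|$, $$|K(x,y)-K(x',y)|+|K(y,x)-K(y,x')|\le C_K\frac{1}{|x-y|^d}\,\omega\!\left(\frac{|x-x'|}{|x-y|}\right).$$ *)

theory Defs
  imports "HOL-Analysis.Analysis"
begin

definition half_open_cube :: "real^'n \<Rightarrow> real \<Rightarrow> (real^'n) set" where
  "half_open_cube a l = {x. \<forall>i. a $ i \<le> x $ i \<and> x $ i < a $ i + l}"

definition cubes :: "(real^'n) set set" where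
  "cubes = {half_open_cube a l | a l. l > 0}"

definition dyadic_cubes :: "(real^'n) set set" where
  "dyadic_cubes =
     {half_open_cube (\<chi> i. 2 powi k * of_int (m $ i)) (2 powi k) | (k :: int) (m :: int^'n). True}"

definition sparse_family :: "real \<Rightarrow> (real^'n) set set \<Rightarrow> bool" where
  "sparse_family \<eta> S \<longleftrightarrow> S \<subseteq> cubes \<and>
     (\<exists>E. (\<forall>Q\<in>S. E Q \<in> sets lebesgue \<and> E Q \<subseteq> Q \<and>
                  measure lebesgue (E Q) \<ge> \<eta> * measure lebesgue Q) \<and>
          (\<forall>Q\<in>S. \<forall>R\<in>S. Q \<noteq> R \<longrightarrow> E Q \<inter> E R = {}))"

definition average :: "(real^'n) set \<Rightarrow> (real^'n \<Rightarrow> real) \<Rightarrow> real" where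
  "average Q f = (LINT x:Q|lebesgue. f x) / measure lebesgue Q"

text \<open>The pairing is bilinear: there is no complex conjugation.\<close>

definition pairing :: "(real^'n \<Rightarrow> complex) \<Rightarrow> (real^'n \<Rightarrow> complex) \<Rightarrow> complex" where
  "pairing f g = (LINT x|lebesgue. f x * g x)"

definition partial_deriv :: "'n \<Rightarrow> (real^'n \<Rightarrow> complex) \<Rightarrow> real^'n \<Rightarrow> complex" where
  "partial_deriv i f x = vector_derivative (\<lambda>t. f (x + t *\<^sub>R axis i 1)) (at 0)"

text \<open>A list \<open>\<alpha>\<close> of coordinates plays the role of a multi-index: \<open>foldr partial_deriv \<alpha> f\<close> is the
  corresponding iterated partial derivative.\<close>

definition schwartz_functions :: "(real^'n \<Rightarrow> complex) set" where
  "schwartz_functions =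
     {f. \<forall>\<alpha>. (\<forall>x. foldr partial_deriv \<alpha> f differentiable (at x)) \<and>
             (\<forall>k::nat. \<exists>B. \<forall>x. norm x ^ k * cmod (foldr partial_deriv \<alpha> f x) \<le> B)}"

text \<open>Elements of \<open>L\<^sup>2\<close> are represented by functions rather than by classes modulo null sets;
  accordingly identities between images under operators are required almost everywhere only.\<close>

definition L2_functions :: "(real^'n \<Rightarrow> complex) set" where
  "L2_functions =
     {f. f \<in> borel_measurable lebesgue \<and> integrable lebesgue (\<lambda>x. (cmod (f x))\<^sup>2)}"

definition L2_norm :: "(real^'n \<Rightarrow> complex) \<Rightarrow> real" where
  "L2_norm f = sqrt (LINT x|lebesgue. (cmod (f x))\<^sup>2)"

definition linear_operator_on ::
  "(real^'n \<Rightarrow> complex) set \<Rightarrow> ((real^'n \<Rightarrow> complex) \<Rightarrow> real^'n \<Rightarrow> complex) \<Rightarrow> bool" where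
  "linear_operator_on V T \<longleftrightarrow>
     (\<forall>f\<in>V. \<forall>g\<in>V. AE x in lebesgue. T (\<lambda>y. f y + g y) x = T f x + T g x) \<and>
     (\<forall>c. \<forall>f\<in>V. AE x in lebesgue. T (\<lambda>y. c * f y) x = c * T f x)"

definition L2_bounds :: "((real^'n \<Rightarrow> complex) \<Rightarrow> real^'n \<Rightarrow> complex) \<Rightarrow> real set" where
  "L2_bounds T = {N. 0 \<le> N \<and> (\<forall>f\<in>L2_functions. L2_norm (T f) \<le> N * L2_norm f)}"

definition L2_bounded_linear :: "((real^'n \<Rightarrow> complex) \<Rightarrow> real^'n \<Rightarrow> complex) \<Rightarrow> bool" where
  "L2_bounded_linear T \<longleftrightarrow>
     (\<forall>f\<in>L2_functions. T f \<in> L2_functions) \<and>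
     linear_operator_on L2_functions T \<and>
     L2_bounds T \<noteq> {}"

definition L2_operator_norm :: "((real^'n \<Rightarrow> complex) \<Rightarrow> real^'n \<Rightarrow> complex) \<Rightarrow> real" where
  "L2_operator_norm T = Inf (L2_bounds T)"

text \<open>Only the values of \<open>\<omega>\<close> on \<open>[0,1]\<close> are relevant. The target \<open>\<real>\<^sup>+\<close> is read as \<open>[0,\<infinity>)\<close>, since the
  Dini condition and continuity force \<open>\<omega> 0 = 0\<close>.\<close>

definition dini_modulus :: "(real \<Rightarrow> real) \<Rightarrow> bool" where
  "dini_modulus \<omega> \<longleftrightarrow>
     (\<forall>t\<in>{0..1}. 0 \<le> \<omega> t) \<and> continuous_on {0..1} \<omega> \<and> mono_on {0..1} \<omega> \<and>
     (\<integral>\<^sup>+t\<in>{0<..1}. ennreal (\<omega> t / t) \<partial>lborel) < \<infinity>"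

text \<open>The diagonal values \<open>K x x\<close> are junk: neither condition below involves them.\<close>

definition dini_kernel ::
  "(real^'n \<Rightarrow> real^'n \<Rightarrow> complex) \<Rightarrow> real \<Rightarrow> (real \<Rightarrow> real) \<Rightarrow> bool" where
  "dini_kernel K C\<^sub>K \<omega> \<longleftrightarrow>
     dini_modulus \<omega> \<and>
     (\<forall>x y. x \<noteq> y \<longrightarrow> cmod (K x y) \<le> C\<^sub>K / norm (x - y) ^ CARD('n)) \<and>
     (\<forall>x x' y. x \<noteq> y \<and> 2 * norm (x - x') \<le> norm (x - y) \<longrightarrow>
        cmod (K x y - K x' y) + cmod (K y x - K y x')
          \<le> C\<^sub>K * (1 / norm (x - y) ^ CARD('n)) * \<omega> (norm (x - x') / norm (x - y)))"

text \<open>\<open>T\<^sub>0\<close> is the operator as initially given on Schwartz functions, \<open>T\<close> its bounded extension to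
  \<open>L\<^sup>2\<close>. As \<open>T f\<close> is defined up to null sets, the kernel representation holds for almost
  every \<open>x\<close> off the support; there the integral converges absolutely because of the size bound
  on \<open>K\<close>.\<close>

definition dini_cz_operator ::
  "((real^'n \<Rightarrow> complex) \<Rightarrow> real^'n \<Rightarrow> complex) \<Rightarrow> ((real^'n \<Rightarrow> complex) \<Rightarrow> real^'n \<Rightarrow> complex) \<Rightarrow>
   (real^'n \<Rightarrow> real^'n \<Rightarrow> complex) \<Rightarrow> real \<Rightarrow> (real \<Rightarrow> real) \<Rightarrow> bool" where
  "dini_cz_operator T\<^sub>0 T K C\<^sub>K \<omega> \<longleftrightarrow>
     linear_operator_on schwartz_functions T\<^sub>0 \<and>
     L2_bounded_linear T \<and>
     (\<forall>f\<in>schwartz_functions. AE x in lebesgue. T f x = T\<^sub>0 f x) \<and>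
     dini_kernel K C\<^sub>K \<omega> \<and>
     (\<forall>f. f \<in> borel_measurable lebesgue \<and> bounded (range f) \<and> compact (closure {y. f y \<noteq> 0}) \<longrightarrow>
        (AE x in lebesgue. x \<notin> closure {y. f y \<noteq> 0} \<longrightarrow> T f x = (LINT y|lebesgue. K x y * f y)))"

definition test_functions :: "(real^'n) set \<Rightarrow> (real^'n \<Rightarrow> real) set" where
  "test_functions Q =
     {f. f \<in> borel_measurable lebesgue \<and> (\<forall>x. 0 \<le> f x) \<and> bounded (range f) \<and> (\<forall>x. x \<notin> Q \<longrightarrow> f x = 0)}"

end

(* The form B(f,g) = <Tf,g> is dominated by stopping cubes, with no weak-type estimate for T.
   For f supported on a dyadic cube Q and g on a dilate cQ, let E be the union of all balls on which
   the average of f or g exceeds a large multiple A of its average over cQ; for A large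
   |E| <= |Q|/2. Split f and g over the Whitney cubes P of E into means and mean-zero parts and call
   two cubes near if their distance is at most comparable to the larger side (then the sides are
   comparable and each cube lies in the dilate of the other). In
     B(f,g) - sum over P of B(f 1_P, g 1_(union of the cubes near P))
   the means are bounded by a multiple of the averages over cQ, so they are handled by the L2 bound;
   every mean-zero part meets only functions living far from its cube, so kernel smoothness and the
   Dini condition apply. Iterating over the cubes P inside Q halves the measure of the remaining cubes
   in each step, so finitely many steps leave an error that is absorbed by the first term, and the
   dilates cP of all the cubes occurring form the sparse family. *)

theory Submission
  imports Defs
begin

text \<open>The delicate point of a stopping argument is what a stopping cube feels from its
  surroundings. Here the stopping rule sees only averages of \<open>f\<close> and \<open>g\<close>,
  and the interaction of neighbouring cubes is never estimated: it is handed to the next generation.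
  This is why the recursion carries the asymmetric supports \<open>dcube q\<close> and
  \<open>dil q\<close>. Near partners of a Whitney cube lie in its dilate, so the hypothesis
  reproduces itself. Against a mean-zero piece, the kernel sees the other function only through
  averages over balls at least as large as the separation. Such balls, enlarged by a fixed factor,
  reach the complement of \<open>E\<close>, where averages are controlled; so one of the two
  functions can stay unsplit there. Infinite Whitney sums are avoided: finitely many cubes are kept
  in each step, and the rest of \<open>E\<close> is cut away at a cost that is small because
  \<open>f\<close> and \<open>g\<close> are bounded. Every family produced is therefore finite. The
  threshold for \<eta> is half the volume ratio of a cube to its dilate, because each cube keeps at
  least half of itself after its children are removed.\<close>

section \<open>Dyadic cubes\<close>

(* Otherwise simp rewrites Lebesgue measures of Borel sets to lborel. *)
declare measure_completion [simp del] emeasure_completion [simp del]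

lemma half_open_cube_borel [measurable]: "half_open_cube a l \<in> sets borel"
  unfolding half_open_cube_def by measurable

lemma half_open_cube_lebesgue [measurable]: "half_open_cube a l \<in> sets lebesgue"
  using half_open_cube_borel[of a l] by (simp add: sets_completionI_sets)

lemma emeasure_half_open_cube:
  fixes a :: "real^'n"
  assumes "0 \<le> l"
  shows "emeasure lebesgue (half_open_cube a l) = ennreal (l ^ CARD('n))"
proof (rule antisym)
  define b where "b = a + (\<chi> i. l)"
  have meas: "measure lborel (cbox a b) = l ^ CARD('n)"
    using assms content_cbox_cart[of a b] by (auto simp: b_def interval_ne_empty_cart)
  then have e1: "emeasure lborel (cbox a b) = ennreal (l ^ CARD('n))"
    by (subst emeasure_eq_ennreal_measure) (auto simp: emeasure_lborel_cbox_eq)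
  then have e2: "emeasure lborel (box a b) = ennreal (l ^ CARD('n))"
    by (simp add: emeasure_lborel_box_eq emeasure_lborel_cbox_eq)
  have "half_open_cube a l \<subseteq> cbox a b"
    by (auto simp: half_open_cube_def b_def mem_box_cart less_imp_le)
  then show "emeasure lebesgue (half_open_cube a l) \<le> ennreal (l ^ CARD('n))"
    unfolding e1[symmetric] by (simp add: emeasure_mono emeasure_completion)
  have "box a b \<subseteq> half_open_cube a l"
    by (auto simp: half_open_cube_def b_def mem_box_cart less_imp_le)
  then show "ennreal (l ^ CARD('n)) \<le> emeasure lebesgue (half_open_cube a l)"
    unfolding e2[symmetric] by (simp add: emeasure_mono emeasure_completion)
qed

lemma measure_half_open_cube:
  fixes a :: "real^'n"
  shows "0 \<le> l \<Longrightarrow> measure lebesgue (half_open_cube a l) = l ^ CARD('n)"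
  by (metis emeasure_half_open_cube enn2real_ennreal measure_def zero_le_power)

lemma half_open_cube_lmeasurable [simp]:
  fixes a :: "real^'n"
  shows "0 \<le> l \<Longrightarrow> half_open_cube a l \<in> lmeasurable"
  by (rule fmeasurableI) (simp_all add: emeasure_half_open_cube)

lemma half_open_cube_corner: "0 < l \<Longrightarrow> a \<in> half_open_cube a l"
  by (simp add: half_open_cube_def)

text \<open>Estimating the Euclidean norm by the sum norm costs a factor of sqrt d (d the
  dimension), but every later distance can then be measured in multiples of
  \<open>real CARD('n) * side p\<close>.\<close>

lemma half_open_cube_diff_le:
  fixes a :: "real^'n"
  assumes "x \<in> half_open_cube a l" "y \<in> half_open_cube a l"
  shows "norm (x - y) \<le> real CARD('n) * l"
proof -
  have "\<bar>(x - y) $ i\<bar> \<le> l" for i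
    using assms[unfolded half_open_cube_def, THEN CollectD, rule_format, of i]
    by (auto simp: abs_if)
  then have "(\<Sum>i\<in>UNIV. \<bar>(x - y) $ i\<bar>) \<le> (\<Sum>i\<in>(UNIV::'n set). l)"
    by (intro sum_mono) auto
  with norm_le_l1_cart[of "x - y"] show ?thesis by simp
qed

text \<open>The side is recovered from the volume, and each corner lies in the other cube, hence
  dominates the other corner componentwise. A sparse family is a set of cubes, so sums over
  parameters must be transferable to sums over sets.\<close>

lemma half_open_cube_inject:
  fixes a :: "real^'n"
  assumes "half_open_cube a l = half_open_cube b r" "0 < l" "0 < r"
  shows "a = b \<and> l = r"
proof
  have "l ^ CARD('n) = r ^ CARD('n)"
    by (metis assms less_imp_le measure_half_open_cube)
  then show "l = r"
    using assms by (metis less_imp_le power_eq_iff_eq_base zero_less_card_finite)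
  have "a \<in> half_open_cube b r" "b \<in> half_open_cube a l"
    using assms half_open_cube_corner by auto
  then show "a = b"
    by (auto simp: half_open_cube_def vec_eq_iff intro!: antisym)
qed

section \<open>Dyadic cubes as pairs of a generation and an integer position\<close>

type_synonym 'n dyadic_index = "int \<times> (int^'n)"

definition side :: "('n::finite) dyadic_index \<Rightarrow> real" where
  "side p = 2 powi fst p"

definition corner :: "('n::finite) dyadic_index \<Rightarrow> real^'n" where
  "corner p = (\<chi> i. side p * of_int (snd p $ i))"

definition dcube :: "('n::finite) dyadic_index \<Rightarrow> (real^'n) set" where
  "dcube p = half_open_cube (corner p) (side p)"

text \<open>A generation and a point determine the cube, so membership becomes the equation
  \<open>mem_dcube_iff\<close> and nestedness a statement about floors.\<close>

definition dcube_at :: "int \<Rightarrow> real^'n \<Rightarrow> ('n::finite) dyadic_index" where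
  "dcube_at k x = (k, \<chi> i. \<lfloor>x $ i / 2 powi k\<rfloor>)"

definition dparent :: "('n::finite) dyadic_index \<Rightarrow> ('n::finite) dyadic_index" where
  "dparent p = dcube_at (fst p + 1) (corner p)"

lemma side_pos [simp]: "0 < side p"
  by (simp add: side_def)

lemma side_nonneg [simp]: "0 \<le> side p"
  by (simp add: less_imp_le)

lemma side_le_iff: "side p \<le> side q \<longleftrightarrow> fst p \<le> fst q"
  unfolding side_def
  by (metis linorder_not_less one_less_numeral_iff power_int_increasing power_int_strict_increasing
      semiring_norm(76) less_imp_le)

lemma side_neq_0 [simp]: "side p \<noteq> 0"
  using side_pos[of p] by (rule less_imp_neq[THEN not_sym])

lemma dyadic_cubes_eq: "dyadic_cubes = range dcube"
proof -
  have "half_open_cube (\<chi> i. 2 powi k * of_int (m $ i)) (2 powi k) = dcube (k, m)" for k m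
    by (simp add: dcube_def corner_def side_def)
  then show ?thesis
    unfolding dyadic_cubes_def image_def by (metis surj_pair UNIV_I)
qed

lemma mem_dcube: "x \<in> dcube p \<longleftrightarrow> (\<forall>i. \<lfloor>x $ i / side p\<rfloor> = snd p $ i)"
proof -
  have "\<lfloor>t / side p\<rfloor> = c \<longleftrightarrow> side p * of_int c \<le> t \<and> t < side p * of_int c + side p" for t c
    using side_pos[of p] by (simp add: floor_eq_iff field_simps)
  then show ?thesis
    by (simp add: dcube_def half_open_cube_def corner_def)
qed

lemma mem_dcube_iff: "x \<in> dcube p \<longleftrightarrow> p = dcube_at (fst p) x"
  by (cases p) (auto simp: mem_dcube dcube_at_def vec_eq_iff side_def)

lemma dcube_at_mem [simp]: "x \<in> dcube (dcube_at k x)"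
  by (simp add: mem_dcube_iff) (simp add: dcube_at_def)

lemma fst_dcube_at [simp]: "fst (dcube_at k x) = k"
  by (simp add: dcube_at_def)

lemma side_dcube_at [simp]: "side (dcube_at k x) = 2 powi k"
  by (simp add: side_def)

text \<open>The floor at the doubled scale is the integer half of the previous floor, so the
  position of a cube determines that of its parent. Nestedness of the dyadic grid rests on
  this.\<close>

lemma dcube_at_Suc:
  assumes "dcube_at k x = dcube_at k y" shows "dcube_at (k+1) x = dcube_at (k+1) y"
proof -
  have *: "\<lfloor>t / 2 powi (k+1)\<rfloor> = \<lfloor>t / 2 powi k\<rfloor> div 2" for t :: real
    using floor_divide_real_eq_div[of 2 "t / 2 powi k"]
    by (simp add: power_int_add)
  from assms show ?thesis
    by (simp add: dcube_at_def vec_eq_iff *)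
qed

lemma dcube_at_mono:
  assumes "dcube_at k x = dcube_at k y" "k \<le> j" shows "dcube_at j x = dcube_at j y"
  using assms(2,1) by (induction j rule: int_ge_induct) (auto dest: dcube_at_Suc)

lemma dcube_nested:
  assumes "x \<in> dcube p" "x \<in> dcube q" "fst p \<le> fst q"
  shows "dcube p \<subseteq> dcube q"
proof
  fix y assume "y \<in> dcube p"
  with assms have "dcube_at (fst p) y = dcube_at (fst p) x" by (metis mem_dcube_iff)
  then have "dcube_at (fst q) y = dcube_at (fst q) x" using assms(3) by (rule dcube_at_mono)
  with assms(2) show "y \<in> dcube q" by (metis mem_dcube_iff)
qed

lemma corner_mem [simp]: "corner p \<in> dcube p"
  by (simp add: dcube_def half_open_cube_corner)

lemma fst_dparent [simp]: "fst (dparent p) = fst p + 1"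
  by (simp add: dparent_def)

lemma side_dparent [simp]: "side (dparent p) = 2 * side p"
  by (simp add: side_def power_int_add)

lemma dcube_subset_dparent: "dcube p \<subseteq> dcube (dparent p)"
  by (rule dcube_nested[of "corner p"]) (auto simp: dparent_def)

lemma inj_dcube: "inj dcube"
proof (rule injI)
  fix p q :: "'a dyadic_index" assume *: "dcube p = dcube q"
  then have "corner p = corner q" "side p = side q"
    using half_open_cube_inject[of "corner p" "side p" "corner q" "side q"]
    by (auto simp: dcube_def)
  then have "fst p = fst q"
    by (metis order_antisym order_refl side_le_iff)
  with * show "p = q"
    by (metis corner_mem mem_dcube_iff)
qed

lemma measure_dcube [simp]:
  fixes p :: "('n::finite) dyadic_index"
  shows "measure lebesgue (dcube p) = side p ^ CARD('n)"
  unfolding dcube_def by (rule measure_half_open_cube) simp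

lemma dcube_lmeasurable [simp]: "dcube p \<in> lmeasurable"
  by (simp add: dcube_def)

lemma dcube_lebesgue [measurable, simp]: "dcube p \<in> sets lebesgue"
  by (simp add: dcube_def)

lemma dcube_diff_le:
  fixes p :: "('n::finite) dyadic_index"
  shows "x \<in> dcube p \<Longrightarrow> y \<in> dcube p \<Longrightarrow> norm (x - y) \<le> real CARD('n) * side p"
  unfolding dcube_def by (rule half_open_cube_diff_le)

lemma countable_dyadic_index: "countable (UNIV :: ('n::finite) dyadic_index set)"
proof -
  have "inj (vec_nth :: int^'n \<Rightarrow> _)"
    by (simp add: inj_on_def vec_nth_inject)
  moreover have "countable (range (vec_nth :: int^'n \<Rightarrow> _))"
    by (rule countable_subset[of _ "PiE (UNIV::'n set) (\<lambda>_. UNIV::int set)"])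
      (auto intro: countable_PiE)
  ultimately have "countable (UNIV :: (int^'n) set)"
    by (rule countable_image_inj_on[rotated])
  then have "countable (UNIV \<times> UNIV :: ('n dyadic_index) set)"
    by (intro countable_SIGMA) auto
  then show ?thesis by simp
qed

text \<open>The 12 comes from \<open>near_whitney_subset_dil\<close>: points of near Whitney cubes
  lie within 11 d side lengths of \<open>dcube p\<close>, d being the dimension. A margin of 12 d
  sides on both ends multiplies the side by 24 d + 1, the \<open>dil_factor\<close>.\<close>

definition dilation :: "'n itself \<Rightarrow> real" where
  "dilation _ = 12 * real CARD('n)"

abbreviation dil_factor :: "'n itself \<Rightarrow> real" where
  "dil_factor t \<equiv> 2 * dilation t + 1"

definition dil :: "('n::finite) dyadic_index \<Rightarrow> (real^'n) set" where
  "dil p = half_open_cube (corner p - (\<chi> i. dilation TYPE('n) * side p)) (dil_factor TYPE('n) * side p)"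

lemma dilation_ge: "12 \<le> dilation TYPE('n::finite)"
proof -
  have "1 \<le> CARD('n)" by (simp add: Suc_leI)
  then show ?thesis by (simp add: dilation_def)
qed

lemma dil_pos: "0 < dil_factor TYPE('n::finite)"
  using dilation_ge[where 'n='n] by simp

lemma dil_cubes:
  fixes p :: "('n::finite) dyadic_index"
  shows "dil p \<in> cubes"
proof -
  have "0 < dil_factor TYPE('n) * side p"
    using dil_pos[where 'n='n] by simp
  then show ?thesis unfolding dil_def cubes_def by blast
qed

lemma measure_dil:
  fixes p :: "('n::finite) dyadic_index"
  shows "measure lebesgue (dil p) = dil_factor TYPE('n) ^ CARD('n) * side p ^ CARD('n)"
proof -
  have "0 \<le> dil_factor TYPE('n) * side p"
    using dil_pos[where 'n='n] by simp
  from measure_half_open_cube[OF this] show ?thesis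
    unfolding dil_def power_mult_distrib .
qed

lemma measure_dil_pos:
  fixes p :: "('n::finite) dyadic_index"
  shows "0 < measure lebesgue (dil p)"
  unfolding measure_dil using dil_pos[where 'n='n] by simp

lemma dil_lmeasurable [simp]:
  fixes p :: "('n::finite) dyadic_index"
  shows "dil p \<in> lmeasurable"
  using dil_pos[where 'n='n] side_pos[of p] by (simp add: dil_def less_imp_le)

lemma dil_lebesgue [measurable, simp]: "dil p \<in> sets lebesgue"
  by (simp add: dil_def)

lemma mem_dilI:
  fixes p :: "('n::finite) dyadic_index"
  assumes "x \<in> dcube p" "norm (x - y) \<le> 11 * real CARD('n) * side p"
  shows "y \<in> dil p"
proof -
  have c: "1 \<le> real CARD('n)" by (simp add: Suc_leI)
  define t where "t = real CARD('n) * side p"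
  have t: "side p \<le> t" using c side_pos[of p] by (simp add: t_def)
  have d: "dilation TYPE('n) * side p = 12 * t" by (simp add: dilation_def t_def)
  have "\<bar>x $ i - y $ i\<bar> \<le> 11 * t" for i
    using order_trans[OF component_le_norm_cart[of "x - y" i] assms(2)] by (simp add: t_def)
  moreover have "corner p $ i \<le> x $ i \<and> x $ i < corner p $ i + side p" for i
    using assms(1) by (auto simp: dcube_def half_open_cube_def)
  ultimately show ?thesis
    using t side_pos[of p] unfolding dil_def half_open_cube_def distrib_right mult.assoc d
    by (simp add: abs_le_iff) (smt (verit))
qed

lemma dcube_subset_dil: "dcube p \<subseteq> dil p"
  by (auto intro: mem_dilI)

text \<open>The sparse family will be a set of dilates; coinciding dilates would merge two summands
  and leave no unique exceptional subset.\<close>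

lemma inj_dil: "inj dil"
proof (rule injI)
  fix p q :: "'a dyadic_index" assume "dil p = dil q"
  then have *: "corner p - (\<chi> i. dilation TYPE('a) * side p) = corner q - (\<chi> i. dilation TYPE('a) * side q)"
    "dil_factor TYPE('a) * side p = dil_factor TYPE('a) * side q"
    using half_open_cube_inject[of "corner p - (\<chi> i. dilation TYPE('a) * side p)" "dil_factor TYPE('a) * side p"
        "corner q - (\<chi> i. dilation TYPE('a) * side q)" "dil_factor TYPE('a) * side q"]
      dil_pos[where 'n='a] side_pos[of p] side_pos[of q] by (auto simp: dil_def)
  then have "side p = side q" using dil_pos[where 'n='a] by simp
  with * have "dcube p = dcube q" by (simp add: dcube_def)
  then show "p = q" by (rule injD[OF inj_dcube])
qed

section \<open>Bounded functions with bounded support\<close>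

text \<open>A class that contains the test functions, is closed under the cutoffs, means and finite
  sums of the argument, and consists of integrable and square integrable functions.\<close>

definition bbs :: "(real^'n \<Rightarrow> real) set" where
  "bbs = {f. f \<in> borel_measurable lebesgue \<and> bounded (range f) \<and> bounded {x. f x \<noteq> 0}}"

lemma bbs_measurable [measurable_dest]: "f \<in> bbs \<Longrightarrow> f \<in> borel_measurable lebesgue"
  by (simp add: bbs_def)

lemma bbsI:
  assumes "f \<in> borel_measurable lebesgue" "\<And>x. \<bar>f x\<bar> \<le> M" "bounded S" "\<And>x. f x \<noteq> 0 \<Longrightarrow> x \<in> S"
  shows "f \<in> bbs"
proof -
  have "{x. f x \<noteq> 0} \<subseteq> S" using assms(4) by blast
  moreover have "bounded (range f)"
    using assms(2) by (auto simp: bounded_iff)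
  ultimately show ?thesis using assms(1,3) bounded_subset by (auto simp: bbs_def)
qed

lemma bbsE:
  assumes "f \<in> bbs"
  obtains M R where "0 < M" "0 < R" "\<And>x. \<bar>f x\<bar> \<le> M" "\<And>x. f x \<noteq> 0 \<Longrightarrow> norm x < R"
proof -
  from assms obtain M where M: "\<forall>y\<in>range f. norm y \<le> M" "0 < M"
    by (auto simp: bbs_def bounded_pos)
  from assms obtain R where R: "\<forall>x\<in>{x. f x \<noteq> 0}. norm x \<le> R" "0 < R"
    by (auto simp: bbs_def bounded_pos)
  show ?thesis
    by (rule that[of M "R+1"]) (use M R in \<open>force+\<close>)
qed

lemma bbs_integrable:
  assumes "f \<in> bbs" shows "integrable lebesgue f"
proof -
  obtain M R where M: "0 < M" "0 < R" "\<And>x. \<bar>f x\<bar> \<le> M" "\<And>x. f x \<noteq> 0 \<Longrightarrow> norm x < R"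
    by (rule bbsE[OF assms]) blast
  have "\<bar>f x\<bar> \<le> \<bar>M * indicator (ball 0 R) x\<bar>" for x
    using M(3,4)[of x] by (cases "f x = 0") auto
  moreover have "ball 0 R \<in> lmeasurable" by simp
  then have "integrable lebesgue (\<lambda>x. M * indicator (ball 0 R) x)"
    by (intro integrable_mult_right integrable_real_indicator) (auto simp: fmeasurable_def)
  ultimately show ?thesis
    using assms by (intro Bochner_Integration.integrable_bound[of _ "\<lambda>x. M * indicator (ball 0 R) x" f])
      (auto simp: bbs_measurable)
qed

text \<open>One domination criterion from which closure under sums, differences, absolute values,
  products and restrictions follows.\<close>

lemma bbs_combine:
  assumes "f \<in> bbs" "g \<in> bbs" and h: "h \<in> borel_measurable lebesgue"
    and C: "\<And>x. \<bar>h x\<bar> \<le> C * (\<bar>f x\<bar> + \<bar>g x\<bar>)"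
  shows "h \<in> bbs"
proof -
  obtain M R where M: "0 < M" "0 < R" "\<And>x. \<bar>f x\<bar> \<le> M" "\<And>x. f x \<noteq> 0 \<Longrightarrow> norm x < R"
    by (rule bbsE[OF assms(1)]) blast
  obtain M' R' where M': "0 < M'" "0 < R'" "\<And>x. \<bar>g x\<bar> \<le> M'" "\<And>x. g x \<noteq> 0 \<Longrightarrow> norm x < R'"
    by (rule bbsE[OF assms(2)]) blast
  show ?thesis
  proof (rule bbsI[OF h, of "\<bar>C\<bar> * (M + M')" "ball 0 R \<union> ball 0 R'"])
    fix x
    have "\<bar>h x\<bar> \<le> \<bar>C\<bar> * (\<bar>f x\<bar> + \<bar>g x\<bar>)"
      using C[of x] by (rule order_trans) (intro mult_right_mono, auto)
    also have "\<dots> \<le> \<bar>C\<bar> * (M + M')"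
      by (intro mult_left_mono add_mono M M') auto
    finally show "\<bar>h x\<bar> \<le> \<bar>C\<bar> * (M + M')" .
    assume "h x \<noteq> 0"
    then have "f x \<noteq> 0 \<or> g x \<noteq> 0" using C[of x] by auto
    then show "x \<in> ball 0 R \<union> ball 0 R'" using M M' by auto
  qed auto
qed

lemma bbs_add: "f \<in> bbs \<Longrightarrow> g \<in> bbs \<Longrightarrow> (\<lambda>x. f x + g x) \<in> bbs"
  by (rule bbs_combine[of f g _ 1]) (auto dest: bbs_measurable)

lemma bbs_diff: "f \<in> bbs \<Longrightarrow> g \<in> bbs \<Longrightarrow> (\<lambda>x. f x - g x) \<in> bbs"
  by (rule bbs_combine[of f g _ 1]) (auto dest: bbs_measurable)

lemma bbs_zero: "(\<lambda>x. 0) \<in> bbs"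
  by (rule bbsI[of _ 0 "{}"]) auto

lemma bbs_sum: "(\<And>i. i \<in> I \<Longrightarrow> f i \<in> bbs) \<Longrightarrow> (\<lambda>x. \<Sum>i\<in>I. f i x) \<in> bbs"
  by (induction I rule: infinite_finite_induct) (auto intro: bbs_zero bbs_add)

lemma bbs_abs: "f \<in> bbs \<Longrightarrow> (\<lambda>x. \<bar>f x\<bar>) \<in> bbs"
  by (rule bbs_combine[of f f _ 1]) (auto dest: bbs_measurable)

lemma bbs_dominated:
  "f \<in> bbs \<Longrightarrow> g \<in> borel_measurable lebesgue \<Longrightarrow> (\<And>x. \<bar>g x\<bar> \<le> \<bar>f x\<bar>) \<Longrightarrow> g \<in> bbs"
  by (rule bbs_combine[of f "\<lambda>x. 0" _ 1]) (auto intro: bbs_zero)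

lemma bbs_indicator: "f \<in> bbs \<Longrightarrow> A \<in> sets lebesgue \<Longrightarrow> (\<lambda>x. f x * indicator A x) \<in> bbs"
  by (rule bbs_dominated[of f]) (auto simp: indicator_def bbs_measurable)

lemma bbs_const_indicator: "A \<in> sets lebesgue \<Longrightarrow> bounded A \<Longrightarrow> (\<lambda>x. c * indicator A x) \<in> bbs"
  by (rule bbsI[of _ "\<bar>c\<bar>" A]) (auto simp: indicator_def)

lemma bbs_mult:
  assumes "f \<in> bbs" "g \<in> bbs" shows "(\<lambda>x. f x * g x) \<in> bbs"
proof -
  obtain M where M: "0 < M" "\<And>x. \<bar>f x\<bar> \<le> M"
    by (rule bbsE[OF assms(1)]) blast
  show ?thesis
    by (rule bbs_combine[of g g _ M])
      (use assms M in \<open>auto simp: bbs_measurable abs_mult intro!: mult_mono\<close>)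
qed

lemma bbs_square: "f \<in> bbs \<Longrightarrow> (\<lambda>x. (f x)\<^sup>2) \<in> bbs"
  by (simp add: power2_eq_square bbs_mult)

lemma integral_le_on_set:
  assumes "f \<in> bbs" "\<And>x. 0 \<le> f x" "A \<in> sets lebesgue" "B \<in> sets lebesgue" "A \<subseteq> B"
  shows "(\<integral>x. f x * indicator A x \<partial>lebesgue) \<le> (\<integral>x. f x * indicator B x \<partial>lebesgue)"
  using assms by (intro integral_mono bbs_integrable bbs_indicator) (auto simp: indicator_def)

lemma integral_indicator_le:
  assumes "f \<in> bbs" "\<And>x. 0 \<le> f x" "A \<in> sets lebesgue"
  shows "(\<integral>x. f x * indicator A x \<partial>lebesgue) \<le> (\<integral>x. f x \<partial>lebesgue)"
  using assms by (intro integral_mono bbs_integrable bbs_indicator) (auto simp: indicator_def)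

lemma integral_indicator_nonneg:
  fixes f :: "'a \<Rightarrow> real"
  assumes "\<And>x. 0 \<le> f x"
  shows "0 \<le> (\<integral>x. f x * indicator A x \<partial>M)"
  by (intro Bochner_Integration.integral_nonneg) (simp add: assms)

lemma integral_const_indicator:
  "A \<in> lmeasurable \<Longrightarrow> (\<integral>x. c * indicator A x \<partial>lebesgue) = c * measure lebesgue A"
  by simp

text \<open>Interpolation between the supremum and the integral. The bound is required almost
  everywhere only, because off \<open>E\<close> good parts are bounded only up to a null
  set.\<close>

lemma integral_square_le:
  assumes "f \<in> bbs" "AE x in lebesgue. \<bar>f x\<bar> \<le> M"
  shows "(\<integral>x. (f x)\<^sup>2 \<partial>lebesgue) \<le> M * (\<integral>x. \<bar>f x\<bar> \<partial>lebesgue)"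
proof -
  have "(\<integral>x. (f x)\<^sup>2 \<partial>lebesgue) \<le> (\<integral>x. M * \<bar>f x\<bar> \<partial>lebesgue)"
  proof (rule integral_mono_AE)
    show "AE x in lebesgue. (f x)\<^sup>2 \<le> M * \<bar>f x\<bar>"
      using assms(2) by eventually_elim (metis abs_ge_zero mult_right_mono power2_abs power2_eq_square)
  qed (use assms in \<open>auto intro!: bbs_integrable bbs_square bbs_abs integrable_mult_right\<close>)
  then show ?thesis by simp
qed

lemma integral_square_le_measure:
  assumes "f \<in> bbs" "AE x in lebesgue. \<bar>f x\<bar> \<le> M" "0 \<le> M" "A \<in> lmeasurable" "\<And>x. f x \<noteq> 0 \<Longrightarrow> x \<in> A"
  shows "(\<integral>x. (f x)\<^sup>2 \<partial>lebesgue) \<le> M\<^sup>2 * measure lebesgue A"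
proof -
  have "(\<integral>x. (f x)\<^sup>2 \<partial>lebesgue) \<le> (\<integral>x. M\<^sup>2 * indicator A x \<partial>lebesgue)"
  proof (rule integral_mono_AE)
    show "integrable lebesgue (\<lambda>x. M\<^sup>2 * indicator A x)"
      using assms(4) by (auto simp: fmeasurable_def intro!: integrable_mult_right integrable_real_indicator)
    show "AE x in lebesgue. (f x)\<^sup>2 \<le> M\<^sup>2 * indicator A x"
      using assms(2)
    proof eventually_elim
      case (elim x)
      then show ?case using assms(5)[of x] power_mono[of "\<bar>f x\<bar>" M 2] by (cases "f x = 0") (auto simp: indicator_def)
    qed
  qed (use assms in \<open>auto intro!: bbs_integrable bbs_square\<close>)
  then show ?thesis using assms(4) by (simp add: integral_const_indicator)
qed

section \<open>Means and mean-zero parts on a dyadic cube\<close>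

definition cell_average :: "(real^'n \<Rightarrow> real) \<Rightarrow> 'n dyadic_index \<Rightarrow> real" where
  "cell_average f p = (\<integral>x. f x * indicator (dcube p) x \<partial>lebesgue) / measure lebesgue (dcube p)"

definition cell_mean :: "(real^'n \<Rightarrow> real) \<Rightarrow> 'n dyadic_index \<Rightarrow> real^'n \<Rightarrow> real" where
  "cell_mean f p x = cell_average f p * indicator (dcube p) x"

definition cell_osc :: "(real^'n \<Rightarrow> real) \<Rightarrow> 'n dyadic_index \<Rightarrow> real^'n \<Rightarrow> real" where
  "cell_osc f p x = f x * indicator (dcube p) x - cell_mean f p x"

lemma bounded_dcube [simp]: "bounded (dcube p)"
proof (rule boundedI)
  fix x assume "x \<in> dcube p"
  with dcube_diff_le[OF this corner_mem]
  show "norm x \<le> norm (corner p) + real CARD('a) * side p"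
    by (smt (verit) norm_triangle_sub)
qed

lemma cell_mean_bbs: "cell_mean f p \<in> bbs"
  using bbs_const_indicator[of "dcube p" "cell_average f p"] by (simp add: cell_mean_def[abs_def])

lemma cell_osc_bbs: "f \<in> bbs \<Longrightarrow> cell_osc f p \<in> bbs"
  unfolding cell_osc_def[abs_def] by (intro bbs_diff bbs_indicator cell_mean_bbs) auto

lemma cell_average_nonneg: "(\<And>x. 0 \<le> f x) \<Longrightarrow> 0 \<le> cell_average f p"
  by (simp add: cell_average_def)

lemma integral_cell_mean: "(\<integral>x. cell_mean f p x \<partial>lebesgue) = (\<integral>x. f x * indicator (dcube p) x \<partial>lebesgue)"
  unfolding cell_mean_def by (subst integral_const_indicator) (simp_all add: cell_average_def less_imp_neq[THEN not_sym])

lemma integral_cell_osc: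
  assumes "f \<in> bbs" shows "(\<integral>x. cell_osc f p x \<partial>lebesgue) = 0"
  unfolding cell_osc_def[abs_def]
  using assms by (subst Bochner_Integration.integral_diff)
    (auto intro!: bbs_integrable bbs_indicator cell_mean_bbs simp: integral_cell_mean)

lemma cell_osc_support: "cell_osc f p x \<noteq> 0 \<Longrightarrow> x \<in> dcube p"
  by (auto simp: cell_osc_def cell_mean_def indicator_def split: if_splits)

lemma integral_abs_cell_osc:
  assumes "f \<in> bbs" "\<And>x. 0 \<le> f x"
  shows "(\<integral>x. \<bar>cell_osc f p x\<bar> \<partial>lebesgue) \<le> 2 * (\<integral>x. f x * indicator (dcube p) x \<partial>lebesgue)"
proof -
  have "(\<integral>x. \<bar>cell_osc f p x\<bar> \<partial>lebesgue) \<le> (\<integral>x. f x * indicator (dcube p) x + cell_mean f p x \<partial>lebesgue)"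
  proof (intro integral_mono bbs_integrable bbs_abs cell_osc_bbs bbs_add bbs_indicator cell_mean_bbs)
    fix x
    have "0 \<le> cell_mean f p x"
      by (simp add: cell_mean_def cell_average_nonneg assms)
    then show "\<bar>cell_osc f p x\<bar> \<le> f x * indicator (dcube p) x + cell_mean f p x"
      using assms(2)[of x] by (auto simp: cell_osc_def indicator_def)
  qed (use assms in auto)
  also have "\<dots> = 2 * (\<integral>x. f x * indicator (dcube p) x \<partial>lebesgue)"
    using assms by (subst Bochner_Integration.integral_add)
      (auto intro!: bbs_integrable bbs_indicator cell_mean_bbs simp: integral_cell_mean)
  finally show ?thesis .
qed

section \<open>The maximal function\<close>

text \<open>The volume of a ball of radius 18 d. A ball of radius 2 d sides around the corner
  contains a cube, and a ninefold enlargement reaches the complement of the Whitney set; 18 is the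
  product.\<close>

definition ball_const :: "'n::finite itself \<Rightarrow> real" where
  "ball_const _ = unit_ball_vol (real CARD('n)) * (18 * real CARD('n)) ^ CARD('n)"

lemma measure_ball:
  fixes a :: "real^'n"
  assumes "0 \<le> r" shows "measure lebesgue (ball a r) = unit_ball_vol (real CARD('n)) * r ^ CARD('n)"
  using content_ball[OF assms, of a] by (simp add: measure_completion)

text \<open>This is the set where the uncentred Hardy-Littlewood maximal function of
  \<open>f\<close> exceeds \<open>T\<close>. Written as the union of the offending balls it is
  visibly open, and no supremum has to be formed.\<close>

definition superlevel_balls :: "(real^'n \<Rightarrow> real) \<Rightarrow> real \<Rightarrow> (real^'n) set" where
  "superlevel_balls f T = \<Union>{ball a r | a r. 0 < r \<and>
     T * measure lebesgue (ball a r) < (\<integral>x. f x * indicator (ball a r) x \<partial>lebesgue)}"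

lemma open_superlevel_balls: "open (superlevel_balls f T)"
  unfolding superlevel_balls_def by (rule open_Union) auto

lemma integral_ball_le_if_not_superlevel:
  assumes "z \<notin> superlevel_balls f T" "z \<in> ball a r"
  shows "(\<integral>x. f x * indicator (ball a r) x \<partial>lebesgue) \<le> T * measure lebesgue (ball a r)"
proof (rule ccontr)
  assume "\<not> ?thesis"
  moreover have "0 < r" using assms(2) by (metis ball_eq_empty empty_iff not_le)
  ultimately have "ball a r \<subseteq> superlevel_balls f T"
    unfolding superlevel_balls_def
    by (intro Union_upper CollectI exI[of _ a] exI[of _ r] conjI refl) auto
  with assms show False by blast
qed

lemma sum_integral_disjoint_le:
  assumes "f \<in> bbs" "\<And>x. 0 \<le> f x" "finite I" "\<And>i. i \<in> I \<Longrightarrow> A i \<in> sets lebesgue"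
    "disjoint_family_on A I" "B \<in> sets lebesgue" "\<And>i. i \<in> I \<Longrightarrow> A i \<subseteq> B"
  shows "(\<Sum>i\<in>I. \<integral>x. f x * indicator (A i) x \<partial>lebesgue) \<le> (\<integral>x. f x * indicator B x \<partial>lebesgue)"
proof -
  have [simp]: "integrable lebesgue (\<lambda>x. f x * indicator (A i) x)" if "i \<in> I" for i
    using assms that by (intro bbs_integrable bbs_indicator)
  have "(\<Sum>i\<in>I. \<integral>x. f x * indicator (A i) x \<partial>lebesgue) = (\<integral>x. (\<Sum>i\<in>I. f x * indicator (A i) x) \<partial>lebesgue)"
    by (simp add: Bochner_Integration.integral_sum)
  also have "\<dots> = (\<integral>x. f x * indicator (\<Union>i\<in>I. A i) x \<partial>lebesgue)"
    by (subst indicator_UN_disjoint[OF assms(3,5)]) (simp add: sum_distrib_left)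
  also have "\<dots> \<le> (\<integral>x. f x * indicator B x \<partial>lebesgue)"
    using assms by (intro integral_le_on_set) auto
  finally show ?thesis .
qed

text \<open>The maximal inequality: Vitali's lemma extracts disjoint offending balls whose fivefold
  enlargements cover the set, and each of these balls has volume below its share of the integral
  divided by \<open>T\<close>.\<close>

lemma superlevel_balls_lmeasurable:
  fixes f :: "real^'n \<Rightarrow> real"
  assumes f: "f \<in> bbs" "\<And>x. 0 \<le> f x" and T: "0 < T"
  shows "superlevel_balls f T \<in> lmeasurable \<and>
    measure lebesgue (superlevel_balls f T) \<le> 5 ^ CARD('n) * (\<integral>x. f x \<partial>lebesgue) / T"
proof -
  let ?I = "\<integral>x. f x \<partial>lebesgue"
  let ?v = "unit_ball_vol (real CARD('n))"
  define K where "K = {(a, r) | a r. 0 < r \<and>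
     T * measure lebesgue (ball a r) < (\<integral>x. f x * indicator (ball a r) x \<partial>lebesgue)}"
  have v: "0 < ?v" by simp
  have KD: "0 < snd i \<and> T * (?v * snd i ^ CARD('n)) \<le> (\<integral>x. f x * indicator (ball (fst i) (snd i)) x \<partial>lebesgue)"
    if "i \<in> K" for i
    using that by (auto simp: K_def measure_ball)
  \<comment> \<open>Vitali's lemma wants bounded radii. A radius above 1 is at most its d-th power,
    and the volume of an offending ball is limited by the total integral.\<close>
  define B where "B = max 1 (?I / (T * ?v))"
  have rB: "snd i \<le> B" if "i \<in> K" for i
  proof (cases "snd i \<le> 1")
    case False
    have "T * (?v * snd i ^ CARD('n)) \<le> ?I"
      using KD[OF that] integral_indicator_le[OF f, of "ball (fst i) (snd i)"] by force
    then have "snd i ^ CARD('n) \<le> ?I / (T * ?v)"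
      using T v by (simp add: field_simps)
    moreover from False have "snd i \<le> snd i ^ CARD('n)" by (intro self_le_power) auto
    ultimately show ?thesis by (simp add: B_def)
  qed (simp add: B_def)
  have cover: "superlevel_balls f T \<subseteq> (\<Union>i\<in>K. ball (fst i) (snd i))"
  proof
    fix x assume "x \<in> superlevel_balls f T"
    then obtain a r where "(a, r) \<in> K" "x \<in> ball a r"
      unfolding superlevel_balls_def K_def by blast
    then show "x \<in> (\<Union>i\<in>K. ball (fst i) (snd i))" by force
  qed
  obtain C where C: "countable C" "C \<subseteq> K"
     "pairwise (\<lambda>i j. disjnt (ball (fst i) (snd i)) (ball (fst j) (snd j))) C"
     "superlevel_balls f T \<subseteq> (\<Union>i\<in>C. ball (fst i) (5 * snd i))"
    by (rule Vitali_covering_lemma_balls[OF cover, of B]) (use rB KD in auto)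
  \<comment> \<open>The bound is uniform over finite subfamilies, so it passes to the countable
    union.\<close>
  have fin: "measure lebesgue (\<Union>i\<in>F. ball (fst i) (5 * snd i)) \<le> 5 ^ CARD('n) * ?I / T"
    if F: "finite F" "F \<subseteq> C" for F
  proof -
    have d: "disjoint_family_on (\<lambda>i. ball (fst i) (snd i)) F"
      using C(3) F(2) unfolding disjoint_family_on_def pairwise_def disjnt_def by blast
    have "measure lebesgue (\<Union>i\<in>F. ball (fst i) (5 * snd i)) \<le> (\<Sum>i\<in>F. measure lebesgue (ball (fst i) (5 * snd i)))"
      using F by (intro measure_UNION_le) auto
    also have "\<dots> = (\<Sum>i\<in>F. 5 ^ CARD('n) / T * (T * (?v * snd i ^ CARD('n))))"
      using F C(2) KD T by (intro sum.cong) (auto simp: measure_ball power_mult_distrib less_imp_le subset_eq)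
    also have "\<dots> \<le> (\<Sum>i\<in>F. 5 ^ CARD('n) / T * (\<integral>x. f x * indicator (ball (fst i) (snd i)) x \<partial>lebesgue))"
      using F C(2) KD T by (intro sum_mono mult_left_mono) auto
    also have "\<dots> \<le> 5 ^ CARD('n) / T * (\<integral>x. f x * indicator UNIV x \<partial>lebesgue)"
      unfolding sum_distrib_left[symmetric]
      using F T d by (intro mult_left_mono sum_integral_disjoint_le f) auto
    finally show ?thesis by simp
  qed
  have meas: "ball (fst i) (5 * snd i) \<in> lmeasurable" for i :: "(real^'n) \<times> real" by simp
  let ?U = "\<Union>i\<in>C. ball (fst i) (5 * snd i)"
  have U: "?U \<in> lmeasurable" "measure lebesgue ?U \<le> 5 ^ CARD('n) * ?I / T"
    by (rule fmeasurable_UN_bound[OF C(1) meas fin], assumption+)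
       (rule measure_UN_bound[OF C(1) meas fin], assumption+)
  have S: "superlevel_balls f T \<in> sets lebesgue"
    by (metis open_superlevel_balls borel_open sets_completionI_sets sets_lborel)
  with U C(4) show ?thesis
    using fmeasurableI2[OF U(1) C(4) S] measure_mono_fmeasurable[OF C(4) S U(1)] by linarith
qed

text \<open>Continuity of the measure along an enumeration of \<open>I\<close>. It replaces a
  Whitney decomposition by a finite part of it, up to a set of small measure.\<close>

lemma finite_subcover_measure:
  assumes "countable I" "\<And>i. i \<in> I \<Longrightarrow> A i \<in> sets lebesgue" "E \<in> lmeasurable"
    "(\<Union>i\<in>I. A i) = E" "0 < e"
  obtains F where "finite F" "F \<subseteq> I" "measure lebesgue (E - (\<Union>i\<in>F. A i)) < e"
proof (cases "I = {}")
  case True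
  with assms that[of "{}"] show ?thesis by simp
next
  case False
  define U where "U n = (\<Union>i\<le>n. A (from_nat_into I i))" for n :: nat
  have UE: "(\<Union>n. U n) = E"
  proof -
    have "(\<Union>n. U n) = (\<Union>n. A (from_nat_into I n))" unfolding U_def by auto
    also have "\<dots> = (\<Union>i\<in>range (from_nat_into I). A i)" by simp
    finally show ?thesis
      unfolding range_from_nat_into[OF False assms(1)] assms(4) .
  qed
  have "U n \<in> sets lebesgue" for n
    unfolding U_def using assms(2) from_nat_into[OF False] by (intro sets.finite_UN) auto
  then have U: "range U \<subseteq> sets lebesgue" by blast
  have U': "incseq U"
    unfolding U_def incseq_def by (meson UN_mono atMost_subset_iff order_refl)
  have "(\<lambda>n. measure lebesgue (U n)) \<longlonglongrightarrow> measure lebesgue (\<Union>n. U n)"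
    using assms(3) by (intro Lim_measure_incseq U U') (auto simp: UE fmeasurable_def)
  then have "eventually (\<lambda>n. measure lebesgue E - e < measure lebesgue (U n)) sequentially"
    unfolding UE using assms(5) by (intro order_tendstoD) auto
  then obtain n where n: "measure lebesgue E - e < measure lebesgue (U n)"
    by (auto simp: eventually_sequentially)
  have "measure lebesgue (E - U n) = measure lebesgue E - measure lebesgue (U n)"
    using U UE assms(3) by (intro measure_Diff) (auto simp: fmeasurable_def)
  with n have "measure lebesgue (E - U n) < e" by simp
  moreover have "U n = (\<Union>i\<in>from_nat_into I ` {..n}. A i)" by (simp add: U_def)
  moreover have "from_nat_into I ` {..n} \<subseteq> I" using from_nat_into[OF False] by blast
  ultimately show ?thesis by (metis that finite_imageI finite_atMost)
qed

section \<open>Whitney cubes\<close>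

text \<open>The 6 exceeds the 2 in \<open>near\<close>, and the difference makes near Whitney cubes
  comparable in size. For \<open>E = UNIV\<close> the distance to the empty complement is 0 by
  convention, so no cube is good.\<close>

definition whitney_good :: "(real^'n) set \<Rightarrow> 'n dyadic_index \<Rightarrow> bool" where
  "whitney_good E p \<longleftrightarrow> (\<forall>x\<in>dcube p. 6 * real CARD('n) * side p \<le> infdist x (- E))"

text \<open>Goodness is inherited by smaller cubes inside a good one, so failure at the parent alone
  expresses maximality.\<close>

definition whitney :: "(real^'n) set \<Rightarrow> ('n::finite) dyadic_index set" where
  "whitney E = {p. whitney_good E p \<and> \<not> whitney_good E (dparent p)}"

text \<open>The distance is compared with the larger side, so cubes that are not near are separated
  on the scale of both, and either of them may carry the mean-zero function.\<close>

definition near :: "('n::finite) dyadic_index \<Rightarrow> 'n dyadic_index \<Rightarrow> bool" where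
  "near p q \<longleftrightarrow> (\<exists>x\<in>dcube p. \<exists>y\<in>dcube q. norm (x - y) < 2 * real CARD('n) * max (side p) (side q))"

lemma not_near_dist:
  fixes p :: "('n::finite) dyadic_index"
  assumes "\<not> near p q" "x \<in> dcube p" "y \<in> dcube q"
  shows "2 * real CARD('n) * side p \<le> norm (x - y)" "2 * real CARD('n) * side q \<le> norm (x - y)"
proof -
  have "2 * real CARD('n) * max (side p) (side q) \<le> norm (x - y)"
    using assms by (auto simp: near_def not_less)
  moreover have "2 * real CARD('n) * side p \<le> 2 * real CARD('n) * max (side p) (side q)"
    "2 * real CARD('n) * side q \<le> 2 * real CARD('n) * max (side p) (side q)"
    by (auto intro!: mult_left_mono)
  ultimately show "2 * real CARD('n) * side p \<le> norm (x - y)" "2 * real CARD('n) * side q \<le> norm (x - y)"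
    by linarith+
qed

lemma whitney_good_subset: "whitney_good E q \<Longrightarrow> dcube p \<subseteq> dcube q \<Longrightarrow> side p \<le> side q \<Longrightarrow> whitney_good E p"
  unfolding whitney_good_def by (smt (verit, best) mult_left_mono of_nat_0_le_iff subsetD mult_nonneg_nonneg)

lemma whitney_subset:
  fixes p :: "('n::finite) dyadic_index"
  assumes "p \<in> whitney E" shows "dcube p \<subseteq> E"
proof
  fix x assume "x \<in> dcube p"
  with assms have "6 * real CARD('n) * side p \<le> infdist x (- E)"
    by (auto simp: whitney_def whitney_good_def)
  moreover have "0 < 6 * real CARD('n) * side p" by simp
  ultimately have "infdist x (- E) \<noteq> 0" by linarith
  then show "x \<in> E" by (cases "x \<in> E") auto
qed

lemma whitney_infdist_ge:
  fixes p :: "('n::finite) dyadic_index"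
  assumes "p \<in> whitney E" "x \<in> dcube p"
  shows "6 * real CARD('n) * side p \<le> infdist x (- E)"
  using assms by (auto simp: whitney_def whitney_good_def)

text \<open>In units of d times \<open>side p\<close>: the parent fails to be good, so one of its
  points is closer than 6 * 2 = 12 to the complement, and the diameter of the parent adds 2.\<close>

lemma whitney_infdist_le:
  fixes p :: "('n::finite) dyadic_index"
  assumes "p \<in> whitney E" "x \<in> dcube p"
  shows "infdist x (- E) \<le> 14 * real CARD('n) * side p"
proof -
  from assms(1) obtain y where y: "y \<in> dcube (dparent p)" "infdist y (- E) < 12 * real CARD('n) * side p"
    by (auto simp: whitney_def whitney_good_def not_le)
  have "x \<in> dcube (dparent p)" using assms(2) dcube_subset_dparent by blast
  from dcube_diff_le[OF this y(1)] have "dist x y \<le> 2 * (real CARD('n) * side p)"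
    by (simp add: dist_norm)
  with infdist_triangle[of x "-E" y] y(2) show ?thesis by linarith
qed

text \<open>If two cubes of different generations overlapped, the parent of the smaller would lie in
  the larger and inherit its goodness.\<close>

lemma disjnt_whitney:
  assumes "p \<in> whitney E" "q \<in> whitney E" "p \<noteq> q"
  shows "dcube p \<inter> dcube q = {}"
proof -
  have *: "dcube p \<inter> dcube q = {}" if pq: "p \<in> whitney E" "q \<in> whitney E" "fst p < fst q" for p q
  proof (rule ccontr)
    assume "dcube p \<inter> dcube q \<noteq> {}"
    then obtain x where x: "x \<in> dcube p" "x \<in> dcube q" by auto
    have "dcube (dparent p) \<subseteq> dcube q"
      using x pq(3) dcube_subset_dparent[of p] by (intro dcube_nested[of x]) auto
    moreover have "side (dparent p) \<le> side q"
      using pq(3) by (simp only: side_le_iff) simp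
    moreover have "whitney_good E q" using pq(2) by (simp add: whitney_def)
    ultimately have "whitney_good E (dparent p)"
      using whitney_good_subset by blast
    with pq(1) show False by (simp add: whitney_def)
  qed
  show ?thesis
  proof (cases "fst p" "fst q" rule: linorder_cases)
    case equal
    with assms(3) show ?thesis by (metis disjoint_iff mem_dcube_iff)
  qed (use *[of p q] *[of q p] assms in auto)
qed

lemma disjoint_family_whitney: "F \<subseteq> whitney E \<Longrightarrow> disjoint_family_on dcube F"
  unfolding disjoint_family_on_def using disjnt_whitney by blast

text \<open>The larger cube is at least 6 of its units away from the complement, the smaller at most
  14 of its own, and the gap is below 2 of the larger units. So (6 - 2) \<open>side q\<close> is at
  most 14 \<open>side p\<close>.\<close>

lemma near_whitney_side:
  fixes p :: "('n::finite) dyadic_index"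
  assumes "p \<in> whitney E" "q \<in> whitney E" "near p q"
  shows "2 * side q \<le> 7 * side p"
proof (cases "side p < side q")
  case True
  with assms(3) obtain x y where xy: "x \<in> dcube p" "y \<in> dcube q"
    "dist y x < 2 * real CARD('n) * side q"
    by (auto simp: near_def dist_norm norm_minus_commute max_def split: if_splits)
  have "6 * real CARD('n) * side q \<le> infdist y (- E)"
    using assms(2) xy(2) by (rule whitney_infdist_ge)
  also have "\<dots> \<le> infdist x (- E) + dist y x" by (rule infdist_triangle)
  also have "\<dots> \<le> 14 * real CARD('n) * side p + 2 * real CARD('n) * side q"
    using whitney_infdist_le[OF assms(1) xy(1)] xy(3) by linarith
  finally have "real CARD('n) * (2 * (2 * side q)) \<le> real CARD('n) * (2 * (7 * side p))"
    by (simp add: algebra_simps)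
  then show ?thesis by (simp add: mult_le_cancel_left)
next
  case False
  then show ?thesis using side_pos[of p] by linarith
qed

text \<open>In units of d times \<open>side p\<close>: the gap is below 7, twice the ratio 7/2, and
  the diameter of the other cube is at most 7/2, rounded up to 4. Their sum is the 11 of
  \<open>mem_dilI\<close>.\<close>

lemma near_whitney_subset_dil:
  fixes p :: "('n::finite) dyadic_index"
  assumes "p \<in> whitney E" "q \<in> whitney E" "near p q"
  shows "dcube q \<subseteq> dil p"
proof
  fix z assume z: "z \<in> dcube q"
  from assms(3) obtain x y where xy: "x \<in> dcube p" "y \<in> dcube q"
    "norm (x - y) < 2 * real CARD('n) * max (side p) (side q)"
    by (auto simp: near_def)
  have q: "2 * side q \<le> 7 * side p" by (rule near_whitney_side[OF assms])
  then have "2 * max (side p) (side q) \<le> 7 * side p" using side_pos[of p] by linarith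
  then have "real CARD('n) * (2 * max (side p) (side q)) \<le> real CARD('n) * (7 * side p)"
    by (rule mult_left_mono) simp
  then have "norm (x - y) < 7 * (real CARD('n) * side p)"
    using xy(3) by (simp only: mult_ac)
  moreover have "real CARD('n) * (2 * side q) \<le> real CARD('n) * (7 * side p)"
    using q by (rule mult_left_mono) simp
  then have "norm (y - z) \<le> 4 * (real CARD('n) * side p)"
    using dcube_diff_le[OF xy(2) z] mult_nonneg_nonneg[of "real CARD('n)" "side p", OF _ side_nonneg]
    by (simp only: mult_ac) linarith
  moreover have "norm (x - z) \<le> norm (x - y) + norm (y - z)"
    using norm_triangle_ineq[of "x - y" "y - z"] by simp
  ultimately have "norm (x - z) \<le> 11 * real CARD('n) * side p"
    by simp
  with xy(1) show "z \<in> dil p" by (rule mem_dilI)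
qed

lemma whitney_cover:
  fixes E :: "(real^'n) set"
  assumes "open E" "E \<noteq> UNIV" "x \<in> E"
  shows "\<exists>p\<in>whitney E. x \<in> dcube p"
proof -
  define \<delta> where "\<delta> = infdist x (- E)"
  have "\<delta> \<noteq> 0"
    using in_closed_iff_infdist_zero[of "- E" x] assms by (auto simp: \<delta>_def)
  then have \<delta>: "0 < \<delta>" using infdist_nonneg[of x "-E"] by (simp add: \<delta>_def)
  define G where "G = {k. whitney_good E (dcube_at k x)}"
  have le: "6 * real CARD('n) * 2 powi k \<le> \<delta>" if "k \<in> G" for k
    using that dcube_at_mem[of x k] by (auto simp: G_def whitney_good_def \<delta>_def)
  \<comment> \<open>7 = 6 + 1: the extra unit pays for moving from \<open>x\<close> to another point
    of the cube.\<close>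
  have G1: "k \<in> G" if "7 * real CARD('n) * 2 powi k \<le> \<delta>" for k
    unfolding G_def whitney_good_def mem_Collect_eq
  proof
    fix y assume "y \<in> dcube (dcube_at k x)"
    from dcube_diff_le[OF dcube_at_mem this]
    have "dist x y \<le> real CARD('n) * 2 powi k" by (simp add: dist_norm)
    with infdist_triangle[of x "-E" y] that
    show "6 * real CARD('n) * side (dcube_at k x) \<le> infdist y (- E)"
      by (simp add: \<delta>_def)
  qed
  obtain n :: nat where n: "7 * real CARD('n) / \<delta> < 2 ^ n"
    using real_arch_pow[of 2 "7 * real CARD('n) / \<delta>"] by auto
  obtain m :: nat where m: "\<delta> < 2 ^ m"
    using real_arch_pow[of 2 \<delta>] by auto
  have "- int n \<in> G"
    using n \<delta> by (intro G1) (simp add: power_int_minus field_simps)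
  moreover have bound: "k \<le> int m" if "k \<in> G" for k
  proof (rule ccontr)
    assume "\<not> k \<le> int m"
    then have "(2::real) powi int m \<le> 2 powi k" by (intro power_int_increasing) auto
    also have "\<dots> \<le> 6 * real CARD('n) * 2 powi k"
    proof -
      have "1 \<le> real CARD('n)" by (simp add: Suc_leI)
      then have "1 \<le> 6 * real CARD('n)" by linarith
      then show ?thesis using mult_right_mono[of 1 "6 * real CARD('n)" "2 powi k"] by simp
    qed
    finally show False using le[OF that] m by simp
  qed
  \<comment> \<open>Good generations exist and are bounded above; intersecting with a finite
    interval of integers makes \<open>Max\<close> meaningful.\<close>
  define k where "k = Max (G \<inter> {- int n..int m})"
  have k: "k \<in> G \<inter> {- int n..int m}"
    unfolding k_def using calculation bound by (intro Max_in) auto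
  have "k + 1 \<notin> G"
  proof
    assume *: "k + 1 \<in> G"
    with k bound have "k + 1 \<in> G \<inter> {- int n..int m}" by auto
    then have "k + 1 \<le> k" unfolding k_def by (intro Max_ge) auto
    then show False by simp
  qed
  moreover have "dparent (dcube_at k x) = dcube_at (k + 1) x"
  proof -
    have "x \<in> dcube (dparent (dcube_at k x))"
      using dcube_at_mem dcube_subset_dparent by blast
    then show ?thesis by (simp add: mem_dcube_iff)
  qed
  ultimately have "dcube_at k x \<in> whitney E"
    using k by (simp add: whitney_def G_def)
  then show ?thesis using dcube_at_mem by blast
qed

lemma whitney_Union:
  assumes "open E" "E \<noteq> UNIV" shows "(\<Union>p\<in>whitney E. dcube p) = E"
  using whitney_cover[OF assms] whitney_subset by blast

lemma countable_whitney: "countable (whitney E)"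
  using countable_dyadic_index by (rule countable_subset[rotated]) auto

section \<open>Control of averages by points outside the exceptional set\<close>

text \<open>The hypothesis on \<open>f\<close> says that the uncentred maximal function of \<open>f\<close> is at most \<open>T\<close> off \<open>E\<close>.\<close>
definition ball_bound :: "(real^'n \<Rightarrow> real) \<Rightarrow> (real^'n) set \<Rightarrow> real \<Rightarrow> bool" where
  "ball_bound f E T \<longleftrightarrow> (\<forall>z a r. z \<notin> E \<longrightarrow> z \<in> ball a r \<longrightarrow>
     (\<integral>x. f x * indicator (ball a r) x \<partial>lebesgue) \<le> T * measure lebesgue (ball a r))"

lemma ball_bound_whitney:
  fixes f :: "real^'n \<Rightarrow> real"
  assumes f: "f \<in> bbs" "\<And>x. 0 \<le> f x" "ball_bound f E T" and "0 \<le> T" "closed (- E)" "E \<noteq> UNIV"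
    and p: "p \<in> whitney E" and r: "2 * real CARD('n) * side p \<le> r"
  shows "(\<integral>x. f x * indicator (ball (corner p) r) x \<partial>lebesgue)
    \<le> T * unit_ball_vol (real CARD('n)) * 9 ^ CARD('n) * r ^ CARD('n)"
proof -
  let ?a = "corner p"
  have "0 < real CARD('n) * side p" by simp
  then have r0: "0 < r" using r by linarith
  have ne: "- E \<noteq> {}" using assms by auto
  obtain z where z: "z \<in> - E" "infdist ?a (- E) = dist ?a z"
    using infdist_attains_inf[OF assms(5) ne] by blast
  have "dist ?a z \<le> 14 * real CARD('n) * side p"
    using whitney_infdist_le[OF p corner_mem] z by simp
  also have "\<dots> = 7 * (2 * real CARD('n) * side p)" by simp
  also have "\<dots> \<le> 7 * r" using r by (rule mult_left_mono) simp
  also have "\<dots> < 9 * r" using r0 by simp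
  finally have "z \<in> ball ?a (9 * r)" by simp
  then have "(\<integral>x. f x * indicator (ball ?a (9 * r)) x \<partial>lebesgue) \<le> T * measure lebesgue (ball ?a (9 * r))"
    using f(3) z(1) unfolding ball_bound_def by blast
  moreover have "(\<integral>x. f x * indicator (ball ?a r) x \<partial>lebesgue) \<le> (\<integral>x. f x * indicator (ball ?a (9 * r)) x \<partial>lebesgue)"
    using r0 by (intro integral_le_on_set f) auto
  ultimately show ?thesis
    using r0 by (simp add: measure_ball power_mult_distrib)
qed

lemma cell_average_le:
  fixes f :: "real^'n \<Rightarrow> real"
  assumes f: "f \<in> bbs" "\<And>x. 0 \<le> f x" "ball_bound f E T" and "0 \<le> T" "closed (- E)" "E \<noteq> UNIV"
    and p: "p \<in> whitney E"
  shows "cell_average f p \<le> ball_const TYPE('n) * T"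
proof -
  let ?r = "2 * real CARD('n) * side p"
  have "0 < real CARD('n) * side p" by simp
  have "dcube p \<subseteq> ball (corner p) ?r"
  proof
    fix x assume "x \<in> dcube p"
    from dcube_diff_le[OF corner_mem this] \<open>0 < real CARD('n) * side p\<close>
    have "norm (corner p - x) < ?r" by linarith
    then show "x \<in> ball (corner p) ?r" by (simp add: dist_norm)
  qed
  then have "(\<integral>x. f x * indicator (dcube p) x \<partial>lebesgue) \<le> (\<integral>x. f x * indicator (ball (corner p) ?r) x \<partial>lebesgue)"
    by (intro integral_le_on_set f) auto
  also have "\<dots> \<le> T * unit_ball_vol (real CARD('n)) * 9 ^ CARD('n) * ?r ^ CARD('n)"
    by (rule ball_bound_whitney[OF assms order_refl])
  also have "\<dots> = ball_const TYPE('n) * T * side p ^ CARD('n)"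
    by (simp add: ball_const_def power_mult_distrib flip: power_mult_distrib[of 2 9])
      (simp add: power_mult_distrib[symmetric])
  finally show ?thesis
    by (simp add: cell_average_def divide_le_eq)
qed

lemma ball_const_pos: "0 < ball_const TYPE('n::finite)"
  by (simp add: ball_const_def)

lemma sum_measure_disjoint_le:
  assumes "finite I" "\<And>i. i \<in> I \<Longrightarrow> A i \<in> lmeasurable" "disjoint_family_on A I"
    "B \<in> lmeasurable" "\<And>i. i \<in> I \<Longrightarrow> A i \<subseteq> B"
  shows "(\<Sum>i\<in>I. measure lebesgue (A i)) \<le> measure lebesgue B"
proof -
  have "(\<Sum>i\<in>I. measure lebesgue (A i)) = measure lebesgue (\<Union>i\<in>I. A i)"
    using assms by (intro measure_finite_Union[symmetric])
      (auto simp: fmeasurable_def simp del: emeasure_eq_ennreal_measure dest!: less_imp_neq)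
  also have "\<dots> \<le> measure lebesgue B"
    using assms by (intro measure_mono_fmeasurable) (auto intro: fmeasurableD)
  finally show ?thesis .
qed

text \<open>A substitute for Lebesgue's differentiation theorem: cover the bad set by an open set of
  almost the same measure and sum the ball averages over its Whitney cubes.\<close>
lemma AE_le_of_ball_bound:
  fixes f :: "real^'n \<Rightarrow> real"
  assumes f: "f \<in> bbs" "\<And>x. 0 \<le> f x" "ball_bound f E T" and T: "0 \<le> T" and E: "E \<in> sets lebesgue"
  shows "AE x in lebesgue. x \<notin> E \<longrightarrow> f x \<le> ball_const TYPE('n) * T"
proof -
  define t where "t = ball_const TYPE('n) * T"
  have t: "0 \<le> t" using T ball_const_pos[where 'n='n] by (simp add: t_def)
  have fm [measurable]: "f \<in> borel_measurable lebesgue" by (rule bbs_measurable[OF f(1)])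
  note E [measurable]
  define G where "G = {x. x \<notin> E \<and> t < f x}"
  obtain M R where M: "0 < M" "0 < R" "\<And>x. \<bar>f x\<bar> \<le> M" "\<And>x. f x \<noteq> 0 \<Longrightarrow> norm x < R"
    by (rule bbsE[OF f(1)]) blast
  have G [measurable]: "G \<in> sets lebesgue"
  proof -
    have *: "{x \<in> space lebesgue. t < f x} \<in> sets lebesgue" by measurable
    have "{x \<in> space lebesgue. t < f x} - E = G" by (auto simp: G_def)
    with sets.Diff[OF * E] show "G \<in> sets lebesgue" by (simp only:)
  qed
  have "G \<subseteq> ball 0 R" using t M(4) by (force simp: G_def)
  then have Glm: "G \<in> lmeasurable" using G by (rule fmeasurableI2[rotated]) simp
  have "(\<integral>x. f x * indicator G x \<partial>lebesgue) \<le> t * measure lebesgue G + e" if e: "0 < e" for e :: real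
  proof -
    \<comment> \<open>The surplus of \<open>U\<close> over \<open>G\<close> will cost
      \<open>t * e'\<close> and the part of \<open>U\<close> left uncovered \<open>M * e'\<close>,
      together \<open>e\<close>.\<close>
    define e' where "e' = e / (t + M)"
    have e': "0 < e'" using e t M by (simp add: e'_def)
    obtain U where U: "open U" "G \<subseteq> U" "U - G \<in> lmeasurable" "emeasure lebesgue (U - G) < ennreal e'"
      using sets_lebesgue_outer_open[OF G e'] .
    have Ul: "U \<in> lmeasurable"
      using fmeasurable.Un[OF Glm U(3)] U(2) by (simp add: Un_absorb1)
    have "U \<noteq> UNIV" using Ul not_measurable_UNIV by blast
    have mU: "measure lebesgue U \<le> measure lebesgue G + e'"
    proof -
      have "measure lebesgue U = measure lebesgue G + measure lebesgue (U - G)"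
        using U(2) Glm Ul by (simp add: measurable_measure_Diff fmeasurableD)
      moreover have "measure lebesgue (U - G) < e'"
        using U(3,4) e' by (simp add: emeasure_eq_measure2 ennreal_less_iff)
      ultimately show ?thesis by simp
    qed
    obtain F where F: "finite F" "F \<subseteq> whitney U" "measure lebesgue (U - (\<Union>p\<in>F. dcube p)) < e'"
      by (rule finite_subcover_measure[OF countable_whitney _ Ul whitney_Union[OF U(1) \<open>U \<noteq> UNIV\<close>] e']) auto
    let ?W = "U - (\<Union>p\<in>F. dcube p)"
    have W: "?W \<in> lmeasurable" using Ul F(1) by (intro fmeasurable_Diff) auto
    \<comment> \<open>Each cube meeting \<open>G\<close> contains a point off \<open>E\<close>, and
      there \<open>ball_bound\<close> applies to a ball around the cube.\<close>
    define H where "H = {p\<in>F. dcube p \<inter> G \<noteq> {}}"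
    have H: "finite H" "H \<subseteq> whitney U" using F by (auto simp: H_def)
    have cube: "(\<integral>x. f x * indicator (dcube p) x \<partial>lebesgue) \<le> t * measure lebesgue (dcube p)" if "p \<in> H" for p
    proof -
      from that obtain x where x: "x \<in> dcube p" "x \<notin> E" by (auto simp: H_def G_def)
      let ?r = "2 * real CARD('n) * side p"
      have r: "0 < real CARD('n) * side p" by simp
      have "dcube p \<subseteq> ball x ?r"
      proof
        fix y assume "y \<in> dcube p"
        from dcube_diff_le[OF x(1) this] r have "norm (x - y) < ?r" by linarith
        then show "y \<in> ball x ?r" by (simp add: dist_norm)
      qed
      then have "(\<integral>x. f x * indicator (dcube p) x \<partial>lebesgue) \<le> (\<integral>y. f y * indicator (ball x ?r) y \<partial>lebesgue)"
        by (intro integral_le_on_set f) auto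
      also have "\<dots> \<le> T * measure lebesgue (ball x ?r)"
      proof -
        have "x \<in> ball x ?r" using r by simp
        then show ?thesis using f(3) x(2) unfolding ball_bound_def by blast
      qed
      also have "\<dots> = T * (unit_ball_vol (real CARD('n)) * (2 * real CARD('n)) ^ CARD('n)) * side p ^ CARD('n)"
        by (simp add: measure_ball power_mult_distrib)
      also have "\<dots> \<le> T * ball_const TYPE('n) * side p ^ CARD('n)"
        unfolding ball_const_def using T by (intro mult_right_mono mult_left_mono power_mono) auto
      finally show ?thesis by (simp add: t_def mult_ac)
    qed
    have int: "integrable lebesgue (\<lambda>x. M * indicator ?W x)"
      "integrable lebesgue (\<lambda>x. f x * indicator (dcube p) x)" for p
      using W by (intro integrable_mult_right integrable_real_indicator, simp_all add: fmeasurable_def)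
        (intro bbs_integrable bbs_indicator f, simp)
    have "(\<integral>x. f x * indicator G x \<partial>lebesgue) \<le>
      (\<integral>x. (\<Sum>p\<in>H. f x * indicator (dcube p) x) + M * indicator ?W x \<partial>lebesgue)"
    proof (intro integral_mono Bochner_Integration.integrable_add Bochner_Integration.integrable_sum int
        bbs_integrable bbs_indicator f G)
      fix x
      have nn: "0 \<le> (\<Sum>p\<in>H. f x * indicator (dcube p) x)" "0 \<le> M * indicator ?W x"
        using f M by (auto intro!: sum_nonneg)
      show "f x * indicator G x \<le> (\<Sum>p\<in>H. f x * indicator (dcube p) x) + M * indicator ?W x"
      proof (cases "x \<in> G")
        case True
        show ?thesis
        proof (cases "\<exists>p\<in>F. x \<in> dcube p")
          case True
          then obtain p where p: "p \<in> H" "x \<in> dcube p" using \<open>x \<in> G\<close> by (auto simp: H_def)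
          have "f x * indicator (dcube p) x \<le> (\<Sum>p\<in>H. f x * indicator (dcube p) x)"
            using p H f by (intro member_le_sum) auto
          with p nn True \<open>x \<in> G\<close> show ?thesis by simp
        next
          case False
          then have "x \<in> ?W" using \<open>x \<in> G\<close> U(2) by auto
          with nn M(3)[of x] \<open>x \<in> G\<close> show ?thesis by simp
        qed
      qed (use nn in simp)
    qed
    also have "\<dots> = (\<Sum>p\<in>H. \<integral>x. f x * indicator (dcube p) x \<partial>lebesgue) + M * measure lebesgue ?W"
      using W int by (simp add: Bochner_Integration.integral_add Bochner_Integration.integral_sum)
    also have "\<dots> \<le> (\<Sum>p\<in>H. t * measure lebesgue (dcube p)) + M * e'"
      using cube F(3) M(1) by (intro add_mono sum_mono mult_left_mono) auto
    also have "\<dots> \<le> t * measure lebesgue U + M * e'"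
    proof -
      have "(\<Sum>p\<in>H. measure lebesgue (dcube p)) \<le> measure lebesgue U"
        using H(2) by (intro sum_measure_disjoint_le H(1) Ul disjoint_family_whitney[OF H(2)])
          (auto dest: whitney_subset[THEN subsetD, rotated])
      then show ?thesis using t by (auto simp: sum_distrib_left[symmetric] intro: mult_left_mono)
    qed
    also have "\<dots> \<le> t * (measure lebesgue G + e') + M * e'"
      using mU t by (intro add_right_mono mult_left_mono)
    also have "\<dots> = t * measure lebesgue G + e"
    proof -
      have "(t + M) * e' = e" using t M(1) by (simp add: e'_def)
      then show ?thesis by (simp add: algebra_simps)
    qed
    finally show ?thesis .
  qed
  then have "(\<integral>x. f x * indicator G x \<partial>lebesgue) \<le> t * measure lebesgue G"
    by (rule field_le_epsilon)
  moreover have int: "integrable lebesgue (\<lambda>x. f x * indicator G x)" "integrable lebesgue (\<lambda>x. t * indicator G x)"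
    using Glm by (intro bbs_integrable bbs_indicator f G,
      intro integrable_mult_right integrable_real_indicator, simp_all add: fmeasurable_def)
  ultimately have le: "(\<integral>x. f x * indicator G x - t * indicator G x \<partial>lebesgue) \<le> 0"
    using Glm by (simp add: Bochner_Integration.integral_diff)
  \<comment> \<open>The difference is strictly positive on \<open>G\<close> and 0 elsewhere, so a
    vanishing integral makes \<open>G\<close> a null set.\<close>
  have nn: "0 \<le> f x * indicator G x - t * indicator G x" for x
    by (simp add: G_def indicator_def)
  then have "(\<integral>x. f x * indicator G x - t * indicator G x \<partial>lebesgue) = 0"
    using le by (intro antisym Bochner_Integration.integral_nonneg)
  then have "AE x in lebesgue. f x * indicator G x - t * indicator G x = 0"
    using int nn by (subst (asm) integral_nonneg_eq_0_iff_AE) auto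
  then show ?thesis
    by eventually_elim (auto simp: G_def t_def not_less indicator_def split: if_splits)
qed

section \<open>Bilinear forms and stopping cubes\<close>

text \<open>Absorbs the numerical factor of \<open>ball_bound_whitney\<close> into
  \<open>ball_const\<close>, so that one constant serves cubes as well as large balls.\<close>

lemma ball_bound_corner:
  fixes f :: "real^'n \<Rightarrow> real"
  assumes "f \<in> bbs" "\<And>x. 0 \<le> f x" "ball_bound f E T" and T: "0 \<le> T" "closed (- E)" "E \<noteq> UNIV"
    and "p \<in> whitney E" and r: "2 * real CARD('n) * side p \<le> r"
  shows "(\<integral>x. f x * indicator (ball (corner p) r) x \<partial>lebesgue) \<le> ball_const TYPE('n) * T * r ^ CARD('n)"
proof -
  have "0 < real CARD('n) * side p" by simp
  then have r0: "0 \<le> r" using r by linarith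
  have "1 \<le> real CARD('n)" by (simp add: Suc_leI)
  then have "9 \<le> 18 * real CARD('n)" by linarith
  then have "(9::real) ^ CARD('n) \<le> (18 * real CARD('n)) ^ CARD('n)" by (intro power_mono) auto
  then have "unit_ball_vol (real CARD('n)) * 9 ^ CARD('n) \<le> ball_const TYPE('n)"
    unfolding ball_const_def by (intro mult_left_mono) auto
  then have "(unit_ball_vol (real CARD('n)) * 9 ^ CARD('n)) * (T * r ^ CARD('n)) \<le> ball_const TYPE('n) * (T * r ^ CARD('n))"
    using T r0 by (intro mult_right_mono) auto
  with ball_bound_whitney[OF assms] show ?thesis by (simp add: mult_ac)
qed

section \<open>Good and oscillating parts over finitely many Whitney cubes\<close>

lemma sum_disjoint_indicator_le:
  fixes c :: "'i \<Rightarrow> real"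
  assumes "finite J" "disjoint_family_on A J" "\<And>i. i \<in> J \<Longrightarrow> 0 \<le> c i" "\<And>i. i \<in> J \<Longrightarrow> c i \<le> K" "0 \<le> K"
  shows "(\<Sum>i\<in>J. c i * indicator (A i) x) \<le> K"
proof (cases "\<exists>i\<in>J. x \<in> A i")
  case True
  then obtain i where i: "i \<in> J" "x \<in> A i" by blast
  have "x \<notin> A j" if "j \<in> J - {i}" for j
    using that i assms(2) by (auto simp: disjoint_family_on_def)
  then have "(\<Sum>j\<in>J. c j * indicator (A j) x) = c i"
    using i assms(1) by (subst sum.remove[of J i]) (auto intro!: sum.neutral)
  then show ?thesis using assms i by simp
next
  case False
  then show ?thesis using assms by (subst sum.neutral) auto
qed

lemma cell_mean_add_osc: "cell_mean f p x + cell_osc f p x = f x * indicator (dcube p) x"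
  by (simp add: cell_osc_def)

text \<open>The good function of the Calderon-Zygmund decomposition. \<open>J\<close> is a parameter
  because against a single oscillation only the means over far cubes occur.\<close>

definition good_part :: "(real^'n \<Rightarrow> real) \<Rightarrow> (real^'n) set \<Rightarrow> ('n::finite) dyadic_index set \<Rightarrow> real^'n \<Rightarrow> real" where
  "good_part f E J x = f x * indicator (- E) x + (\<Sum>p\<in>J. cell_mean f p x)"

text \<open>\<open>vanish\<close> says that the part of \<open>E\<close> missed by the finite family
  has already been removed from \<open>f\<close>, which makes the decomposition a finite sum. Both
  functions will enter with the same \<open>E\<close> and \<open>F\<close> but with their own
  thresholds.\<close>

locale stopping_cubes =
  fixes f :: "real^'n \<Rightarrow> real" and E :: "(real^'n) set" and T :: real and F :: "'n dyadic_index set"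
  assumes f: "f \<in> bbs" and f_nonneg: "\<And>x. 0 \<le> f x"
    and E: "open E" "E \<in> lmeasurable" and T: "0 \<le> T" and bb: "ball_bound f E T"
    and F: "finite F" "F \<subseteq> whitney E" and vanish: "\<And>x. x \<in> E \<Longrightarrow> x \<notin> (\<Union>p\<in>F. dcube p) \<Longrightarrow> f x = 0"
begin

lemma E_sets: "E \<in> sets lebesgue" "- E \<in> sets lebesgue"
  using fmeasurableD[OF E(2)] by (auto simp: Compl_in_sets_lebesgue)

lemma E_ne: "E \<noteq> UNIV"
  using E(2) not_measurable_UNIV by blast

lemma closed_compl: "closed (- E)"
  using E(1) by auto

lemma decompose: "f x = f x * indicator (- E) x + (\<Sum>p\<in>F. cell_mean f p x + cell_osc f p x)"
proof -
  have "(\<Sum>p\<in>F. f x * indicator (dcube p) x) = f x * indicator (\<Union>p\<in>F. dcube p) x"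
    by (subst indicator_UN_disjoint[OF F(1) disjoint_family_whitney[OF F(2)]]) (simp add: sum_distrib_left)
  moreover have "(\<Union>p\<in>F. dcube p) \<subseteq> E" using F(2) whitney_subset by blast
  ultimately show ?thesis
    using vanish[of x] by (auto simp: cell_mean_add_osc indicator_def)
qed

lemma outside_bbs: "(\<lambda>x. f x * indicator (- E) x) \<in> bbs"
  using f E_sets by (intro bbs_indicator)

lemma good_part_bbs: "good_part f E J \<in> bbs"
  unfolding good_part_def[abs_def] by (intro bbs_add outside_bbs bbs_sum cell_mean_bbs)

lemma good_part_nonneg: "0 \<le> good_part f E J x"
  unfolding good_part_def cell_mean_def
  by (intro add_nonneg_nonneg sum_nonneg mult_nonneg_nonneg cell_average_nonneg f_nonneg) auto

lemma average_le: "p \<in> F \<Longrightarrow> cell_average f p \<le> ball_const TYPE('n) * T"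
  using F(2) by (intro cell_average_le[OF f f_nonneg bb T closed_compl E_ne]) auto

text \<open>Off \<open>E\<close> this is the differentiation argument of
  \<open>AE_le_of_ball_bound\<close>; on \<open>E\<close> at most one mean is nonzero, and it is an
  average over a Whitney cube.\<close>

lemma good_part_AE_le:
  assumes "J \<subseteq> F"
  shows "AE x in lebesgue. good_part f E J x \<le> ball_const TYPE('n) * T"
  using AE_le_of_ball_bound[OF f f_nonneg bb T E_sets(1)]
proof eventually_elim
  case (elim x)
  have J: "finite J" "J \<subseteq> whitney E" using assms F by (auto intro: finite_subset)
  have K: "0 \<le> ball_const TYPE('n) * T" using T ball_const_pos[where 'n='n] by simp
  show ?case
  proof (cases "x \<in> E")
    case True
    have "(\<Sum>p\<in>J. cell_average f p * indicator (dcube p) x) \<le> ball_const TYPE('n) * T"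
      using assms by (intro sum_disjoint_indicator_le J disjoint_family_whitney[OF J(2)] K
          cell_average_nonneg f_nonneg average_le) auto
    with True show ?thesis by (simp add: good_part_def cell_mean_def)
  next
    case False
    then have "x \<notin> dcube p" if "p \<in> J" for p using that J(2) whitney_subset by blast
    then have "(\<Sum>p\<in>J. cell_mean f p x) = 0" by (intro sum.neutral) (auto simp: cell_mean_def)
    then show ?thesis using elim False by (simp add: good_part_def)
  qed
qed

lemma integral_good_part_le: "(\<integral>x. good_part f E F x \<partial>lebesgue) \<le> (\<integral>x. f x \<partial>lebesgue)"
proof -
  have i: "integrable lebesgue (\<lambda>x. f x * indicator (- E) x)" "integrable lebesgue (cell_mean f p)"
    "integrable lebesgue (\<lambda>x. f x * indicator (dcube p) x)" for p
    by (auto intro!: bbs_integrable outside_bbs cell_mean_bbs bbs_indicator f)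
  have "(\<integral>x. good_part f E F x \<partial>lebesgue)
      = (\<integral>x. f x * indicator (- E) x + (\<Sum>p\<in>F. f x * indicator (dcube p) x) \<partial>lebesgue)"
    unfolding good_part_def using i
    by (simp add: Bochner_Integration.integral_add Bochner_Integration.integral_sum integral_cell_mean)
  also have "\<dots> = (\<integral>x. f x \<partial>lebesgue)"
    using decompose by (simp add: cell_mean_add_osc)
  finally show ?thesis by simp
qed

lemma good_part_square_le:
  "(\<integral>x. (good_part f E F x)\<^sup>2 \<partial>lebesgue) \<le> ball_const TYPE('n) * T * (\<integral>x. f x \<partial>lebesgue)"
proof -
  have "(\<integral>x. (good_part f E F x)\<^sup>2 \<partial>lebesgue) \<le> ball_const TYPE('n) * T * (\<integral>x. \<bar>good_part f E F x\<bar> \<partial>lebesgue)"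
    using good_part_AE_le[of F] good_part_nonneg by (intro integral_square_le good_part_bbs) simp
  also have "\<dots> \<le> ball_const TYPE('n) * T * (\<integral>x. f x \<partial>lebesgue)"
    using integral_good_part_le good_part_nonneg T ball_const_pos[where 'n='n]
    by (intro mult_left_mono) auto
  finally show ?thesis .
qed

lemma integral_abs_osc_sum:
  "(\<Sum>p\<in>F. \<integral>x. \<bar>cell_osc f p x\<bar> \<partial>lebesgue) \<le> 2 * (\<integral>x. f x \<partial>lebesgue)"
proof -
  have "(\<Sum>p\<in>F. \<integral>x. \<bar>cell_osc f p x\<bar> \<partial>lebesgue) \<le> (\<Sum>p\<in>F. 2 * (\<integral>x. f x * indicator (dcube p) x \<partial>lebesgue))"
    by (intro sum_mono integral_abs_cell_osc f f_nonneg)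
  also have "\<dots> \<le> 2 * (\<integral>x. f x * indicator UNIV x \<partial>lebesgue)"
    unfolding sum_distrib_left[symmetric]
    by (intro mult_left_mono sum_integral_disjoint_le f f_nonneg F disjoint_family_whitney[OF F(2)]) auto
  finally show ?thesis by simp
qed

text \<open>Written as half of a radius to match \<open>separated\<close> with that radius as
  \<rho>.\<close>

lemma osc_support:
  assumes "cell_osc f p y \<noteq> 0"
  shows "norm (y - corner p) \<le> (2 * real CARD('n) * side p) / 2"
  using dcube_diff_le[OF cell_osc_support[OF assms] corner_mem] by simp

lemma outside_dist:
  assumes "p \<in> F" "x \<notin> E"
  shows "2 * real CARD('n) * side p \<le> norm (x - corner p)"
proof -
  have "6 * real CARD('n) * side p \<le> infdist (corner p) (- E)"
    using assms F by (intro whitney_infdist_ge) auto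
  also have "\<dots> \<le> dist (corner p) x"
    using assms by (intro infdist_le) auto
  finally have "6 * (real CARD('n) * side p) \<le> norm (x - corner p)"
    by (simp add: dist_norm norm_minus_commute)
  moreover have "0 < real CARD('n) * side p" by simp
  ultimately show ?thesis by linarith
qed

lemma integral_good_part_ball_le:
  assumes "J \<subseteq> F" "0 \<le> r"
  shows "(\<integral>x. good_part f E J x * indicator (ball a r) x \<partial>lebesgue)
    \<le> ball_const TYPE('n) * T * unit_ball_vol (real CARD('n)) * r ^ CARD('n)"
proof -
  have "(\<integral>x. good_part f E J x * indicator (ball a r) x \<partial>lebesgue)
      \<le> (\<integral>x. (ball_const TYPE('n) * T) * indicator (ball a r) x \<partial>lebesgue)"
  proof (rule integral_mono_AE)
    show "AE x in lebesgue. good_part f E J x * indicator (ball a r) x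
        \<le> (ball_const TYPE('n) * T) * indicator (ball a r) x"
      using good_part_AE_le[OF assms(1)] by eventually_elim (auto simp: indicator_def)
  qed (rule bbs_integrable, rule bbs_indicator[OF good_part_bbs], simp,
      rule bbs_integrable, rule bbs_const_indicator, auto)
  also have "\<dots> = ball_const TYPE('n) * T * unit_ball_vol (real CARD('n)) * r ^ CARD('n)"
    using assms(2) by (subst integral_const_indicator) (auto simp: measure_ball)
  finally show ?thesis .
qed

end

text \<open>What the stopping argument knows of the operator. In \<open>separated\<close>,
  \<open>b\<close> is a mean-zero function near \<open>a\<close> and \<open>u\<close> lives away
  from it; the size of \<open>u\<close> enters only through ball integrals from scale \<rho> on.
  Bounding both orders of the arguments stands in for an adjoint operator.\<close>

locale cz_form =
  fixes B :: "(real^'n \<Rightarrow> real) \<Rightarrow> (real^'n \<Rightarrow> real) \<Rightarrow> complex" and N C :: real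
  assumes N_nonneg: "0 \<le> N" and C_nonneg: "0 \<le> C"
    and add_left: "\<And>f f' g. f \<in> bbs \<Longrightarrow> f' \<in> bbs \<Longrightarrow> g \<in> bbs \<Longrightarrow> B (\<lambda>x. f x + f' x) g = B f g + B f' g"
    and add_right: "\<And>f g g'. f \<in> bbs \<Longrightarrow> g \<in> bbs \<Longrightarrow> g' \<in> bbs \<Longrightarrow> B f (\<lambda>x. g x + g' x) = B f g + B f g'"
    and bound: "\<And>f g. f \<in> bbs \<Longrightarrow> g \<in> bbs \<Longrightarrow>
      cmod (B f g) \<le> N * (sqrt (\<integral>x. (f x)\<^sup>2 \<partial>lebesgue) * sqrt (\<integral>x. (g x)\<^sup>2 \<partial>lebesgue))"
    and separated: "\<And>b u a \<rho> \<Lambda>. \<lbrakk>b \<in> bbs; u \<in> bbs; (\<integral>x. b x \<partial>lebesgue) = 0; 0 < \<rho>;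
      \<And>y. b y \<noteq> 0 \<Longrightarrow> norm (y - a) \<le> \<rho> / 2; \<And>x. u x \<noteq> 0 \<Longrightarrow> \<rho> \<le> norm (x - a); \<And>x. 0 \<le> u x; 0 \<le> \<Lambda>;
      \<And>r. \<rho> \<le> r \<Longrightarrow> (\<integral>x. u x * indicator (ball a r) x \<partial>lebesgue) \<le> \<Lambda> * r ^ CARD('n)\<rbrakk>
      \<Longrightarrow> cmod (B b u) \<le> C * \<Lambda> * (\<integral>x. \<bar>b x\<bar> \<partial>lebesgue) \<and> cmod (B u b) \<le> C * \<Lambda> * (\<integral>x. \<bar>b x\<bar> \<partial>lebesgue)"
begin

lemmas far_left = separated[THEN conjunct1] and far_right = separated[THEN conjunct2]

lemma zero_left: "g \<in> bbs \<Longrightarrow> B (\<lambda>x. 0) g = 0"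
  using add_left[OF bbs_zero bbs_zero, of g] by simp

lemma zero_right: "f \<in> bbs \<Longrightarrow> B f (\<lambda>x. 0) = 0"
  using add_right[OF _ bbs_zero bbs_zero, of f] by simp

lemma sum_left: "(\<And>i. i \<in> I \<Longrightarrow> f i \<in> bbs) \<Longrightarrow> g \<in> bbs \<Longrightarrow> B (\<lambda>x. \<Sum>i\<in>I. f i x) g = (\<Sum>i\<in>I. B (f i) g)"
  by (induction I rule: infinite_finite_induct) (auto simp: zero_left add_left bbs_sum)

lemma sum_right: "f \<in> bbs \<Longrightarrow> (\<And>i. i \<in> I \<Longrightarrow> g i \<in> bbs) \<Longrightarrow> B f (\<lambda>x. \<Sum>i\<in>I. g i x) = (\<Sum>i\<in>I. B f (g i))"
  by (induction I rule: infinite_finite_induct) (auto simp: zero_right add_right bbs_sum)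

lemma bound_le:
  assumes "f \<in> bbs" "g \<in> bbs" "(\<integral>x. (f x)\<^sup>2 \<partial>lebesgue) \<le> X" "(\<integral>x. (g x)\<^sup>2 \<partial>lebesgue) \<le> Y"
  shows "cmod (B f g) \<le> N * (sqrt X * sqrt Y)"
proof -
  have "sqrt (\<integral>x. (f x)\<^sup>2 \<partial>lebesgue) * sqrt (\<integral>x. (g x)\<^sup>2 \<partial>lebesgue) \<le> sqrt X * sqrt Y"
    using assms order_trans[OF Bochner_Integration.integral_nonneg assms(3)] by (intro mult_mono) auto
  with bound[OF assms(1,2)] N_nonneg show ?thesis
    by (meson mult_left_mono order_trans)
qed

text \<open>Pure bilinearity. The oscillations of the first function take the whole far part of the
  second, so the remaining far terms pair means of the first with oscillations of the second, and no
  far pair is counted twice. The mean pairs are completed to one global term, from which the near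
  ones are subtracted again.\<close>

lemma splitting:
  assumes F: "finite F" and h: "h \<in> bbs" "h' \<in> bbs"
    and p: "\<And>i. p i \<in> bbs" "\<And>i. b i \<in> bbs" "\<And>i. q i \<in> bbs" "\<And>i. c i \<in> bbs"
  shows "B (\<lambda>x. h x + (\<Sum>i\<in>F. p i x + b i x)) (\<lambda>x. h' x + (\<Sum>j\<in>F. q j x + c j x))
      - (\<Sum>i\<in>F. B (\<lambda>x. p i x + b i x) (\<lambda>x. \<Sum>j\<in>{j\<in>F. R i j}. q j x + c j x))
    = B (\<lambda>x. h x + (\<Sum>i\<in>F. p i x)) (\<lambda>x. h' x + (\<Sum>j\<in>F. q j x))
      - (\<Sum>i\<in>F. B (p i) (\<lambda>x. \<Sum>j\<in>{j\<in>F. R i j}. q j x))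
      + (\<Sum>i\<in>F. B (b i) (\<lambda>x. h' x + (\<Sum>j\<in>{j\<in>F. \<not> R i j}. q j x + c j x)))
      + (\<Sum>j\<in>F. B (\<lambda>x. h x + (\<Sum>i\<in>{i\<in>F. \<not> R i j}. p i x)) (c j))"
proof -
  let ?S = "\<lambda>X. \<Sum>i\<in>F. \<Sum>j\<in>F. (X i j :: complex)"
  let ?n = "\<lambda>X. \<Sum>i\<in>F. \<Sum>j\<in>{j\<in>F. R i j}. (X i j :: complex)"
  let ?f = "\<lambda>X. \<Sum>i\<in>F. \<Sum>j\<in>{j\<in>F. \<not> R i j}. (X i j :: complex)"
  have nf: "?S X = ?n X + ?f X" for X
  proof -
    have "(\<Sum>j\<in>F. X i j) = (\<Sum>j\<in>{j\<in>F. R i j}. X i j) + (\<Sum>j\<in>{j\<in>F. \<not> R i j}. X i j)" for i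
      using F by (subst sum.union_disjoint[symmetric]) (auto intro!: sum.cong)
    then show ?thesis by (simp add: sum.distrib)
  qed
  have swap: "(\<Sum>j\<in>F. \<Sum>i\<in>{i\<in>F. \<not> R i j}. X i j) = ?f X" for X :: "_ \<Rightarrow> _ \<Rightarrow> complex"
    using F by (subst sum.swap_restrict) auto
  have swap': "(\<Sum>j\<in>F. \<Sum>i\<in>F. X i j) = ?S X" for X :: "_ \<Rightarrow> _ \<Rightarrow> complex"
    by (rule sum.swap)
  note mem = bbs_add bbs_sum h p
  have L: "B (\<lambda>x. h x + (\<Sum>i\<in>F. p i x + b i x)) (\<lambda>x. h' x + (\<Sum>j\<in>F. q j x + c j x))
    = B h h' + (\<Sum>j\<in>F. B h (q j)) + (\<Sum>j\<in>F. B h (c j)) + (\<Sum>i\<in>F. B (p i) h') + (\<Sum>i\<in>F. B (b i) h')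
      + ?S (\<lambda>i j. B (p i) (q j)) + ?S (\<lambda>i j. B (p i) (c j)) + ?S (\<lambda>i j. B (b i) (q j)) + ?S (\<lambda>i j. B (b i) (c j))"
    by (simp add: add_left add_right sum_left sum_right mem sum.distrib)
  have L2: "(\<Sum>i\<in>F. B (\<lambda>x. p i x + b i x) (\<lambda>x. \<Sum>j\<in>{j\<in>F. R i j}. q j x + c j x))
    = ?n (\<lambda>i j. B (p i) (q j)) + ?n (\<lambda>i j. B (p i) (c j)) + ?n (\<lambda>i j. B (b i) (q j)) + ?n (\<lambda>i j. B (b i) (c j))"
    by (simp add: add_left add_right sum_left sum_right mem sum.distrib)
  have R1: "B (\<lambda>x. h x + (\<Sum>i\<in>F. p i x)) (\<lambda>x. h' x + (\<Sum>j\<in>F. q j x))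
    = B h h' + (\<Sum>j\<in>F. B h (q j)) + (\<Sum>i\<in>F. B (p i) h') + ?S (\<lambda>i j. B (p i) (q j))"
    by (simp add: add_left add_right sum_left sum_right mem sum.distrib)
  have R2: "(\<Sum>i\<in>F. B (p i) (\<lambda>x. \<Sum>j\<in>{j\<in>F. R i j}. q j x)) = ?n (\<lambda>i j. B (p i) (q j))"
    by (simp add: sum_right mem)
  have R3: "(\<Sum>i\<in>F. B (b i) (\<lambda>x. h' x + (\<Sum>j\<in>{j\<in>F. \<not> R i j}. q j x + c j x)))
    = (\<Sum>i\<in>F. B (b i) h') + ?f (\<lambda>i j. B (b i) (q j)) + ?f (\<lambda>i j. B (b i) (c j))"
    by (simp add: add_left add_right sum_left sum_right mem sum.distrib)
  have R4: "(\<Sum>j\<in>F. B (\<lambda>x. h x + (\<Sum>i\<in>{i\<in>F. \<not> R i j}. p i x)) (c j))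
    = (\<Sum>j\<in>F. B h (c j)) + ?f (\<lambda>i j. B (p i) (c j))"
    by (simp add: add_left add_right sum_left sum_right mem sum.distrib swap)
  show ?thesis
    unfolding L L2 R1 R2 R3 R4 nf by (simp add: algebra_simps)
qed

end

lemma indicator_Union_cells:
  assumes "J \<subseteq> F" "finite F" "F \<subseteq> whitney E"
  shows "(\<Sum>p\<in>J. cell_mean f p x + cell_osc f p x) = f x * indicator (\<Union>p\<in>J. dcube p) x"
proof -
  have "finite J" "J \<subseteq> whitney E" using assms by (auto intro: finite_subset)
  then show ?thesis
    unfolding cell_mean_add_osc
    by (subst indicator_UN_disjoint[OF _ disjoint_family_whitney]) (auto simp: sum_distrib_left)
qed

lemma cell_mean_support: "cell_mean f p x \<noteq> 0 \<Longrightarrow> x \<in> dcube p"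
  by (auto simp: cell_mean_def indicator_def split: if_splits)

section \<open>The four terms of the splitting\<close>

context cz_form
begin

text \<open>Near cubes are disjoint and lie in \<open>dil p\<close>, so the sum of their means is a
  bounded function on the dilate, and the L2 bound suffices.\<close>

lemma near_mean_le:
  assumes "stopping_cubes f E T F" "stopping_cubes g E S F" and p: "p \<in> F"
  shows "cmod (B (cell_mean f p) (\<lambda>x. \<Sum>j\<in>{j\<in>F. near p j}. cell_mean g j x))
    \<le> N * (ball_const TYPE('n) * T) * (ball_const TYPE('n) * S) * dil_factor TYPE('n) ^ CARD('n) * measure lebesgue (dcube p)"
proof -
  interpret f: stopping_cubes f E T F by fact
  interpret g: stopping_cubes g E S F by fact
  let ?k = "ball_const TYPE('n)" and ?c = "dil_factor TYPE('n) ^ CARD('n)" and ?m = "measure lebesgue (dcube p)"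
  let ?J = "{j\<in>F. near p j}"
  have k: "0 \<le> ?k * T" "0 \<le> ?k * S" using ball_const_pos[where 'n='n] f.T g.T by simp_all
  have c: "1 \<le> ?c" using dilation_ge[where 'n='n] by (intro one_le_power) simp
  have dm: "measure lebesgue (dil p) = ?c * ?m" by (simp add: measure_dil)
  have J: "finite ?J" "?J \<subseteq> whitney E" using f.F by auto
  have "cmod (B (cell_mean f p) (\<lambda>x. \<Sum>j\<in>?J. cell_mean g j x))
      \<le> N * (sqrt ((?k * T)\<^sup>2 * ?m) * sqrt ((?k * S)\<^sup>2 * measure lebesgue (dil p)))"
  proof (intro bound_le integral_square_le_measure cell_mean_bbs bbs_sum k)
    show "AE x in lebesgue. \<bar>cell_mean f p x\<bar> \<le> ?k * T"
      using f.average_le[OF p] cell_average_nonneg[of f p, OF f.f_nonneg] k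
      by (auto simp: cell_mean_def indicator_def)
    show "AE x in lebesgue. \<bar>\<Sum>j\<in>?J. cell_mean g j x\<bar> \<le> ?k * S"
    proof (rule AE_I2)
      fix x
      have "(\<Sum>j\<in>?J. cell_average g j * indicator (dcube j) x) \<le> ?k * S"
        by (intro sum_disjoint_indicator_le J disjoint_family_whitney[OF J(2)] k
          cell_average_nonneg g.f_nonneg g.average_le) auto
      moreover have "0 \<le> (\<Sum>j\<in>?J. cell_average g j * indicator (dcube j) x)"
        by (intro sum_nonneg mult_nonneg_nonneg cell_average_nonneg g.f_nonneg) auto
      ultimately show "\<bar>\<Sum>j\<in>?J. cell_mean g j x\<bar> \<le> ?k * S" by (simp add: cell_mean_def)
    qed
    fix x
    show "x \<in> dcube p" if "cell_mean f p x \<noteq> 0" using that by (rule cell_mean_support)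
    assume "(\<Sum>j\<in>?J. cell_mean g j x) \<noteq> 0"
    then obtain j where j: "j \<in> ?J" "cell_mean g j x \<noteq> 0" by (auto elim: sum.not_neutral_contains_not_neutral)
    then have "x \<in> dcube j" by (auto intro: cell_mean_support)
    moreover have "dcube j \<subseteq> dil p"
      using j p f.F by (intro near_whitney_subset_dil[of p E j]) auto
    ultimately show "x \<in> dil p" by blast
  qed auto
  also have "\<dots> = N * ((?k * T) * (?k * S) * (sqrt ?c * ?m))"
  proof -
    have 1: "sqrt ((?k * T)\<^sup>2 * ?m) = ?k * T * sqrt ?m"
      using k(1) by (simp only: real_sqrt_mult real_sqrt_abs abs_of_nonneg)
    have 2: "sqrt ((?k * S)\<^sup>2 * (?c * ?m)) = ?k * S * (sqrt ?c * sqrt ?m)"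
      using k(2) by (simp only: real_sqrt_mult real_sqrt_abs abs_of_nonneg)
    have 3: "sqrt ?m * sqrt ?m = ?m" by (intro real_sqrt_mult_self[THEN trans]) simp
    have "sqrt ((?k * T)\<^sup>2 * ?m) * sqrt ((?k * S)\<^sup>2 * (?c * ?m))
      = (?k * T) * (?k * S) * (sqrt ?c * (sqrt ?m * sqrt ?m))"
      unfolding 1 2 by (simp only: mult_ac)
    then show ?thesis unfolding dm 3 by (rule arg_cong)
  qed
  also have "\<dots> \<le> N * ((?k * T) * (?k * S) * (?c * ?m))"
  proof -
    \<comment> \<open>As \<open>?c\<close> is at least 1, it may replace its own square root and
      keep the constant free of roots.\<close>
    have "?c \<le> ?c\<^sup>2" using c by (rule self_le_power) simp
    then have "sqrt ?c \<le> ?c" using c by (intro real_le_lsqrt) linarith+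
    then show ?thesis using k N_nonneg
      by (intro mult_left_mono mult_right_mono) auto
  qed
  finally show ?thesis by (simp add: mult_ac)
qed

text \<open>\<open>g\<close> stays unsplit on the far cubes. It may be large there, but its
  integrals over balls around the corner of radius at least the separation are controlled by
  \<open>ball_bound_corner\<close>, and this is all that \<open>separated\<close> asks for.\<close>

lemma osc_far_le:
  assumes "stopping_cubes f E T F" "stopping_cubes g E S F" and p: "p \<in> F"
  shows "cmod (B (cell_osc f p) (\<lambda>x. g x * indicator (- E) x
      + (\<Sum>j\<in>{j\<in>F. \<not> near p j}. cell_mean g j x + cell_osc g j x)))
    \<le> C * (ball_const TYPE('n) * S) * (\<integral>x. \<bar>cell_osc f p x\<bar> \<partial>lebesgue)"
proof -
  interpret f: stopping_cubes f E T F by fact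
  interpret g: stopping_cubes g E S F by fact
  let ?J = "{j\<in>F. \<not> near p j}"
  define A where "A = - E \<union> (\<Union>j\<in>?J. dcube j)"
  have disj: "(\<Union>j\<in>?J. dcube j) \<subseteq> E" using f.F whitney_subset by blast
  have "indicator A x = (indicator (- E) x + indicator (\<Union>j\<in>?J. dcube j) x :: real)" for x
    unfolding A_def using disj by (intro indicator_disj_union) blast
  then have eq: "(\<lambda>x. g x * indicator (- E) x + (\<Sum>j\<in>?J. cell_mean g j x + cell_osc g j x)) = (\<lambda>x. g x * indicator A x)"
    by (subst indicator_Union_cells[OF _ f.F]) (simp_all add: distrib_left)
  have A: "A \<in> sets lebesgue"
    unfolding A_def using f.F(1) by (intro sets.Un f.E_sets sets.finite_UN) simp_all
  have "cmod (B (cell_osc f p) (\<lambda>x. g x * indicator A x)) \<le> C * (ball_const TYPE('n) * S) * (\<integral>x. \<bar>cell_osc f p x\<bar> \<partial>lebesgue)"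
  proof (rule far_left[of _ _ "2 * real CARD('n) * side p" "corner p"])
    show "0 \<le> ball_const TYPE('n) * S" using ball_const_pos[where 'n='n] g.T by simp
    fix x assume "g x * indicator A x \<noteq> 0"
    then have "x \<in> A" by (auto simp: indicator_def split: if_splits)
    then consider "x \<notin> E" | j where "j \<in> F" "\<not> near p j" "x \<in> dcube j"
      unfolding A_def by blast
    then show "2 * real CARD('n) * side p \<le> norm (x - corner p)"
    proof cases
      case 2
      then show ?thesis using not_near_dist(1)[of p j "corner p" x] by (simp add: norm_minus_commute)
    qed (use p f.outside_dist in auto)
  next
    fix r assume r: "2 * real CARD('n) * side p \<le> r"
    have "(\<integral>x. g x * indicator A x * indicator (ball (corner p) r) x \<partial>lebesgue)
        \<le> (\<integral>x. g x * indicator (ball (corner p) r) x \<partial>lebesgue)"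
      using A g.f g.f_nonneg by (intro integral_mono bbs_integrable bbs_indicator) (auto simp: indicator_def)
    also have "\<dots> \<le> ball_const TYPE('n) * S * r ^ CARD('n)"
      using p f.F by (intro ball_bound_corner[OF g.f g.f_nonneg g.bb g.T g.closed_compl g.E_ne _ r]) auto
    finally show "(\<integral>x. g x * indicator A x * indicator (ball (corner p) r) x \<partial>lebesgue)
      \<le> ball_const TYPE('n) * S * r ^ CARD('n)" .
  next
    show "cell_osc f p \<in> bbs" "(\<integral>x. cell_osc f p x \<partial>lebesgue) = 0"
      by (rule cell_osc_bbs[OF f.f], rule integral_cell_osc[OF f.f])
    show "(\<lambda>x. g x * indicator A x) \<in> bbs" using g.f A by (rule bbs_indicator)
    show "0 < 2 * real CARD('n) * side p" by simp
    show "0 \<le> g x * indicator A x" for x using g.f_nonneg[of x] by simp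
  qed (rule f.osc_support)
  then show ?thesis unfolding eq .
qed

text \<open>The far function consists of means and of \<open>f\<close> off \<open>E\<close>, so it
  is bounded almost everywhere, and its ball integrals are at most that bound times the volume.
  Hence the factor \<open>unit_ball_vol\<close>.\<close>

lemma good_far_osc_le:
  assumes "stopping_cubes f E T F" "stopping_cubes g E S F" and p: "p \<in> F"
  shows "cmod (B (\<lambda>x. f x * indicator (- E) x + (\<Sum>j\<in>{j\<in>F. \<not> near j p}. cell_mean f j x)) (cell_osc g p))
    \<le> C * (ball_const TYPE('n) * T * unit_ball_vol (real CARD('n))) * (\<integral>x. \<bar>cell_osc g p x\<bar> \<partial>lebesgue)"
proof -
  interpret f: stopping_cubes f E T F by fact
  interpret g: stopping_cubes g E S F by fact
  let ?J = "{j\<in>F. \<not> near j p}"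
  have r0: "0 < 2 * real CARD('n) * side p" by simp
  have "cmod (B (good_part f E ?J) (cell_osc g p))
    \<le> C * (ball_const TYPE('n) * T * unit_ball_vol (real CARD('n))) * (\<integral>x. \<bar>cell_osc g p x\<bar> \<partial>lebesgue)"
  proof (rule far_right[of _ _ "2 * real CARD('n) * side p" "corner p"])
    show "0 \<le> ball_const TYPE('n) * T * unit_ball_vol (real CARD('n))"
      using ball_const_pos[where 'n='n] f.T by simp
    fix x assume "good_part f E ?J x \<noteq> 0"
    then have "x \<notin> E \<or> (\<Sum>j\<in>?J. cell_mean f j x) \<noteq> 0"
      by (auto simp: good_part_def indicator_def split: if_splits)
    then consider "x \<notin> E" | j where "j \<in> ?J" "cell_mean f j x \<noteq> 0"
      by (auto elim: sum.not_neutral_contains_not_neutral)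
    then show "2 * real CARD('n) * side p \<le> norm (x - corner p)"
    proof cases
      case 2
      then have "x \<in> dcube j" by (auto intro: cell_mean_support)
      with 2 show ?thesis using not_near_dist(2)[of j p x "corner p"] by auto
    qed (use p f.outside_dist in auto)
  next
    fix r assume "2 * real CARD('n) * side p \<le> r"
    with r0 have "0 \<le> r" by linarith
    then show "(\<integral>x. good_part f E ?J x * indicator (ball (corner p) r) x \<partial>lebesgue)
      \<le> ball_const TYPE('n) * T * unit_ball_vol (real CARD('n)) * r ^ CARD('n)"
      by (intro f.integral_good_part_ball_le) auto
  next
    show "cell_osc g p \<in> bbs" "(\<integral>x. cell_osc g p x \<partial>lebesgue) = 0"
      by (rule cell_osc_bbs[OF g.f], rule integral_cell_osc[OF g.f])
  qed (rule f.good_part_bbs r0 g.osc_support f.good_part_nonneg | assumption)+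
  then show ?thesis by (simp only: good_part_def[abs_def])
qed

text \<open>The near means contribute in proportion to the total measure of the disjoint cubes, at
  most that of \<open>E\<close>; the L1 norms of the oscillations add up to at most twice the
  integral of the function.\<close>

lemma stopping_estimate:
  assumes fg: "stopping_cubes f E T F" "stopping_cubes g E S F"
  defines "k \<equiv> ball_const TYPE('n)" and "I \<equiv> \<integral>x. f x \<partial>lebesgue" and "J \<equiv> \<integral>x. g x \<partial>lebesgue"
  shows "cmod (B f g - (\<Sum>p\<in>F. B (\<lambda>x. f x * indicator (dcube p) x)
        (\<lambda>x. g x * indicator (\<Union>j\<in>{j\<in>F. near p j}. dcube j) x)))
    \<le> N * (sqrt (k * T * I) * sqrt (k * S * J))
      + N * (k * T) * (k * S) * dil_factor TYPE('n) ^ CARD('n) * measure lebesgue E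
      + C * (k * S) * (2 * I) + C * (k * T * unit_ball_vol (real CARD('n))) * (2 * J)"
proof -
  interpret f: stopping_cubes f E T F by fact
  interpret g: stopping_cubes g E S F by fact
  let ?h = "\<lambda>x. f x * indicator (- E) x" and ?h' = "\<lambda>x. g x * indicator (- E) x"
  have k: "0 \<le> k * T" "0 \<le> k * S" using ball_const_pos[where 'n='n] f.T g.T by (simp_all add: k_def)
  let ?X1 = "B (good_part f E F) (good_part g E F)"
  let ?X2 = "\<Sum>i\<in>F. B (cell_mean f i) (\<lambda>x. \<Sum>j\<in>{j\<in>F. near i j}. cell_mean g j x)"
  let ?X3 = "\<Sum>i\<in>F. B (cell_osc f i) (\<lambda>x. ?h' x + (\<Sum>j\<in>{j\<in>F. \<not> near i j}. cell_mean g j x + cell_osc g j x))"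
  let ?X4 = "\<Sum>j\<in>F. B (\<lambda>x. ?h x + (\<Sum>i\<in>{i\<in>F. \<not> near i j}. cell_mean f i x)) (cell_osc g j)"
  have eq: "B f g - (\<Sum>p\<in>F. B (\<lambda>x. f x * indicator (dcube p) x)
        (\<lambda>x. g x * indicator (\<Union>j\<in>{j\<in>F. near p j}. dcube j) x)) = ?X1 - ?X2 + ?X3 + ?X4"
  proof -
    have 1: "(\<lambda>x. ?h x + (\<Sum>p\<in>F. cell_mean f p x + cell_osc f p x)) = f"
      "(\<lambda>x. ?h' x + (\<Sum>p\<in>F. cell_mean g p x + cell_osc g p x)) = g"
      by (rule ext, rule f.decompose[symmetric], rule ext, rule g.decompose[symmetric])
    have 2: "(\<lambda>x. cell_mean f i x + cell_osc f i x) = (\<lambda>x. f x * indicator (dcube i) x)" for i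
      by (simp add: cell_mean_add_osc)
    have 3: "(\<lambda>x. \<Sum>j\<in>{j\<in>F. near p j}. cell_mean g j x + cell_osc g j x)
      = (\<lambda>x. g x * indicator (\<Union>j\<in>{j\<in>F. near p j}. dcube j) x)" for p
      by (rule ext, rule indicator_Union_cells[OF _ f.F]) auto
    note sp = splitting[of F ?h ?h' "cell_mean f" "cell_osc f" "cell_mean g" "cell_osc g" near,
      OF f.F(1) f.outside_bbs g.outside_bbs cell_mean_bbs cell_osc_bbs[OF f.f] cell_mean_bbs cell_osc_bbs[OF g.f]]
    have L: "B f g = B (\<lambda>x. ?h x + (\<Sum>p\<in>F. cell_mean f p x + cell_osc f p x))
        (\<lambda>x. ?h' x + (\<Sum>p\<in>F. cell_mean g p x + cell_osc g p x))"
      by (rule arg_cong2[where f = B, OF 1[symmetric]])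
    have M: "B (\<lambda>x. f x * indicator (dcube p) x) (\<lambda>x. g x * indicator (\<Union>j\<in>{j\<in>F. near p j}. dcube j) x)
      = B (\<lambda>x. cell_mean f p x + cell_osc f p x) (\<lambda>x. \<Sum>j\<in>{j\<in>F. near p j}. cell_mean g j x + cell_osc g j x)" for p
      by (rule arg_cong2[where f = B, OF 2[symmetric] 3[symmetric]])
    have X1: "?X1 = B (\<lambda>x. ?h x + (\<Sum>p\<in>F. cell_mean f p x)) (\<lambda>x. ?h' x + (\<Sum>p\<in>F. cell_mean g p x))"
      by (rule arg_cong2[where f = B]; rule ext, rule good_part_def)
    have S: "(\<Sum>p\<in>F. B (\<lambda>x. f x * indicator (dcube p) x)
        (\<lambda>x. g x * indicator (\<Union>j\<in>{j\<in>F. near p j}. dcube j) x))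
      = (\<Sum>p\<in>F. B (\<lambda>x. cell_mean f p x + cell_osc f p x)
        (\<lambda>x. \<Sum>j\<in>{j\<in>F. near p j}. cell_mean g j x + cell_osc g j x))"
      by (intro sum.cong refl M)
    show ?thesis
      unfolding X1 by (simp only: L S sp)
  qed
  have "cmod (?X1 - ?X2 + ?X3 + ?X4) \<le> cmod ?X1 + cmod ?X2 + cmod ?X3 + cmod ?X4"
    using norm_triangle_ineq[of "?X1 - ?X2 + ?X3" ?X4] norm_triangle_ineq[of "?X1 - ?X2" ?X3]
      norm_triangle_ineq4[of ?X1 ?X2] by linarith
  also have "\<dots> \<le> N * (sqrt (k * T * I) * sqrt (k * S * J))
      + N * (k * T) * (k * S) * dil_factor TYPE('n) ^ CARD('n) * measure lebesgue E
      + C * (k * S) * (2 * I) + C * (k * T * unit_ball_vol (real CARD('n))) * (2 * J)"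
  proof (intro add_mono)
    show "cmod ?X1 \<le> N * (sqrt (k * T * I) * sqrt (k * S * J))"
      unfolding k_def I_def J_def
      by (intro bound_le f.good_part_bbs g.good_part_bbs f.good_part_square_le g.good_part_square_le)
    have "cmod ?X2 \<le> (\<Sum>i\<in>F. N * (k * T) * (k * S) * dil_factor TYPE('n) ^ CARD('n) * measure lebesgue (dcube i))"
      unfolding k_def by (intro sum_norm_le near_mean_le[OF fg])
    also have "\<dots> \<le> N * (k * T) * (k * S) * dil_factor TYPE('n) ^ CARD('n) * measure lebesgue E"
    proof -
      have sub: "dcube i \<subseteq> E" if "i \<in> F" for i using that f.F(2) whitney_subset by blast
      have "(\<Sum>i\<in>F. measure lebesgue (dcube i)) \<le> measure lebesgue E"
        by (rule sum_measure_disjoint_le[OF f.F(1) dcube_lmeasurable disjoint_family_whitney[OF f.F(2)] f.E(2) sub])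
      moreover have "0 \<le> N * (k * T) * (k * S) * dil_factor TYPE('n) ^ CARD('n)"
        by (intro mult_nonneg_nonneg k N_nonneg zero_le_power less_imp_le[OF dil_pos])
      ultimately show ?thesis
        unfolding sum_distrib_left[symmetric] by (rule mult_left_mono)
    qed
    finally show "cmod ?X2 \<le> N * (k * T) * (k * S) * dil_factor TYPE('n) ^ CARD('n) * measure lebesgue E" .
    have "cmod ?X3 \<le> (\<Sum>i\<in>F. C * (k * S) * (\<integral>x. \<bar>cell_osc f i x\<bar> \<partial>lebesgue))"
      unfolding k_def by (intro sum_norm_le osc_far_le[OF fg])
    also have "\<dots> \<le> C * (k * S) * (2 * I)"
      unfolding sum_distrib_left[symmetric] I_def
      by (intro mult_left_mono f.integral_abs_osc_sum mult_nonneg_nonneg k C_nonneg)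
    finally show "cmod ?X3 \<le> C * (k * S) * (2 * I)" .
    have "cmod ?X4 \<le> (\<Sum>i\<in>F. C * (k * T * unit_ball_vol (real CARD('n))) * (\<integral>x. \<bar>cell_osc g i x\<bar> \<partial>lebesgue))"
      unfolding k_def by (intro sum_norm_le good_far_osc_le[OF fg])
    also have "\<dots> \<le> C * (k * T * unit_ball_vol (real CARD('n))) * (2 * J)"
      unfolding sum_distrib_left[symmetric] J_def
      by (intro mult_left_mono g.integral_abs_osc_sum mult_nonneg_nonneg k C_nonneg) simp
    finally show "cmod ?X4 \<le> C * (k * T * unit_ball_vol (real CARD('n))) * (2 * J)" .
  qed
  finally show ?thesis unfolding eq .
qed

end

section \<open>Averages over dilates and the stopping threshold\<close>

lemma average_eq: "average Q f = (\<integral>x. f x * indicator Q x \<partial>lebesgue) / measure lebesgue Q"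
  by (simp add: average_def set_lebesgue_integral_def mult.commute)

lemma average_nonneg: "(\<And>x. 0 \<le> f x) \<Longrightarrow> 0 \<le> average Q f"
  unfolding average_eq by (intro divide_nonneg_nonneg integral_indicator_nonneg) auto

lemma average_mono:
  assumes "f \<in> bbs" "g \<in> bbs" "\<And>x. f x \<le> g x" "Q \<in> sets lebesgue"
  shows "average Q f \<le> average Q g"
  unfolding average_eq using assms
  by (intro divide_right_mono integral_mono bbs_integrable bbs_indicator) (auto simp: indicator_def)

lemma integral_eq_average:
  assumes "\<And>x. f x \<noteq> 0 \<Longrightarrow> x \<in> dil q"
  shows "(\<integral>x. f x \<partial>lebesgue) = average (dil q) f * measure lebesgue (dil q)"
proof -
  have "(\<integral>x. f x * indicator (dil q) x \<partial>lebesgue) = (\<integral>x. f x \<partial>lebesgue)"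
    using assms by (intro Bochner_Integration.integral_cong) (auto simp: indicator_def)
  then show ?thesis using measure_dil_pos[of q] by (simp add: average_eq)
qed

text \<open>By the maximal inequality each of the two superlevel sets measures at most
  \<open>5 ^ CARD('n)\<close> times the volume of \<open>dil q\<close> divided by this constant,
  which is a quarter of the volume of \<open>dcube q\<close>.\<close>

definition stop_const :: "'n::finite itself \<Rightarrow> real" where
  "stop_const _ = 4 * 5 ^ CARD('n) * dil_factor TYPE('n) ^ CARD('n)"

lemma stop_const_pos: "0 < stop_const TYPE('n::finite)"
  using dil_pos[where 'n='n] by (simp add: stop_const_def)

lemma ball_bound_Un:
  "ball_bound f (superlevel_balls f T \<union> X) T" "ball_bound f (X \<union> superlevel_balls f T) T"
  unfolding ball_bound_def by (auto intro: integral_ball_le_if_not_superlevel)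

lemma ball_bound_mono:
  assumes "ball_bound g E T" "f \<in> bbs" "g \<in> bbs" "\<And>x. f x \<le> g x"
  shows "ball_bound f E T"
  unfolding ball_bound_def
proof (intro allI impI)
  fix z a r assume z: "z \<notin> E" "z \<in> ball a r"
  have "(\<integral>x. f x * indicator (ball a r) x \<partial>lebesgue) \<le> (\<integral>x. g x * indicator (ball a r) x \<partial>lebesgue)"
    using assms by (intro integral_mono bbs_integrable bbs_indicator) (auto simp: indicator_def)
  also have "\<dots> \<le> T * measure lebesgue (ball a r)"
    using assms(1) z unfolding ball_bound_def by blast
  finally show "(\<integral>x. f x * indicator (ball a r) x \<partial>lebesgue) \<le> T * measure lebesgue (ball a r)" .
qed

lemma measure_dcube_le_dil: "measure lebesgue (dcube p) \<le> measure lebesgue (dil p)"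
  by (intro measure_mono_fmeasurable dcube_subset_dil) (auto simp del: measure_dcube)

section \<open>One stopping step\<close>

context cz_form
begin

text \<open>The first four summands are the coefficients in \<open>stopping_estimate\<close> when
  each threshold is \<open>stop_const\<close> times an average; the last 1 pays for the part of
  \<open>E\<close> outside the finite family.\<close>

definition step_const :: real where
  "step_const = (let k = ball_const TYPE('n) * stop_const TYPE('n) in
     N * k + N * k * k * dil_factor TYPE('n) ^ CARD('n) + 2 * C * k + 2 * C * k * unit_ball_vol (real CARD('n)) + 1)"

lemma step_const_ge: "1 \<le> step_const"
proof -
  have k: "0 \<le> ball_const TYPE('n) * stop_const TYPE('n)"
    using ball_const_pos[where 'n='n] stop_const_pos[where 'n='n] by simp
  show ?thesis
    unfolding step_const_def Let_def using dil_pos[where 'n='n]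
    by (simp add: k N_nonneg C_nonneg)
qed

text \<open>A bounded nonnegative function of integral 0 has L2 norm 0. This disposes of vanishing
  averages, which would give thresholds that are not positive.\<close>

lemma vanish_of_integral_zero:
  assumes "f \<in> bbs" "g \<in> bbs" "\<And>x. 0 \<le> f x" "(\<integral>x. f x \<partial>lebesgue) = 0"
  shows "B f g = 0" "B g f = 0"
proof -
  obtain M where M: "\<And>x. \<bar>f x\<bar> \<le> M" by (rule bbsE[OF assms(1)]) blast
  have "(\<integral>x. (f x)\<^sup>2 \<partial>lebesgue) \<le> 0"
    using integral_square_le[OF assms(1), of M] M assms by simp
  with bound_le[OF assms(1,2) _ order_refl, of 0] bound_le[OF assms(2,1) order_refl, of 0]
  show "B f g = 0" "B g f = 0" by auto
qed

text \<open>The support hypotheses return for every child \<open>p\<close>: \<open>dcube p\<close>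
  for the first function, and for the second the near cubes, which lie in \<open>dil p\<close>. This
  is what makes the estimate iterable.\<close>

lemma one_step:
  assumes f: "f \<in> bbs" "\<And>x. 0 \<le> f x" "\<And>x. f x \<noteq> 0 \<Longrightarrow> x \<in> dcube q"
    and g: "g \<in> bbs" "\<And>x. 0 \<le> g x" "\<And>x. g x \<noteq> 0 \<Longrightarrow> x \<in> dil q"
  shows "\<exists>F G. finite F \<and> (\<forall>p\<in>F. dcube p \<subseteq> dcube q) \<and> disjoint_family_on dcube F \<and>
    (\<Sum>p\<in>F. measure lebesgue (dcube p)) \<le> measure lebesgue (dcube q) / 2 \<and>
    (\<forall>p\<in>F. G p \<in> sets lebesgue \<and> G p \<subseteq> dil p) \<and>
    cmod (B f g) \<le> step_const * (average (dil q) f * average (dil q) g * measure lebesgue (dil q)) +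
      (\<Sum>p\<in>F. cmod (B (\<lambda>x. f x * indicator (dcube p) x) (\<lambda>x. g x * indicator (G p) x)))"
    (is "\<exists>F G. ?P F G")
proof -
  let ?m = "measure lebesgue (dil q)"
  define l u where "l = average (dil q) f" and "u = average (dil q) g"
  have fq: "x \<in> dil q" if "f x \<noteq> 0" for x using f(3)[OF that] dcube_subset_dil by blast
  have m: "0 < ?m" by (rule measure_dil_pos)
  have If: "(\<integral>x. f x \<partial>lebesgue) = l * ?m" unfolding l_def using fq by (rule integral_eq_average)
  have Ig: "(\<integral>x. g x \<partial>lebesgue) = u * ?m" unfolding u_def using g(3) by (rule integral_eq_average)
  have lu0: "0 \<le> l" "0 \<le> u" unfolding l_def u_def using f(2) g(2) by (auto intro: average_nonneg)
  show ?thesis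
  proof (cases "l = 0 \<or> u = 0")
    case True
    then have "(\<integral>x. f x \<partial>lebesgue) = 0 \<or> (\<integral>x. g x \<partial>lebesgue) = 0" using If Ig by auto
    then have "B f g = 0" using vanish_of_integral_zero(1)[OF f(1) g(1) f(2)] vanish_of_integral_zero(2)[OF g(1) f(1) g(2)] by blast
    show ?thesis
    proof (rule exI[of _ "{}"], rule exI[of _ "\<lambda>_. {}"])
      show "?P {} (\<lambda>_. {})" using True \<open>B f g = 0\<close> by (auto simp: l_def u_def disjoint_family_on_def)
    qed
  next
    case False
    with lu0 have lu: "0 < l" "0 < u" by auto
    let ?A = "stop_const TYPE('n)" and ?k = "ball_const TYPE('n)" and ?c = "dil_factor TYPE('n) ^ CARD('n)"
    \<comment> \<open>Thresholds proportional to the averages turn every error term into a multiple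
      of \<open>l * u * ?m\<close>.\<close>
    define T S where "T = ?A * l" and "S = ?A * u"
    have TS: "0 < T" "0 < S" using lu stop_const_pos[where 'n='n] by (auto simp: T_def S_def)
    define E where "E = superlevel_balls f T \<union> superlevel_balls g S"
    have E: "open E" "E \<in> lmeasurable"
      unfolding E_def using superlevel_balls_lmeasurable[OF f(1,2) TS(1)] superlevel_balls_lmeasurable[OF g(1,2) TS(2)]
      by (auto intro: open_superlevel_balls)
    have E_half: "measure lebesgue E \<le> measure lebesgue (dcube q) / 2"
    proof -
      have "measure lebesgue E \<le> measure lebesgue (superlevel_balls f T) + measure lebesgue (superlevel_balls g S)"
        unfolding E_def using superlevel_balls_lmeasurable[OF f(1,2) TS(1)] superlevel_balls_lmeasurable[OF g(1,2) TS(2)]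
        by (intro measure_Un_le) (auto intro: fmeasurableD)
      also have "\<dots> \<le> 5 ^ CARD('n) * (l * ?m) / T + 5 ^ CARD('n) * (u * ?m) / S"
        using superlevel_balls_lmeasurable[OF f(1,2) TS(1)] superlevel_balls_lmeasurable[OF g(1,2) TS(2)]
        unfolding If Ig by linarith
      also have "\<dots> = 2 * (5 ^ CARD('n) * ?m / ?A)"
        using lu by (simp add: T_def S_def)
      also have "\<dots> = measure lebesgue (dcube q) / 2"
        using dil_pos[where 'n='n] by (simp add: stop_const_def measure_dil)
      finally show ?thesis .
    qed
    have E_ne: "E \<noteq> UNIV" using E(2) not_measurable_UNIV by blast
    have bb: "ball_bound f E T" "ball_bound g E S" unfolding E_def by (rule ball_bound_Un)+
    obtain M1 where M1: "0 < M1" "\<And>x. \<bar>f x\<bar> \<le> M1" by (rule bbsE[OF f(1)]) blast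
    obtain M2 where M2: "0 < M2" "\<And>x. \<bar>g x\<bar> \<le> M2" by (rule bbsE[OF g(1)]) blast
    define M where "M = max M1 M2"
    have M: "0 < M" "\<And>x. \<bar>f x\<bar> \<le> M" "\<And>x. \<bar>g x\<bar> \<le> M"
      using M1 M2 by (auto simp: M_def le_max_iff_disj)
    define \<eta> where "\<eta> = l * u * ?m"
    \<comment> \<open>Chosen so that \<open>2 * N * M\<^sup>2 * sqrt ?m * sqrt e\<close> is at most
      \<eta>; the added 1 keeps the denominator positive when \<open>N\<close> is 0.\<close>
    define e where "e = (\<eta> / (2 * N * M\<^sup>2 * sqrt ?m + 1))\<^sup>2"
    have den: "0 < 2 * N * M\<^sup>2 * sqrt ?m + 1"
      using N_nonneg M(1) m by (intro add_nonneg_pos mult_nonneg_nonneg) auto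
    have \<eta>: "0 < \<eta>" using lu m by (simp add: \<eta>_def)
    have e: "0 < e" using den \<eta> by (simp add: e_def)
    obtain F0 where F0: "finite F0" "F0 \<subseteq> whitney E" "measure lebesgue (E - (\<Union>p\<in>F0. dcube p)) < e"
      by (rule finite_subcover_measure[OF countable_whitney _ E(2) whitney_Union[OF E(1) E_ne] e]) auto
    define W where "W = E - (\<Union>p\<in>F0. dcube p)"
    have W: "W \<in> lmeasurable" "measure lebesgue W \<le> e"
      using F0 E(2) by (auto simp: W_def intro!: fmeasurable_Diff)
    then have Ws: "W \<in> sets lebesgue" "- W \<in> sets lebesgue"
      by (auto simp: Compl_in_sets_lebesgue fmeasurableD)
    \<comment> \<open>Cutting off the remainder \<open>W\<close> produces the \<open>vanish\<close>
      property of \<open>stopping_cubes\<close>; the price is settled in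
      \<open>tail\<close>.\<close>
    define f' g' where "f' x = f x * indicator (- W) x" and "g' x = g x * indicator (- W) x" for x
    have f'g': "f' \<in> bbs" "g' \<in> bbs"
      unfolding f'_def[abs_def] g'_def[abs_def] using f g Ws by (auto intro: bbs_indicator)
    have le: "0 \<le> f' x" "f' x \<le> f x" "0 \<le> g' x" "g' x \<le> g x" for x
      using f(2) g(2) by (auto simp: f'_def g'_def indicator_def)
    have vanish: "f' x = 0" "g' x = 0" if "x \<in> W" for x
      using that by (auto simp: f'_def g'_def)
    have sf: "stopping_cubes f' E T F0"
      using f'g' le E TS F0 ball_bound_mono[OF bb(1) f'g'(1) f(1) le(2)]
        vanish
      by unfold_locales (auto simp: W_def)
    have sg: "stopping_cubes g' E S F0"
      using f'g' le E TS F0 ball_bound_mono[OF bb(2) f'g'(2) g(1) le(4)]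
        vanish
      by unfold_locales (auto simp: W_def)
    have tail: "cmod (B f g) \<le> cmod (B f' g') + \<eta>"
    proof -
      define f'' g'' where "f'' x = f x * indicator W x" and "g'' x = g x * indicator W x" for x
      have f''g'': "f'' \<in> bbs" "g'' \<in> bbs"
        unfolding f''_def[abs_def] g''_def[abs_def] using f g Ws by (auto intro: bbs_indicator)
      have split: "f = (\<lambda>x. f' x + f'' x)" "g = (\<lambda>x. g' x + g'' x)"
        by (auto simp: fun_eq_iff f'_def g'_def f''_def g''_def indicator_def)
      have "B f g = B f' g + B f'' g"
        by (subst split(1)) (rule add_left[OF f'g'(1) f''g''(1) g(1)])
      also have "B f' g = B f' g' + B f' g''"
        by (subst split(2)) (rule add_right[OF f'g'(1) f'g'(2) f''g''(2)])
      finally have B: "B f g = B f' g' + B f' g'' + B f'' g" .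
      have sq: "(\<integral>x. (f'' x)\<^sup>2 \<partial>lebesgue) \<le> M\<^sup>2 * e" "(\<integral>x. (g'' x)\<^sup>2 \<partial>lebesgue) \<le> M\<^sup>2 * e"
        "(\<integral>x. (f' x)\<^sup>2 \<partial>lebesgue) \<le> M\<^sup>2 * ?m" "(\<integral>x. (g x)\<^sup>2 \<partial>lebesgue) \<le> M\<^sup>2 * ?m"
      proof -
        have *: "(\<integral>x. (h x)\<^sup>2 \<partial>lebesgue) \<le> M\<^sup>2 * e"
          if "h \<in> bbs" "\<And>x. \<bar>h x\<bar> \<le> M" "\<And>x. h x \<noteq> 0 \<Longrightarrow> x \<in> W" for h
        proof -
          have "(\<integral>x. (h x)\<^sup>2 \<partial>lebesgue) \<le> M\<^sup>2 * measure lebesgue W"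
            using that M(1) W(1) by (intro integral_square_le_measure) auto
          also have "\<dots> \<le> M\<^sup>2 * e" using W(2) by (intro mult_left_mono) auto
          finally show ?thesis .
        qed
        show "(\<integral>x. (f'' x)\<^sup>2 \<partial>lebesgue) \<le> M\<^sup>2 * e" "(\<integral>x. (g'' x)\<^sup>2 \<partial>lebesgue) \<le> M\<^sup>2 * e"
        proof -
          have "\<bar>f'' x\<bar> \<le> M" "\<bar>g'' x\<bar> \<le> M" for x
            using M by (auto simp: f''_def g''_def indicator_def less_imp_le)
          moreover have "x \<in> W" if "f'' x \<noteq> 0 \<or> g'' x \<noteq> 0" for x
            using that by (auto simp: f''_def g''_def indicator_def split: if_splits)
          ultimately show "(\<integral>x. (f'' x)\<^sup>2 \<partial>lebesgue) \<le> M\<^sup>2 * e" "(\<integral>x. (g'' x)\<^sup>2 \<partial>lebesgue) \<le> M\<^sup>2 * e"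
            using *[OF f''g''(1)] *[OF f''g''(2)] by blast+
        qed
        show "(\<integral>x. (f' x)\<^sup>2 \<partial>lebesgue) \<le> M\<^sup>2 * ?m"
        proof (rule integral_square_le_measure[OF f'g'(1)])
          show "AE x in lebesgue. \<bar>f' x\<bar> \<le> M"
            using M by (auto simp: f'_def indicator_def less_imp_le)
          show "x \<in> dil q" if "f' x \<noteq> 0" for x
            using that fq[of x] by (auto simp: f'_def)
        qed (use M(1) in auto)
        show "(\<integral>x. (g x)\<^sup>2 \<partial>lebesgue) \<le> M\<^sup>2 * ?m"
          by (rule integral_square_le_measure[OF g(1) _ _ _ g(3)]) (use M in auto)
      qed
      have "cmod (B f' g'') + cmod (B f'' g) \<le> N * (sqrt (M\<^sup>2 * ?m) * sqrt (M\<^sup>2 * e)) + N * (sqrt (M\<^sup>2 * e) * sqrt (M\<^sup>2 * ?m))"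
        by (intro add_mono bound_le f'g' f''g'' g sq)
      also have "\<dots> = 2 * N * M\<^sup>2 * sqrt ?m * sqrt e"
        using M(1) by (simp add: real_sqrt_mult real_sqrt_abs power2_eq_square)
      also have "sqrt e = \<eta> / (2 * N * M\<^sup>2 * sqrt ?m + 1)"
        unfolding e_def using den \<eta> by (simp only: real_sqrt_abs abs_of_nonneg[OF less_imp_le[OF divide_pos_pos]])
      also have "2 * N * M\<^sup>2 * sqrt ?m * (\<eta> / (2 * N * M\<^sup>2 * sqrt ?m + 1)) \<le> \<eta>"
        using den \<eta> by (simp add: divide_simps algebra_simps)
      finally have "cmod (B f' g'') + cmod (B f'' g) \<le> \<eta>" .
      then show ?thesis
        unfolding B using norm_triangle_ineq[of "B f' g' + B f' g''" "B f'' g"] norm_triangle_ineq[of "B f' g'" "B f' g''"]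
        by linarith
    qed
    define G where "G p = (\<Union>j\<in>{j\<in>F0. near p j}. dcube j)" for p
    have G: "G p \<in> sets lebesgue" "G p \<subseteq> dil p" if "p \<in> F0" for p
    proof -
      show "G p \<in> sets lebesgue" unfolding G_def using F0(1) by (intro sets.finite_UN) auto
      have "dcube j \<subseteq> dil p" if "j \<in> F0" "near p j" for j
        using near_whitney_subset_dil[of p E j] that \<open>p \<in> F0\<close> F0(2) by blast
      then show "G p \<subseteq> dil p" unfolding G_def by blast
    qed
    let ?b = "\<lambda>p. B (\<lambda>x. f x * indicator (dcube p) x) (\<lambda>x. g x * indicator (G p) x)"
    have sum_eq: "(\<Sum>p\<in>F0. B (\<lambda>x. f' x * indicator (dcube p) x) (\<lambda>x. g' x * indicator (\<Union>j\<in>{j\<in>F0. near p j}. dcube j) x))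
      = (\<Sum>p\<in>F0. ?b p)"
    proof (rule sum.cong[OF refl])
      fix p assume p: "p \<in> F0"
      \<comment> \<open>\<open>W\<close> misses all chosen cubes, so the children inherit
        \<open>f\<close> and \<open>g\<close> themselves instead of their truncations.\<close>
      have "W \<inter> dcube p = {}" "W \<inter> G p = {}" using p unfolding W_def G_def by blast+
      then have "f' x * indicator (dcube p) x = f x * indicator (dcube p) x"
        "g' x * indicator (G p) x = g x * indicator (G p) x" for x
        by (auto simp: f'_def g'_def indicator_def)
      then show "B (\<lambda>x. f' x * indicator (dcube p) x) (\<lambda>x. g' x * indicator (\<Union>j\<in>{j\<in>F0. near p j}. dcube j) x) = ?b p"
        unfolding G_def[symmetric] by (intro arg_cong2[where f = B] ext) assumption+
    qed
    \<comment> \<open>A Whitney cube that meets \<open>dcube q\<close> without lying in it would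
      contain it, which \<open>E_half\<close> forbids; a cube disjoint from \<open>dcube q\<close>
      misses the support of \<open>f\<close> and contributes 0.\<close>
    define F where "F = {p\<in>F0. dcube p \<subseteq> dcube q}"
    have F: "finite F" "F \<subseteq> whitney E" using F0 by (auto simp: F_def)
    have sum_F: "(\<Sum>p\<in>F0. ?b p) = (\<Sum>p\<in>F. ?b p)"
    proof (rule sum.mono_neutral_right[OF F0(1)])
      show "F \<subseteq> F0" by (auto simp: F_def)
      show "\<forall>p\<in>F0 - F. ?b p = 0"
      proof
        fix p assume "p \<in> F0 - F"
        then have p: "p \<in> F0" "\<not> dcube p \<subseteq> dcube q" by (auto simp: F_def)
        have "dcube p \<inter> dcube q = {}"
        proof (rule ccontr)
          assume "dcube p \<inter> dcube q \<noteq> {}"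
          then obtain x where x: "x \<in> dcube p" "x \<in> dcube q" by blast
          have "\<not> fst p \<le> fst q" using dcube_nested[OF x] p(2) by blast
          then have "dcube q \<subseteq> dcube p" using dcube_nested[OF x(2,1)] by linarith
          also have "\<dots> \<subseteq> E" using p(1) F0(2) whitney_subset by blast
          finally have "measure lebesgue (dcube q) \<le> measure lebesgue E"
            using E(2) by (intro measure_mono_fmeasurable) auto
          with E_half have "measure lebesgue (dcube q) \<le> 0" by linarith
          then show False using zero_less_power[OF side_pos[of q], of "CARD('n)"] by simp
        qed
        then have "(\<lambda>x. f x * indicator (dcube p) x) = (\<lambda>x. 0)"
          using f(3) by (auto simp: fun_eq_iff indicator_def)
        then show "?b p = 0"
          using zero_left[OF bbs_indicator[OF g(1) G(1)[OF p(1)]]] by simp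
      qed
    qed
    have main: "cmod (B f' g' - (\<Sum>p\<in>F0. ?b p)) \<le> (step_const - 1) * \<eta>"
    proof -
      let ?I = "\<integral>x. f' x \<partial>lebesgue" and ?J = "\<integral>x. g' x \<partial>lebesgue" and ?v = "unit_ball_vol (real CARD('n))"
      have IJ: "?I \<le> l * ?m" "?J \<le> u * ?m"
        unfolding If[symmetric] Ig[symmetric] using f'g' f g le by (auto intro!: integral_mono bbs_integrable)
      have kT: "0 \<le> ?k * T" "0 \<le> ?k * S" using TS ball_const_pos[where 'n='n] by auto
      have Em: "measure lebesgue E \<le> ?m"
        using E_half measure_dcube_le_dil[of q] measure_nonneg[of lebesgue "dcube q"] by linarith
      have c: "0 \<le> ?c" using dil_pos[where 'n='n] by simp
      have "cmod (B f' g' - (\<Sum>p\<in>F0. ?b p)) \<le> N * (sqrt (?k * T * ?I) * sqrt (?k * S * ?J))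
          + N * (?k * T) * (?k * S) * ?c * measure lebesgue E
          + C * (?k * S) * (2 * ?I) + C * (?k * T * ?v) * (2 * ?J)"
        using stopping_estimate[OF sf sg] unfolding sum_eq .
      also have "\<dots> \<le> N * (sqrt (?k * T * (l * ?m)) * sqrt (?k * S * (u * ?m)))
          + N * (?k * T) * (?k * S) * ?c * ?m
          + C * (?k * S) * (2 * (l * ?m)) + C * (?k * T * ?v) * (2 * (u * ?m))"
      proof (intro add_mono)
        have I0: "0 \<le> ?J" by (intro Bochner_Integration.integral_nonneg le)
        have 1: "?k * T * ?I \<le> ?k * T * (l * ?m)" "?k * S * ?J \<le> ?k * S * (u * ?m)"
          by (rule mult_left_mono[OF IJ(1) kT(1)], rule mult_left_mono[OF IJ(2) kT(2)])
        have 2: "0 \<le> sqrt (?k * T * (l * ?m))" "0 \<le> sqrt (?k * S * ?J)"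
          using kT lu m I0 by auto
        show "N * (sqrt (?k * T * ?I) * sqrt (?k * S * ?J)) \<le> N * (sqrt (?k * T * (l * ?m)) * sqrt (?k * S * (u * ?m)))"
          by (rule mult_left_mono[OF mult_mono[OF real_sqrt_le_mono[OF 1(1)] real_sqrt_le_mono[OF 1(2)] 2] N_nonneg])
        have "0 \<le> N * (?k * T) * (?k * S) * ?c"
          by (rule mult_nonneg_nonneg[OF mult_nonneg_nonneg[OF mult_nonneg_nonneg[OF N_nonneg kT(1)] kT(2)] c])
        then show "N * (?k * T) * (?k * S) * ?c * measure lebesgue E \<le> N * (?k * T) * (?k * S) * ?c * ?m"
          by (rule mult_left_mono[OF Em])
        have "0 \<le> C * (?k * S)" "0 \<le> C * (?k * T * ?v)"
          using C_nonneg kT by auto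
        moreover have "2 * ?I \<le> 2 * (l * ?m)" "2 * ?J \<le> 2 * (u * ?m)" using IJ by auto
        ultimately show "C * (?k * S) * (2 * ?I) \<le> C * (?k * S) * (2 * (l * ?m))"
          "C * (?k * T * ?v) * (2 * ?J) \<le> C * (?k * T * ?v) * (2 * (u * ?m))"
          by (blast intro: mult_left_mono)+
      qed
      also have "\<dots> = (step_const - 1) * \<eta>"
      proof -
        define K where "K = ?k * ?A"
        have K: "0 \<le> K" using ball_const_pos[where 'n='n] stop_const_pos[where 'n='n] by (simp add: K_def)
        have kTS: "?k * T = K * l" "?k * S = K * u" by (simp_all add: K_def T_def S_def)
        have s: "sqrt (K * l * (l * ?m)) * sqrt (K * u * (u * ?m)) = K * \<eta>"
        proof -
          have "sqrt (K * l * (l * ?m)) * sqrt (K * u * (u * ?m)) = sqrt ((K * (l * u * ?m))\<^sup>2)"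
            by (simp add: real_sqrt_mult[symmetric] power2_eq_square mult_ac)
          then show ?thesis using K lu m by (simp add: \<eta>_def)
        qed
        show ?thesis
          unfolding kTS s step_const_def Let_def K_def[symmetric] by (simp add: \<eta>_def algebra_simps)
      qed
      finally show ?thesis .
    qed
    have "cmod (B f g) \<le> step_const * \<eta> + (\<Sum>p\<in>F. cmod (?b p))"
    proof -
      have "cmod (B f' g') \<le> cmod (B f' g' - (\<Sum>p\<in>F0. ?b p)) + cmod (\<Sum>p\<in>F. ?b p)"
        unfolding sum_F
        using norm_triangle_ineq[of "B f' g' - (\<Sum>p\<in>F. ?b p)" "\<Sum>p\<in>F. ?b p"] by simp
      also have "\<dots> \<le> (step_const - 1) * \<eta> + (\<Sum>p\<in>F. cmod (?b p))"
        by (intro add_mono main norm_sum)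
      finally show ?thesis using tail by (simp add: algebra_simps)
    qed
    moreover have "(\<Sum>p\<in>F. measure lebesgue (dcube p)) \<le> measure lebesgue E"
      using F whitney_subset
      by (intro sum_measure_disjoint_le[OF F(1) dcube_lmeasurable disjoint_family_whitney[OF F(2)] E(2)]) blast
    ultimately have "?P F G"
      using F(1) disjoint_family_whitney[OF F(2)] E_half G
      unfolding \<eta>_def l_def u_def by (auto simp: F_def simp del: measure_dcube)
    show ?thesis by (rule exI[of _ F], rule exI[of _ G]) fact
  qed
qed

end

section \<open>Iteration and construction of the sparse family\<close>

context cz_form
begin

abbreviation dil_term :: "(real^'n \<Rightarrow> real) \<Rightarrow> (real^'n \<Rightarrow> real) \<Rightarrow> 'n dyadic_index \<Rightarrow> real" where
  "dil_term f g p \<equiv> average (dil p) f * average (dil p) g * measure lebesgue (dil p)"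

lemma dil_term_mono:
  assumes "f \<in> bbs" "g \<in> bbs" "f' \<in> bbs" "g' \<in> bbs" "\<And>x. 0 \<le> f x" "\<And>x. 0 \<le> g x" "\<And>x. f x \<le> f' x" "\<And>x. g x \<le> g' x"
  shows "dil_term f g p \<le> dil_term f' g' p"
proof -
  have "0 \<le> f' x" for x using assms(5,7) order_trans by blast
  then show ?thesis
    using assms by (intro mult_right_mono mult_mono average_mono average_nonneg) auto
qed

text \<open>The functions change during the induction while \<open>M\<close> stays fixed, so the
  plain L2 estimate at the last generation is proportional to the total measure of its cubes, and
  that measure halves each time. The set \<open>W p\<close> is the cube without its children.
  Membership of \<open>q\<close> is recorded because the term of \<open>q\<close> will absorb the
  remainder.\<close>

lemma iterated_steps:
  assumes "f \<in> bbs" "\<And>x. 0 \<le> f x" "\<And>x. f x \<noteq> 0 \<Longrightarrow> x \<in> dcube q" "\<And>x. f x \<le> M"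
    and "g \<in> bbs" "\<And>x. 0 \<le> g x" "\<And>x. g x \<noteq> 0 \<Longrightarrow> x \<in> dil q" "\<And>x. g x \<le> M"
  shows "\<exists>G W. finite G \<and> (n \<noteq> 0 \<longrightarrow> q \<in> G) \<and>
    (\<forall>p\<in>G. dcube p \<subseteq> dcube q \<and> W p \<in> sets lebesgue \<and> W p \<subseteq> dcube p \<and>
       measure lebesgue (dcube p) / 2 \<le> measure lebesgue (W p)) \<and>
    disjoint_family_on W G \<and>
    cmod (B f g) \<le> step_const * (\<Sum>p\<in>G. dil_term f g p)
      + N * M\<^sup>2 * dil_factor TYPE('n) ^ CARD('n) * measure lebesgue (dcube q) / 2 ^ n"
  using assms
proof (induction n arbitrary: q f g)
  case 0
  let ?m = "measure lebesgue (dcube q)"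
  have M: "0 \<le> M" using 0(2,4) order_trans by blast
  have sq: "(\<integral>x. (f x)\<^sup>2 \<partial>lebesgue) \<le> M\<^sup>2 * measure lebesgue (dil q)"
    using 0 M subsetD[OF dcube_subset_dil[of q]] by (intro integral_square_le_measure) auto
  have sq': "(\<integral>x. (g x)\<^sup>2 \<partial>lebesgue) \<le> M\<^sup>2 * measure lebesgue (dil q)"
    using 0 M by (intro integral_square_le_measure) auto
  have "cmod (B f g) \<le> N * (sqrt (M\<^sup>2 * measure lebesgue (dil q)) * sqrt (M\<^sup>2 * measure lebesgue (dil q)))"
    by (intro bound_le sq sq' 0)
  also have "\<dots> = N * M\<^sup>2 * dil_factor TYPE('n) ^ CARD('n) * ?m"
    by (simp add: measure_dil real_sqrt_mult_self less_imp_le dil_pos)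
  finally show ?case
    by (intro exI[of _ "{}"]) (simp add: disjoint_family_on_def)
next
  case (Suc n)
  define R where "R = N * M\<^sup>2 * dil_factor TYPE('n) ^ CARD('n)"
  have R: "0 \<le> R" using N_nonneg dil_pos[where 'n='n] by (simp add: R_def)
  have "\<exists>F V. finite F \<and> (\<forall>p\<in>F. dcube p \<subseteq> dcube q) \<and> disjoint_family_on dcube F \<and>
    (\<Sum>p\<in>F. measure lebesgue (dcube p)) \<le> measure lebesgue (dcube q) / 2 \<and>
    (\<forall>p\<in>F. V p \<in> sets lebesgue \<and> V p \<subseteq> dil p) \<and>
    cmod (B f g) \<le> step_const * dil_term f g q +
      (\<Sum>p\<in>F. cmod (B (\<lambda>x. f x * indicator (dcube p) x) (\<lambda>x. g x * indicator (V p) x)))"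
    by (rule one_step[OF Suc.prems(1-3,5-7)])
  then obtain F V where FV: "finite F \<and> (\<forall>p\<in>F. dcube p \<subseteq> dcube q) \<and> disjoint_family_on dcube F \<and>
    (\<Sum>p\<in>F. measure lebesgue (dcube p)) \<le> measure lebesgue (dcube q) / 2 \<and>
    (\<forall>p\<in>F. V p \<in> sets lebesgue \<and> V p \<subseteq> dil p) \<and>
    cmod (B f g) \<le> step_const * dil_term f g q +
      (\<Sum>p\<in>F. cmod (B (\<lambda>x. f x * indicator (dcube p) x) (\<lambda>x. g x * indicator (V p) x)))"
    by (elim exE) (rule that)
  from FV have F: "finite F" "\<And>p. p \<in> F \<Longrightarrow> dcube p \<subseteq> dcube q" "disjoint_family_on dcube F"
    "(\<Sum>p\<in>F. measure lebesgue (dcube p)) \<le> measure lebesgue (dcube q) / 2"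
    and V: "\<And>p. p \<in> F \<Longrightarrow> V p \<in> sets lebesgue" "\<And>p. p \<in> F \<Longrightarrow> V p \<subseteq> dil p"
    by (auto simp del: measure_dcube)
  from FV have step: "cmod (B f g) \<le> step_const * dil_term f g q +
      (\<Sum>p\<in>F. cmod (B (\<lambda>x. f x * indicator (dcube p) x) (\<lambda>x. g x * indicator (V p) x)))"
    by (elim conjE)
  let ?f = "\<lambda>p x. f x * indicator (dcube p) x" and ?g = "\<lambda>p x. g x * indicator (V p) x"
  have fb: "?f p \<in> bbs" "?g p \<in> bbs" if "p \<in> F" for p
    by (rule bbs_indicator[OF Suc.prems(1) dcube_lebesgue], rule bbs_indicator[OF Suc.prems(5) V(1)[OF that]])
  have fle: "0 \<le> ?f p x" "?f p x \<le> f x" "0 \<le> ?g p x" "?g p x \<le> g x" for p x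
    using Suc.prems(2,6)[of x] by (auto simp: indicator_def)
  have M: "0 \<le> M" using Suc.prems(2,4) order_trans by blast
  \<comment> \<open>Packages the induction hypothesis so that \<open>bchoice\<close> can select
    families and subsets for all children at once.\<close>
  define P where "P p G W \<longleftrightarrow> finite G \<and> (n \<noteq> 0 \<longrightarrow> p \<in> G) \<and>
    (\<forall>r\<in>G. dcube r \<subseteq> dcube p \<and> W r \<in> sets lebesgue \<and> W r \<subseteq> dcube r \<and>
       measure lebesgue (dcube r) / 2 \<le> measure lebesgue (W r)) \<and>
    disjoint_family_on W G \<and>
    cmod (B (?f p) (?g p)) \<le> step_const * (\<Sum>r\<in>G. dil_term (?f p) (?g p) r)
      + R * measure lebesgue (dcube p) / 2 ^ n" for p G and W :: "'n dyadic_index \<Rightarrow> (real^'n) set"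
  have "\<exists>G W. P p G W" if p: "p \<in> F" for p
  proof -
    have le: "?f p x \<le> M" "?g p x \<le> M" for x
      using fle(2,4)[of x p] Suc.prems(4,8)[of x] by linarith+
    have f_supp: "x \<in> dcube p" if "?f p x \<noteq> 0" for x using that by (auto simp: indicator_def split: if_splits)
    have g_supp: "x \<in> dil p" if "?g p x \<noteq> 0" for x
      using that V(2)[OF p] by (auto simp: indicator_def split: if_splits)
    show ?thesis
      unfolding P_def R_def by (rule Suc.IH[OF fb(1)[OF p] fle(1) f_supp le(1) fb(2)[OF p] fle(3) g_supp le(2)])
  qed
  then have "\<exists>G. \<forall>p\<in>F. \<exists>W. P p (G p) W" by (intro bchoice) blast
  then obtain G where "\<forall>p\<in>F. \<exists>W. P p (G p) W" by blast
  then have "\<exists>W. \<forall>p\<in>F. P p (G p) (W p)" by (intro bchoice)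
  then obtain W where GW: "\<And>p. p \<in> F \<Longrightarrow> P p (G p) (W p)" by blast
  have Gfin: "finite (G p)" and Gsub: "\<And>r. r \<in> G p \<Longrightarrow> dcube r \<subseteq> dcube p"
    and Wr: "\<And>r. r \<in> G p \<Longrightarrow> W p r \<in> sets lebesgue \<and> W p r \<subseteq> dcube r \<and>
       measure lebesgue (dcube r) / 2 \<le> measure lebesgue (W p r)"
    and Wdis: "disjoint_family_on (W p) (G p)"
    and IH: "cmod (B (?f p) (?g p)) \<le> step_const * (\<Sum>r\<in>G p. dil_term (?f p) (?g p) r)
      + R * measure lebesgue (dcube p) / 2 ^ n" if "p \<in> F" for p
    using GW[OF that] unfolding P_def by auto
  have cell: "p = p'" if "p \<in> F" "p' \<in> F" "r \<in> G p" "r \<in> G p'" for p p' r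
  proof (rule ccontr)
    assume "p \<noteq> p'"
    then have "dcube p \<inter> dcube p' = {}" using F(3) that by (auto simp: disjoint_family_on_def)
    moreover have "corner r \<in> dcube p \<inter> dcube p'" using Gsub that corner_mem by blast
    ultimately show False by blast
  qed
  \<comment> \<open>A child has at most half the measure of \<open>dcube q\<close> and cannot
    contain it, so \<open>q\<close> is a new member and its subset can be prescribed freely.\<close>
  have qG: "q \<notin> G p" if p: "p \<in> F" for p
  proof
    assume "q \<in> G p"
    then have "measure lebesgue (dcube q) \<le> measure lebesgue (dcube p)"
      using Gsub[OF p] by (intro measure_mono_fmeasurable) auto
    also have "\<dots> \<le> (\<Sum>p\<in>F. measure lebesgue (dcube p))"
      using p F(1) by (intro member_le_sum) auto
    finally have "measure lebesgue (dcube q) \<le> 0" using F(4) by linarith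
    then show False using zero_less_power[OF side_pos[of q], of "CARD('n)"] by simp
  qed
  define H where "H = insert q (\<Union>p\<in>F. G p)"
  \<comment> \<open>By \<open>cell\<close> the union runs over a single child; writing it as a union
    avoids choosing that child.\<close>
  define W' where "W' r = (if r = q then dcube q - (\<Union>p\<in>F. dcube p) else (\<Union>p\<in>{p\<in>F. r \<in> G p}. W p r))" for r
  have W'q: "W' q = dcube q - (\<Union>p\<in>F. dcube p)" by (simp add: W'_def)
  have W'r: "W' r = W p r" if "p \<in> F" "r \<in> G p" for p r
  proof -
    have "{p'\<in>F. r \<in> G p'} = {p}" using cell that by blast
    moreover have "r \<noteq> q" using qG that by blast
    ultimately show ?thesis by (simp add: W'_def)
  qed
  have q_half: "measure lebesgue (dcube q) / 2 \<le> measure lebesgue (W' q)"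
  proof -
    have U: "(\<Union>p\<in>F. dcube p) \<in> lmeasurable" using F(1) by (intro fmeasurable.finite_UN) auto
    have "measure lebesgue (\<Union>p\<in>F. dcube p) \<le> (\<Sum>p\<in>F. measure lebesgue (dcube p))"
      using F(1) by (intro measure_UNION_le) auto
    moreover have "measure lebesgue (W' q) = measure lebesgue (dcube q) - measure lebesgue (\<Union>p\<in>F. dcube p)"
      unfolding W'q using F(2) U by (intro measurable_measure_Diff) (auto intro: fmeasurableD)
    ultimately show ?thesis using F(4) by linarith
  qed
  have H: "dcube r \<subseteq> dcube q \<and> W' r \<in> sets lebesgue \<and> W' r \<subseteq> dcube r \<and>
       measure lebesgue (dcube r) / 2 \<le> measure lebesgue (W' r)" if rH: "r \<in> H" for r
  proof (cases "r = q")
    case True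
    moreover have "W' q \<in> sets lebesgue" unfolding W'q using F(1) by (intro sets.Diff sets.finite_UN) auto
    ultimately show ?thesis using q_half W'q by auto
  next
    case False
    then obtain p where p: "p \<in> F" "r \<in> G p" using rH unfolding H_def by blast
    then show ?thesis using Wr[OF p] Gsub[OF p] F(2)[OF p(1)] W'r[OF p] by auto
  qed
  have disj: "disjoint_family_on W' H"
  proof -
    have *: "W' q \<inter> W' r = {}" if "r \<in> H" "r \<noteq> q" for r
    proof -
      from that obtain p where p: "p \<in> F" "r \<in> G p" unfolding H_def by blast
      then have "W' r \<subseteq> dcube p" using Wr[OF p] Gsub[OF p] W'r[OF p] by auto
      then show ?thesis unfolding W'q using p by blast
    qed
    have "W' r \<inter> W' s = {}" if rs: "r \<in> H" "s \<in> H" "r \<noteq> s" for r s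
    proof (cases "r = q \<or> s = q")
      case True
      then show ?thesis using * rs by blast
    next
      case False
      with rs obtain p p' where p: "p \<in> F" "r \<in> G p" "p' \<in> F" "s \<in> G p'" unfolding H_def by blast
      show ?thesis
      proof (cases "p = p'")
        case True
        then show ?thesis using Wdis[OF p(1)] p rs W'r[OF p(1,2)] W'r[OF p(3,4)] by (auto simp: disjoint_family_on_def)
      next
        case False
        then have "dcube p \<inter> dcube p' = {}" using F(3) p by (auto simp: disjoint_family_on_def)
        moreover have "W' r \<subseteq> dcube p" "W' s \<subseteq> dcube p'"
          using Wr[OF p(1,2)] Gsub[OF p(1,2)] W'r[OF p(1,2)] Wr[OF p(3,4)] Gsub[OF p(3,4)] W'r[OF p(3,4)] by auto
        ultimately show ?thesis by blast
      qed
    qed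
    then show ?thesis by (auto simp: disjoint_family_on_def)
  qed
  have "(\<Sum>r\<in>H. dil_term f g r) = dil_term f g q + (\<Sum>r\<in>(\<Union>p\<in>F. G p). dil_term f g r)"
    unfolding H_def using F(1) Gfin qG by (subst sum.insert) auto
  also have "(\<Sum>r\<in>(\<Union>p\<in>F. G p). dil_term f g r) = (\<Sum>p\<in>F. \<Sum>r\<in>G p. dil_term f g r)"
    using F(1) Gfin cell by (intro sum.UNION_disjoint) auto
  finally have sumH: "(\<Sum>r\<in>H. dil_term f g r) = dil_term f g q + (\<Sum>p\<in>F. \<Sum>r\<in>G p. dil_term f g r)" .
  have "(\<Sum>p\<in>F. cmod (B (?f p) (?g p)))
      \<le> (\<Sum>p\<in>F. step_const * (\<Sum>r\<in>G p. dil_term f g r) + R * measure lebesgue (dcube p) / 2 ^ n)"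
  proof (rule sum_mono)
    fix p assume p: "p \<in> F"
    \<comment> \<open>The induction hypothesis bounds by averages of the restricted functions;
      restoring \<open>f\<close> and \<open>g\<close> can only enlarge them.\<close>
    have "step_const * (\<Sum>r\<in>G p. dil_term (?f p) (?g p) r) \<le> step_const * (\<Sum>r\<in>G p. dil_term f g r)"
      using step_const_ge
      by (intro mult_left_mono sum_mono dil_term_mono fb[OF p] Suc.prems fle) auto
    with IH[OF p] show "cmod (B (?f p) (?g p)) \<le> step_const * (\<Sum>r\<in>G p. dil_term f g r) + R * measure lebesgue (dcube p) / 2 ^ n"
      by linarith
  qed
  also have "\<dots> = step_const * (\<Sum>p\<in>F. \<Sum>r\<in>G p. dil_term f g r) + R * (\<Sum>p\<in>F. measure lebesgue (dcube p)) / 2 ^ n"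
    by (simp only: sum.distrib sum_distrib_left sum_divide_distrib)
  also have "\<dots> \<le> step_const * (\<Sum>p\<in>F. \<Sum>r\<in>G p. dil_term f g r) + R * (measure lebesgue (dcube q) / 2) / 2 ^ n"
    using F(4) R by (intro add_left_mono divide_right_mono mult_left_mono) auto
  finally have "cmod (B f g) \<le> step_const * (\<Sum>r\<in>H. dil_term f g r) + R * measure lebesgue (dcube q) / 2 ^ Suc n"
    using step unfolding sumH by (simp add: distrib_left)
  moreover have "finite H" using F(1) Gfin by (simp add: H_def)
  moreover have "q \<in> H" by (simp add: H_def)
  ultimately show ?case
    using H disj unfolding R_def by (intro exI[of _ H] exI[of _ W'] conjI ballI) blast+
qed

text \<open>The remainder decays geometrically in the depth while the term of \<open>q\<close> is
  fixed, so at sufficient depth one more copy of the sum absorbs it; hence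
  \<open>step_const + 1\<close>.\<close>

lemma sparse_domination:
  assumes f: "f \<in> bbs" "\<And>x. 0 \<le> f x" "\<And>x. f x \<noteq> 0 \<Longrightarrow> x \<in> dcube q"
    and g: "g \<in> bbs" "\<And>x. 0 \<le> g x" "\<And>x. g x \<noteq> 0 \<Longrightarrow> x \<in> dcube q"
    and \<eta>: "\<eta> \<le> 1 / (2 * dil_factor TYPE('n) ^ CARD('n))"
  shows "\<exists>S. finite S \<and> sparse_family \<eta> S \<and>
    cmod (B f g) \<le> (step_const + 1) * (\<Sum>Q\<in>S. average Q f * average Q g * measure lebesgue Q)"
proof -
  have gq: "x \<in> dil q" if "g x \<noteq> 0" for x using g(3)[OF that] dcube_subset_dil by blast
  have fq: "x \<in> dil q" if "f x \<noteq> 0" for x using f(3)[OF that] dcube_subset_dil by blast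
  have tn: "0 \<le> dil_term f g p" for p
    using f(2) g(2) by (intro mult_nonneg_nonneg average_nonneg) auto
  show ?thesis
  proof (cases "dil_term f g q = 0")
    \<comment> \<open>Absorption needs a positive term for \<open>q\<close>. If it is 0, one of the
      integrals vanishes, with it the form, and the empty family will do.\<close>
    case True
    then have "(\<integral>x. f x \<partial>lebesgue) = 0 \<or> (\<integral>x. g x \<partial>lebesgue) = 0"
      using integral_eq_average[of f q] integral_eq_average[of g q] fq gq measure_dil_pos[of q] by auto
    then have "B f g = 0"
      using vanish_of_integral_zero(1)[OF f(1) g(1) f(2)] vanish_of_integral_zero(2)[OF g(1) f(1) g(2)] by blast
    then show ?thesis by (intro exI[of _ "{}"]) (auto simp: sparse_family_def)
  next
    case False
    with tn[of q] have pos: "0 < dil_term f g q" by linarith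
    obtain M1 where M1: "\<And>x. \<bar>f x\<bar> \<le> M1" by (rule bbsE[OF f(1)]) blast
    obtain M2 where M2: "\<And>x. \<bar>g x\<bar> \<le> M2" by (rule bbsE[OF g(1)]) blast
    define M where "M = max M1 M2"
    have M: "f x \<le> M" "g x \<le> M" for x
      using M1[of x] M2[of x] by (auto simp: M_def)
    define R where "R = N * M\<^sup>2 * dil_factor TYPE('n) ^ CARD('n) * measure lebesgue (dcube q)"
    obtain n where n: "R / dil_term f g q < 2 ^ n"
      using real_arch_pow[of 2 "R / dil_term f g q"] by auto
    \<comment> \<open>The depth is \<open>Suc n\<close>, since only a positive depth puts
      \<open>q\<close> into the family.\<close>
    have "(2::real) ^ n \<le> 2 ^ Suc n" by simp
    with n have "R / dil_term f g q < 2 ^ Suc n" by linarith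
    then have Rn: "R / 2 ^ Suc n \<le> dil_term f g q"
      using pos by (simp add: field_simps)
    obtain G W where G: "finite G" "q \<in> G"
      and W: "\<And>p. p \<in> G \<Longrightarrow> W p \<in> sets lebesgue" "\<And>p. p \<in> G \<Longrightarrow> W p \<subseteq> dcube p"
        "\<And>p. p \<in> G \<Longrightarrow> measure lebesgue (dcube p) / 2 \<le> measure lebesgue (W p)"
      and dis: "disjoint_family_on W G"
      and B: "cmod (B f g) \<le> step_const * (\<Sum>p\<in>G. dil_term f g p) + R / 2 ^ Suc n"
      using iterated_steps[OF f M(1) g(1,2) gq M(2), of "Suc n"] unfolding R_def by auto
    have "dil_term f g q \<le> (\<Sum>p\<in>G. dil_term f g p)"
      using G tn by (intro member_le_sum) auto
    with B Rn have "cmod (B f g) \<le> (step_const + 1) * (\<Sum>p\<in>G. dil_term f g p)"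
      by (simp add: distrib_right)
    also have "(\<Sum>p\<in>G. dil_term f g p) = (\<Sum>Q\<in>dil ` G. average Q f * average Q g * measure lebesgue Q)"
      by (subst sum.reindex) (auto intro: inj_on_subset[OF inj_dil])
    finally have "cmod (B f g) \<le> (step_const + 1) * (\<Sum>Q\<in>dil ` G. average Q f * average Q g * measure lebesgue Q)" .
    moreover have "sparse_family \<eta> (dil ` G)"
      unfolding sparse_family_def
    \<comment> \<open>The subsets are indexed by dyadic cubes and the family consists of dilates;
      \<open>inv dil\<close> translates.\<close>
    proof (intro conjI exI[of _ "\<lambda>Q. W (inv dil Q)"])
      show "dil ` G \<subseteq> cubes" using dil_cubes by auto
      have inv: "inv dil (dil p) = p" for p :: "'n dyadic_index" by (rule inv_f_f[OF inj_dil])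
      have "\<eta> * measure lebesgue (dil p) \<le> measure lebesgue (W p)" if "p \<in> G" for p
      proof -
        have "\<eta> * measure lebesgue (dil p) \<le> 1 / (2 * dil_factor TYPE('n) ^ CARD('n)) * measure lebesgue (dil p)"
          using \<eta> by (rule mult_right_mono) simp
        also have "\<dots> = measure lebesgue (dcube p) / 2"
          using dil_pos[where 'n='n] by (simp add: measure_dil)
        also have "\<dots> \<le> measure lebesgue (W p)" by (rule W(3)[OF that])
        finally show ?thesis .
      qed
      then show "\<forall>Q\<in>dil ` G. W (inv dil Q) \<in> sets lebesgue \<and> W (inv dil Q) \<subseteq> Q \<and>
          \<eta> * measure lebesgue Q \<le> measure lebesgue (W (inv dil Q))"
        using W(1) W(2) dcube_subset_dil by (auto simp: inv) blast
      show "\<forall>Q\<in>dil ` G. \<forall>R\<in>dil ` G. Q \<noteq> R \<longrightarrow> W (inv dil Q) \<inter> W (inv dil R) = {}"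
      proof (intro ballI impI)
        fix Q R assume "Q \<in> dil ` G" "R \<in> dil ` G" "Q \<noteq> R"
        then obtain p r where "p \<in> G" "r \<in> G" "p \<noteq> r" "Q = dil p" "R = dil r" by blast
        then show "W (inv dil Q) \<inter> W (inv dil R) = {}"
          using dis by (simp add: inv disjoint_family_on_def)
      qed
    qed
    ultimately show ?thesis using G(1) by (intro exI[of _ "dil ` G"]) auto
  qed
qed

end

section \<open>Dini kernels\<close>

text \<open>On the interval from 2^-(k+1) to 2^-k monotonicity gives \<open>\<omega> t / t\<close>
  at least the value of \<omega> at the left end divided by the right end, and the length is half
  the right end. So each summand is at most twice its share of the Dini integral.\<close>

lemma dini_modulus_sum_bounded:
  assumes "dini_modulus \<omega>"
  obtains D where "0 \<le> D" "\<And>n. (\<Sum>k<n. \<omega> ((1/2) ^ Suc k)) \<le> D"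
proof -
  have nonneg: "0 \<le> \<omega> t" if "0 \<le> t" "t \<le> 1" for t
    using assms that by (auto simp: dini_modulus_def)
  have mono: "\<omega> s \<le> \<omega> t" if "0 \<le> s" "s \<le> t" "t \<le> 1" for s t
    using assms that by (auto simp: dini_modulus_def intro: mono_onD)
  define J where "J = (\<integral>\<^sup>+t\<in>{0<..1}. ennreal (\<omega> t / t) \<partial>lborel)"
  have J: "J < \<infinity>" using assms by (simp add: dini_modulus_def J_def)
  define I where "I k = {(1/2::real) ^ Suc k<..(1/2) ^ k}" for k
  have p1: "(1/2::real) ^ k \<le> 1" for k by (simp add: power_le_one)
  have "(\<Sum>k<n. \<omega> ((1/2) ^ Suc k)) \<le> 2 * enn2real J" for n
  proof -
    define c where "c k = \<omega> ((1/2) ^ Suc k) / (1/2) ^ k" for k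
    have c: "0 \<le> c k" for k
      unfolding c_def by (intro divide_nonneg_nonneg nonneg p1) auto
    have Idis: "disjoint_family_on I {..<n}"
    proof -
      have "I j \<inter> I k = {}" if "j < k" for j k
      proof -
        have "(1/2::real) ^ k \<le> (1/2) ^ Suc j" using that by (intro power_decreasing) auto
        then show ?thesis by (auto simp: I_def)
      qed
      then show ?thesis unfolding disjoint_family_on_def by (metis inf_commute linorder_neqE_nat)
    qed
    have pw: "(\<Sum>k<n. ennreal (c k) * indicator (I k) t) \<le> ennreal (\<omega> t / t) * indicator {0<..1} t" for t
    proof (cases "\<exists>k<n. t \<in> I k")
      case True
      then obtain k where k: "k < n" "t \<in> I k" by blast
      have "t \<notin> I j" if "j \<in> {..<n} - {k}" for j
        using that k Idis by (auto simp: disjoint_family_on_def)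
      then have "(\<Sum>j<n. ennreal (c j) * indicator (I j) t) = ennreal (c k)"
        using k by (subst sum.remove[of "{..<n}" k]) (auto intro!: sum.neutral)
      moreover have t: "0 < t" "t \<le> 1" "(1/2) ^ Suc k \<le> t" "t \<le> (1/2) ^ k"
      proof -
        have "0 < (1/2::real) ^ Suc k" by simp
        with k p1[of k] show "0 < t" "t \<le> 1" "(1/2) ^ Suc k \<le> t" "t \<le> (1/2) ^ k"
          unfolding I_def greaterThanAtMost_iff by linarith+
      qed
      have "c k \<le> \<omega> t / t"
        unfolding c_def using t by (intro frac_le mono nonneg) auto
      ultimately show ?thesis using t by (simp add: ennreal_leI)
    next
      case False
      then have "(\<Sum>k<n. ennreal (c k) * indicator (I k) t) = 0" by (intro sum.neutral) auto
      then show ?thesis by simp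
    qed
    have "(\<Sum>k<n. ennreal (\<omega> ((1/2) ^ Suc k) / 2)) = (\<Sum>k<n. ennreal (c k) * emeasure lborel (I k))"
    proof (rule sum.cong[OF refl])
      fix k
      have "emeasure lborel (I k) = ennreal ((1/2) ^ k - (1/2) ^ Suc k)"
        unfolding I_def by (intro emeasure_lborel_Ioc power_decreasing) auto
      also have "\<dots> = ennreal ((1/2) ^ k / 2)" by simp
      finally show "ennreal (\<omega> ((1/2) ^ Suc k) / 2) = ennreal (c k) * emeasure lborel (I k)"
        using c[of k] by (simp add: c_def ennreal_mult[symmetric])
    qed
    also have "\<dots> = (\<integral>\<^sup>+t. (\<Sum>k<n. ennreal (c k) * indicator (I k) t) \<partial>lborel)"
      by (subst nn_integral_sum) (auto simp: I_def nn_integral_cmult_indicator)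
    also have "\<dots> \<le> J"
      unfolding J_def by (intro nn_integral_mono pw)
    finally have "ennreal (\<Sum>k<n. \<omega> ((1/2) ^ Suc k) / 2) \<le> J"
      using nonneg p1 by (subst (asm) sum_ennreal) (auto simp del: power_Suc)
    then have "(\<Sum>k<n. \<omega> ((1/2) ^ Suc k) / 2) \<le> enn2real J"
      using J nonneg p1
      by (subst (asm) ennreal_enn2real[symmetric]) (auto intro!: sum_nonneg simp: ennreal_le_iff simp del: power_Suc)
    then show ?thesis by (simp add: sum_divide_distrib[symmetric] field_simps)
  qed
  then show ?thesis by (intro that[of "2 * enn2real J"]) auto
qed

text \<open>The terms of a convergent series tend to 0, and monotonicity fills the gaps between
  dyadic points. The continuity of the kernel is derived from this.\<close>

lemma dini_modulus_small:
  assumes "dini_modulus \<omega>" "0 < \<epsilon>"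
  obtains \<delta> where "0 < \<delta>" "\<delta> \<le> 1" "\<And>t. 0 \<le> t \<Longrightarrow> t \<le> \<delta> \<Longrightarrow> \<omega> t < \<epsilon>"
proof -
  obtain D where D: "0 \<le> D" "\<And>n. (\<Sum>k<n. \<omega> ((1/2) ^ Suc k)) \<le> D"
    by (rule dini_modulus_sum_bounded[OF assms(1)]) blast
  have p1: "(1/2::real) ^ k \<le> 1" for k by (simp add: power_le_one)
  have "summable (\<lambda>k. \<omega> ((1/2) ^ Suc k))"
    by (rule summableI_nonneg_bounded[OF _ D(2)])
      (use assms(1) p1 in \<open>auto simp: dini_modulus_def simp del: power_Suc\<close>)
  from order_tendstoD(2)[OF summable_LIMSEQ_zero[OF this] assms(2)]
  obtain k where k: "\<omega> ((1/2) ^ Suc k) < \<epsilon>" by (auto simp: eventually_sequentially)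
  show ?thesis
  proof (rule that[of "(1/2) ^ Suc k"])
    fix t :: real assume t: "0 \<le> t" "t \<le> (1/2) ^ Suc k"
    then have "\<omega> t \<le> \<omega> ((1/2) ^ Suc k)"
      using assms(1) p1[of "Suc k"] unfolding dini_modulus_def by (auto intro!: mono_onD[of "{0..1}" \<omega>] simp del: power_Suc)
    with k show "\<omega> t < \<epsilon>" by linarith
  qed (use p1[of "Suc k"] in auto)
qed

section \<open>Pairings in L2 and regularity of the kernel\<close>

lemma L2_cauchy_schwarz:
  assumes "F \<in> L2_functions" "G \<in> L2_functions"
  shows "integrable lebesgue (\<lambda>x. F x * G x)" "cmod (pairing F G) \<le> L2_norm F * L2_norm G"
proof -
  have m [measurable]: "F \<in> borel_measurable lebesgue" "G \<in> borel_measurable lebesgue"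
    and i: "integrable lebesgue (\<lambda>x. (cmod (F x))\<^sup>2)" "integrable lebesgue (\<lambda>x. (cmod (G x))\<^sup>2)"
    using assms by (auto simp: L2_functions_def)
  show int: "integrable lebesgue (\<lambda>x. F x * G x)"
  proof (rule Bochner_Integration.integrable_bound[OF Bochner_Integration.integrable_add[OF i]])
    show "AE x in lebesgue. cmod (F x * G x) \<le> norm ((cmod (F x))\<^sup>2 + (cmod (G x))\<^sup>2)"
    proof (rule AE_I2)
      fix x
      have "2 * (cmod (F x) * cmod (G x)) \<le> (cmod (F x))\<^sup>2 + (cmod (G x))\<^sup>2"
        using zero_le_power2[of "cmod (F x) - cmod (G x)"] by (simp add: power2_diff)
      moreover have "0 \<le> cmod (F x) * cmod (G x)" by simp
      ultimately have "cmod (F x) * cmod (G x) \<le> (cmod (F x))\<^sup>2 + (cmod (G x))\<^sup>2" by linarith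
      then show "cmod (F x * G x) \<le> norm ((cmod (F x))\<^sup>2 + (cmod (G x))\<^sup>2)"
        by (simp add: norm_mult)
    qed
  qed auto
  let ?P = "\<integral>x. cmod (F x) * cmod (G x) \<partial>lebesgue"
  have "(\<integral>\<^sup>+x. ennreal (cmod (F x)) * ennreal (cmod (G x)) \<partial>lebesgue)\<^sup>2
      \<le> (\<integral>\<^sup>+x. ennreal (cmod (F x)) ^ 2 \<partial>lebesgue) * (\<integral>\<^sup>+x. ennreal (cmod (G x)) ^ 2 \<partial>lebesgue)"
    by (rule Cauchy_Schwarz_nn_integral) auto
  also have "(\<integral>\<^sup>+x. ennreal (cmod (F x)) * ennreal (cmod (G x)) \<partial>lebesgue) = ennreal ?P"
    using integrable_norm[OF int] by (simp add: ennreal_mult[symmetric] norm_mult nn_integral_eq_integral)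
  also have "(\<integral>\<^sup>+x. ennreal (cmod (F x)) ^ 2 \<partial>lebesgue) = ennreal (\<integral>x. (cmod (F x))\<^sup>2 \<partial>lebesgue)"
    using i by (simp add: ennreal_power nn_integral_eq_integral)
  also have "(\<integral>\<^sup>+x. ennreal (cmod (G x)) ^ 2 \<partial>lebesgue) = ennreal (\<integral>x. (cmod (G x))\<^sup>2 \<partial>lebesgue)"
    using i by (simp add: ennreal_power nn_integral_eq_integral)
  finally have "?P\<^sup>2 \<le> (\<integral>x. (cmod (F x))\<^sup>2 \<partial>lebesgue) * (\<integral>x. (cmod (G x))\<^sup>2 \<partial>lebesgue)"
    by (simp add: ennreal_power ennreal_mult[symmetric] Bochner_Integration.integral_nonneg)
  then have "?P \<le> L2_norm F * L2_norm G"
    unfolding L2_norm_def real_sqrt_mult[symmetric] by (rule real_le_rsqrt)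
  moreover have "cmod (pairing F G) \<le> ?P"
    unfolding pairing_def using integral_norm_bound[of lebesgue "\<lambda>x. F x * G x"] by (simp add: norm_mult)
  ultimately show "cmod (pairing F G) \<le> L2_norm F * L2_norm G" by linarith
qed

lemma bbs_L2:
  assumes "f \<in> bbs"
  shows "(\<lambda>x. complex_of_real (f x)) \<in> L2_functions"
    "L2_norm (\<lambda>x. complex_of_real (f x)) = sqrt (\<integral>x. (f x)\<^sup>2 \<partial>lebesgue)"
  using assms bbs_integrable[OF bbs_square[OF assms]]
  by (auto simp: L2_functions_def L2_norm_def bbs_measurable)

lemma dini_kernel_const_nonneg:
  fixes K :: "real^'n \<Rightarrow> real^'n \<Rightarrow> complex"
  assumes "dini_kernel K c \<omega>" shows "0 \<le> c"
proof -
  have "(axis undefined 1 :: real^'n) \<noteq> 0" by (simp add: axis_eq_0_iff)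
  then have "0 \<le> c / norm (axis undefined 1 - (0::real^'n)) ^ CARD('n)"
    using assms unfolding dini_kernel_def by (meson norm_ge_zero order_trans)
  then show ?thesis by simp
qed

text \<open>Monotonicity of \<omega> replaces the distance from \<open>y\<close> to \<open>a\<close>
  by its largest admissible value \<open>\<rho> / 2\<close>, so the bound no longer depends on
  \<open>y\<close>.\<close>

lemma dini_kernel_diff_le:
  fixes K :: "real^'n \<Rightarrow> real^'n \<Rightarrow> complex"
  assumes K: "dini_kernel K c \<omega>" and \<rho>: "0 < \<rho>" "norm (y - a) \<le> \<rho> / 2" "\<rho> \<le> norm (x - a)"
  shows "cmod (K x y - K x a) \<le> c * (1 / norm (x - a) ^ CARD('n)) * \<omega> (\<rho> / (2 * norm (x - a)))"
    "cmod (K y x - K a x) \<le> c * (1 / norm (x - a) ^ CARD('n)) * \<omega> (\<rho> / (2 * norm (x - a)))"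
proof -
  have n: "0 < norm (x - a)" using \<rho> by linarith
  have "norm (a - y) / norm (a - x) \<le> (\<rho> / 2) / norm (x - a)"
    using \<rho> n by (intro frac_le) (auto simp: norm_minus_commute)
  moreover have "(\<rho> / 2) / norm (x - a) \<le> 1" "0 \<le> (\<rho> / 2) / norm (x - a)"
    using \<rho> n by (simp_all add: field_simps)
  ultimately have "\<omega> (norm (a - y) / norm (a - x)) \<le> \<omega> (\<rho> / (2 * norm (x - a)))"
    using K unfolding dini_kernel_def dini_modulus_def
    by (intro mono_onD[of "{0..1}" \<omega>]) auto
  then have "c * (1 / norm (x - a) ^ CARD('n)) * \<omega> (norm (a - y) / norm (a - x))
      \<le> c * (1 / norm (x - a) ^ CARD('n)) * \<omega> (\<rho> / (2 * norm (x - a)))"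
    using dini_kernel_const_nonneg[OF K] by (intro mult_left_mono) auto
  moreover have "a \<noteq> x \<and> 2 * norm (a - y) \<le> norm (a - x)" using \<rho> n by (auto simp: norm_minus_commute)
  then have "cmod (K a x - K y x) + cmod (K x a - K x y)
      \<le> c * (1 / norm (x - a) ^ CARD('n)) * \<omega> (norm (a - y) / norm (a - x))"
    using K unfolding dini_kernel_def by (metis norm_minus_commute)
  ultimately have s: "cmod (K a x - K y x) + cmod (K x a - K x y) \<le> c * (1 / norm (x - a) ^ CARD('n)) * \<omega> (\<rho> / (2 * norm (x - a)))"
    by linarith
  show "cmod (K x y - K x a) \<le> c * (1 / norm (x - a) ^ CARD('n)) * \<omega> (\<rho> / (2 * norm (x - a)))"
    using s norm_ge_zero[of "K a x - K y x"] unfolding norm_minus_commute[of "K x y"] by linarith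
  show "cmod (K y x - K a x) \<le> c * (1 / norm (x - a) ^ CARD('n)) * \<omega> (\<rho> / (2 * norm (x - a)))"
    using s norm_ge_zero[of "K x a - K x y"] unfolding norm_minus_commute[of "K y x"] by linarith
qed

text \<open>Measurability of the kernel is not among the axioms; it is obtained from the regularity
  condition, which together with the smallness of \<omega> near 0 gives continuity off the
  diagonal.\<close>

lemma dini_kernel_continuous:
  fixes K :: "real^'n \<Rightarrow> real^'n \<Rightarrow> complex"
  assumes K: "dini_kernel K c \<omega>"
  shows "continuous_on (- {x}) (K x)"
  unfolding continuous_on_iff
proof (intro ballI allI impI)
  fix z :: "real^'n" and e :: real assume z: "z \<in> - {x}" and e: "0 < e"
  define A where "A = c * (1 / norm (z - x) ^ CARD('n))"
  have n: "0 < norm (z - x)" using z by simp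
  have A: "0 \<le> A" using dini_kernel_const_nonneg[OF K] by (simp add: A_def)
  have "dini_modulus \<omega>" using K by (simp add: dini_kernel_def)
  then obtain \<delta> where \<delta>: "0 < \<delta>" "\<delta> \<le> 1" "\<And>t. 0 \<le> t \<Longrightarrow> t \<le> \<delta> \<Longrightarrow> \<omega> t < e / (A + 1)"
    using A e by (elim dini_modulus_small[of \<omega> "e / (A + 1)"]) auto
  show "\<exists>d>0. \<forall>y\<in>- {x}. dist y z < d \<longrightarrow> dist (K x y) (K x z) < e"
  proof (intro exI[of _ "\<delta> / 2 * norm (z - x)"] conjI ballI impI)
    show "0 < \<delta> / 2 * norm (z - x)" using \<delta> n by simp
    fix y assume y: "dist y z < \<delta> / 2 * norm (z - x)"
    have half: "\<delta> / 2 * norm (z - x) \<le> 1 / 2 * norm (z - x)" using \<delta> n by (intro mult_right_mono) auto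
    have yz: "norm (z - y) < \<delta> / 2 * norm (z - x)"
      using y by (simp add: dist_norm norm_minus_commute)
    then have "2 * norm (z - y) \<le> norm (z - x)" using half by linarith
    then have "z \<noteq> x \<and> 2 * norm (z - y) \<le> norm (z - x)" using z by simp
    then have "cmod (K z x - K y x) + cmod (K x z - K x y) \<le> A * \<omega> (norm (z - y) / norm (z - x))"
      using K unfolding dini_kernel_def A_def by blast
    moreover have "norm (z - y) \<le> \<delta> * norm (z - x)"
      using yz mult_nonneg_nonneg[of \<delta> "norm (z - x)"] \<delta>(1) n by linarith
    then have "norm (z - y) / norm (z - x) \<le> \<delta>" using n by (simp add: divide_le_eq)
    then have "\<omega> (norm (z - y) / norm (z - x)) < e / (A + 1)" using n by (intro \<delta>) auto
    then have "A * \<omega> (norm (z - y) / norm (z - x)) \<le> A * (e / (A + 1))"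
      using A by (intro mult_left_mono) auto
    moreover have "A * (e / (A + 1)) < e" using A e by (simp add: field_simps)
    moreover have "0 \<le> cmod (K z x - K y x)" by simp
    ultimately have "cmod (K x z - K x y) < e" by linarith
    then show "dist (K x y) (K x z) < e" by (simp add: dist_norm norm_minus_commute)
  qed
qed

lemma kernel_integrable:
  fixes K :: "real^'n \<Rightarrow> real^'n \<Rightarrow> complex"
  assumes K: "dini_kernel K c \<omega>" and v: "v \<in> bbs" and \<delta>: "0 < \<delta>" "\<And>y. v y \<noteq> 0 \<Longrightarrow> \<delta> \<le> norm (x - y)"
  shows "integrable lebesgue (\<lambda>y. K x y * complex_of_real (v y))"
proof (rule Bochner_Integration.integrable_bound)
  show "integrable lebesgue (\<lambda>y. c / \<delta> ^ CARD('n) * \<bar>v y\<bar>)"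
    by (intro integrable_mult_right bbs_integrable bbs_abs v)
  have vx: "v x = 0" using \<delta> by force
  \<comment> \<open>Masking the junk value on the diagonal gives a Borel function on the whole
    space; by \<open>vx\<close> the product with \<open>v\<close> does not notice.\<close>
  have "(\<lambda>y. indicator (- {x}) y *\<^sub>R K x y) \<in> borel_measurable borel"
    using dini_kernel_continuous[OF K] by (intro borel_measurable_continuous_on_indicator) auto
  then have [measurable]: "(\<lambda>y. indicator (- {x}) y *\<^sub>R K x y) \<in> borel_measurable lebesgue"
    by (simp add: measurable_completion)
  have [measurable]: "v \<in> borel_measurable lebesgue" using v by (rule bbs_measurable)
  have "(\<lambda>y. (indicator (- {x}) y *\<^sub>R K x y) * complex_of_real (v y)) \<in> borel_measurable lebesgue"
    by measurable
  also have "(\<lambda>y. (indicator (- {x}) y *\<^sub>R K x y) * complex_of_real (v y)) = (\<lambda>y. K x y * complex_of_real (v y))"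
    using vx by (auto simp: fun_eq_iff indicator_def)
  finally show "(\<lambda>y. K x y * complex_of_real (v y)) \<in> borel_measurable lebesgue" .
  show "AE y in lebesgue. norm (K x y * complex_of_real (v y)) \<le> norm (c / \<delta> ^ CARD('n) * \<bar>v y\<bar>)"
  proof (rule AE_I2)
    fix y
    show "norm (K x y * complex_of_real (v y)) \<le> norm (c / \<delta> ^ CARD('n) * \<bar>v y\<bar>)"
    proof (cases "v y = 0")
      case False
      with \<delta> have d: "\<delta> \<le> norm (x - y)" by auto
      with \<delta>(1) have "x \<noteq> y" by auto
      with K have "cmod (K x y) \<le> c / norm (x - y) ^ CARD('n)" by (simp add: dini_kernel_def)
      also have "\<dots> \<le> c / \<delta> ^ CARD('n)"
        using d \<delta>(1) dini_kernel_const_nonneg[OF K] by (intro frac_le power_mono) auto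
      finally show ?thesis
        using dini_kernel_const_nonneg[OF K] \<delta>(1) mult_right_mono[of "cmod (K x y)" "c / \<delta> ^ CARD('n)" "\<bar>v y\<bar>"]
        by (simp add: norm_mult abs_mult)
    qed simp
  qed
qed

text \<open>On the shell between 2^k \<rho> and 2^(k+1) \<rho> the weight is at most a constant
  \<open>w k\<close>, and the integral of \<open>u\<close> over the outer ball is at most \<Lambda>
  times the d-th power of its radius. The powers cancel up to 2^d and the dyadic sum of \<omega>
  remains. Balls may replace shells because all weights are nonnegative.\<close>

lemma annuli_majorant:
  fixes u :: "real^'n \<Rightarrow> real"
  assumes \<omega>: "dini_modulus \<omega>" and D: "\<And>n. (\<Sum>k<n. \<omega> ((1/2) ^ Suc k)) \<le> D" and c: "0 \<le> c"
    and u: "u \<in> bbs" "\<And>x. 0 \<le> u x" "\<And>x. u x \<noteq> 0 \<Longrightarrow> \<rho> \<le> norm (x - a)"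
    and \<rho>: "0 < \<rho>" and \<Lambda>: "0 \<le> \<Lambda>"
    and avg: "\<And>r. \<rho> \<le> r \<Longrightarrow> (\<integral>x. u x * indicator (ball a r) x \<partial>lebesgue) \<le> \<Lambda> * r ^ CARD('n)"
  obtains \<Psi> where "integrable lebesgue (\<lambda>x. \<Psi> x * u x)"
    "\<And>x. u x \<noteq> 0 \<Longrightarrow> c * (1 / norm (x - a) ^ CARD('n)) * \<omega> (\<rho> / (2 * norm (x - a))) \<le> \<Psi> x"
    "(\<integral>x. \<Psi> x * u x \<partial>lebesgue) \<le> c * 2 ^ CARD('n) * D * \<Lambda>"
proof -
  have p1: "(1/2::real) ^ k \<le> 1" for k by (simp add: power_le_one)
  have \<omega>0: "0 \<le> \<omega> ((1/2) ^ Suc k)" for k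
    using \<omega> p1[of "Suc k"] by (auto simp: dini_modulus_def simp del: power_Suc)
  obtain R where R: "0 < R" "\<And>x. u x \<noteq> 0 \<Longrightarrow> norm x < R" by (rule bbsE[OF u(1)]) blast
  \<comment> \<open>The support of \<open>u\<close> is bounded, so finitely many shells exhaust it
    and \<Psi> is a finite sum.\<close>
  obtain n where n: "(R + norm a) / \<rho> < 2 ^ n" using real_arch_pow[of 2 "(R + norm a) / \<rho>"] by auto
  define w where "w k = c * \<omega> ((1/2) ^ Suc k) / (2 ^ k * \<rho>) ^ CARD('n)" for k
  have w: "0 \<le> w k" for k using c \<omega>0 \<rho> by (simp add: w_def del: power_Suc)
  define \<Psi> where "\<Psi> x = (\<Sum>k<n. w k * indicator (ball a (2 ^ Suc k * \<rho>)) x)" for x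
  have int: "integrable lebesgue (\<lambda>x. u x * indicator (ball a r) x)" for r
    by (intro bbs_integrable bbs_indicator u) simp
  have eq: "(\<lambda>x. \<Psi> x * u x) = (\<lambda>x. \<Sum>k<n. w k * (u x * indicator (ball a (2 ^ Suc k * \<rho>)) x))"
    unfolding \<Psi>_def sum_distrib_right by (intro ext sum.cong refl) (simp only: mult_ac)
  show ?thesis
  proof (rule that[of \<Psi>])
    show "integrable lebesgue (\<lambda>x. \<Psi> x * u x)"
      unfolding eq by (intro Bochner_Integration.integrable_sum integrable_mult_right int)
    have "(\<integral>x. \<Psi> x * u x \<partial>lebesgue) = (\<Sum>k<n. w k * (\<integral>x. u x * indicator (ball a (2 ^ Suc k * \<rho>)) x \<partial>lebesgue))"
      unfolding eq using int by (subst Bochner_Integration.integral_sum) auto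
    also have "\<dots> \<le> (\<Sum>k<n. w k * (\<Lambda> * (2 ^ Suc k * \<rho>) ^ CARD('n)))"
    proof (intro sum_mono mult_left_mono avg w)
      fix k
      have "1 * \<rho> \<le> 2 ^ Suc k * \<rho>" using \<rho> by (intro mult_right_mono) (auto intro: one_le_power simp del: power_Suc)
      then show "\<rho> \<le> 2 ^ Suc k * \<rho>" by simp
    qed
    also have "\<dots> = (\<Sum>k<n. c * 2 ^ CARD('n) * \<Lambda> * \<omega> ((1/2) ^ Suc k))"
      using \<rho> by (intro sum.cong refl) (simp add: w_def power_mult_distrib)
    also have "\<dots> \<le> c * 2 ^ CARD('n) * \<Lambda> * D"
      unfolding sum_distrib_left[symmetric] using c \<Lambda> by (intro mult_left_mono D) auto
    finally show "(\<integral>x. \<Psi> x * u x \<partial>lebesgue) \<le> c * 2 ^ CARD('n) * D * \<Lambda>" by (simp add: mult_ac)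
    fix x assume x: "u x \<noteq> 0"
    have lo: "\<rho> \<le> norm (x - a)" by (rule u(3)[OF x])
    have hi: "norm (x - a) < 2 ^ n * \<rho>"
    proof -
      have "norm (x - a) \<le> norm x + norm a" by (rule norm_triangle_ineq4)
      also have "\<dots> < R + norm a" using R(2)[OF x] by simp
      also have "\<dots> < 2 ^ n * \<rho>" using n \<rho> by (simp add: divide_less_eq)
      finally show ?thesis .
    qed
    \<comment> \<open>Minimality gives the lower bound on the distance as well; for k = 0 that bound
      is the separation \<open>lo\<close>.\<close>
    define k where "k = (LEAST k. norm (x - a) < 2 ^ Suc k * \<rho>)"
    have n0: "n \<noteq> 0" using lo hi by (cases n) auto
    have ex: "norm (x - a) < 2 ^ Suc (n - 1) * \<rho>" using hi n0 by simp
    have k: "norm (x - a) < 2 ^ Suc k * \<rho>" unfolding k_def by (rule LeastI) (rule ex)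
    have kn: "k < n" using Least_le[of "\<lambda>k. norm (x - a) < 2 ^ Suc k * \<rho>", OF ex] n0 by (simp add: k_def)
    have k': "2 ^ k * \<rho> \<le> norm (x - a)"
    proof (cases k)
      case (Suc j)
      then have "\<not> norm (x - a) < 2 ^ Suc j * \<rho>"
        using not_less_Least[of j "\<lambda>k. norm (x - a) < 2 ^ Suc k * \<rho>"] by (simp add: k_def)
      then show ?thesis using Suc by simp
    qed (use lo in simp)
    have pos: "0 < 2 ^ k * \<rho>" using \<rho> by simp
    have "\<rho> / (2 * norm (x - a)) \<le> \<rho> / (2 * (2 ^ k * \<rho>))"
      using k' pos \<rho> lo by (intro divide_left_mono mult_left_mono mult_pos_pos) auto
    also have "\<dots> = (1/2) ^ Suc k" using \<rho> by (simp add: power_divide)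
    finally have "\<omega> (\<rho> / (2 * norm (x - a))) \<le> \<omega> ((1/2) ^ Suc k)"
      using \<omega> p1[of "Suc k"] \<rho> unfolding dini_modulus_def
      by (intro mono_onD[of "{0..1}" \<omega>]) (auto simp del: power_Suc)
    moreover have "0 < norm (x - a)" using lo \<rho> by linarith
    then have "c * (1 / norm (x - a) ^ CARD('n)) \<le> c * (1 / (2 ^ k * \<rho>) ^ CARD('n))"
      using c k' pos by (intro mult_left_mono divide_left_mono power_mono) auto
    ultimately have "c * (1 / norm (x - a) ^ CARD('n)) * \<omega> (\<rho> / (2 * norm (x - a)))
        \<le> c * (1 / (2 ^ k * \<rho>) ^ CARD('n)) * \<omega> ((1/2) ^ Suc k)"
      using c pos \<omega>0 by (meson mult_left_mono mult_right_mono order_trans mult_nonneg_nonneg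
          divide_nonneg_nonneg zero_le_one zero_le_power norm_ge_zero)
    also have "\<dots> = w k * indicator (ball a (2 ^ Suc k * \<rho>)) x"
      using k by (simp add: w_def dist_norm norm_minus_commute)
    also have "\<dots> \<le> \<Psi> x"
      unfolding \<Psi>_def using kn w by (intro member_le_sum) auto
    finally show "c * (1 / norm (x - a) ^ CARD('n)) * \<omega> (\<rho> / (2 * norm (x - a))) \<le> \<Psi> x" .
  qed
qed

text \<open>Subtracting a constant from \<open>k\<close> changes nothing because \<open>b\<close>
  has integral 0. The estimate is asked for almost everywhere since \<open>k\<close> may also be an
  image under \<open>T\<close>, known only up to null sets.\<close>

lemma integral_cancel_le:
  assumes b: "b \<in> bbs" "(\<integral>x. b x \<partial>lebesgue) = 0"
    and k: "integrable lebesgue (\<lambda>y. k y * complex_of_real (b y))"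
    and le: "AE y in lebesgue. b y \<noteq> 0 \<longrightarrow> cmod (k y - k0) \<le> \<phi>"
  shows "cmod (\<integral>y. k y * complex_of_real (b y) \<partial>lebesgue) \<le> \<phi> * (\<integral>x. \<bar>b x\<bar> \<partial>lebesgue)"
proof -
  have i0: "integrable lebesgue (\<lambda>y. k0 * complex_of_real (b y))"
    using bbs_integrable[OF b(1)] by (intro integrable_mult_right) simp
  have i: "integrable lebesgue (\<lambda>y. (k y - k0) * complex_of_real (b y))"
    unfolding left_diff_distrib by (rule Bochner_Integration.integrable_diff[OF k i0])
  have "(\<integral>y. (k y - k0) * complex_of_real (b y) \<partial>lebesgue)
      = (\<integral>y. k y * complex_of_real (b y) \<partial>lebesgue) - (\<integral>y. k0 * complex_of_real (b y) \<partial>lebesgue)"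
    unfolding left_diff_distrib by (rule Bochner_Integration.integral_diff[OF k i0])
  also have "(\<integral>y. k0 * complex_of_real (b y) \<partial>lebesgue) = 0"
    using b(2) by (simp add: integral_complex_of_real)
  finally have "cmod (\<integral>y. k y * complex_of_real (b y) \<partial>lebesgue) = cmod (\<integral>y. (k y - k0) * complex_of_real (b y) \<partial>lebesgue)"
    by simp
  also have "\<dots> \<le> (\<integral>y. cmod ((k y - k0) * complex_of_real (b y)) \<partial>lebesgue)"
    by (rule integral_norm_bound)
  also have "\<dots> \<le> (\<integral>y. \<phi> * \<bar>b y\<bar> \<partial>lebesgue)"
  proof (rule integral_mono_AE[OF integrable_norm[OF i]])
    show "integrable lebesgue (\<lambda>y. \<phi> * \<bar>b y\<bar>)"
      by (intro integrable_mult_right bbs_integrable bbs_abs b)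
    show "AE y in lebesgue. cmod ((k y - k0) * complex_of_real (b y)) \<le> \<phi> * \<bar>b y\<bar>"
      using le
    proof eventually_elim
      case (elim y)
      then show ?case
        by (cases "b y = 0") (auto simp: norm_mult intro!: mult_right_mono)
    qed
  qed
  finally show ?thesis by simp
qed

text \<open>\<open>D\<close> is fixed along with the operator so that \<omega> enters the constants
  only through a bound for its dyadic sums.\<close>

locale dini_operator =
  fixes T\<^sub>0 T :: "(real^'n \<Rightarrow> complex) \<Rightarrow> real^'n \<Rightarrow> complex" and K c \<omega> and D :: real
  assumes T: "dini_cz_operator T\<^sub>0 T K c \<omega>"
    and D_bound: "\<And>n. (\<Sum>k<n. \<omega> ((1/2) ^ Suc k)) \<le> D"
begin

abbreviation lift :: "(real^'n \<Rightarrow> real) \<Rightarrow> real^'n \<Rightarrow> complex" where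
  "lift f \<equiv> \<lambda>x. complex_of_real (f x)"

definition form :: "(real^'n \<Rightarrow> real) \<Rightarrow> (real^'n \<Rightarrow> real) \<Rightarrow> complex" where
  "form f g = pairing (T (lift f)) (lift g)"

lemma K: "dini_kernel K c \<omega>"
  using T by (simp add: dini_cz_operator_def)

lemma \<omega>: "dini_modulus \<omega>"
  using K by (simp add: dini_kernel_def)

lemma c_nonneg: "0 \<le> c"
  using K by (rule dini_kernel_const_nonneg)

lemma T_L2: "f \<in> bbs \<Longrightarrow> T (lift f) \<in> L2_functions"
  using T bbs_L2(1) by (auto simp: dini_cz_operator_def L2_bounded_linear_def)

lemma T_linear: "linear_operator_on L2_functions T"
  using T by (simp add: dini_cz_operator_def L2_bounded_linear_def)

lemma form_integrable: "f \<in> bbs \<Longrightarrow> g \<in> bbs \<Longrightarrow> integrable lebesgue (\<lambda>x. T (lift f) x * lift g x)"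
  by (intro L2_cauchy_schwarz(1) T_L2 bbs_L2(1))

lemma form_add_left:
  assumes "f \<in> bbs" "f' \<in> bbs" "g \<in> bbs"
  shows "form (\<lambda>x. f x + f' x) g = form f g + form f' g"
proof -
  have AE: "AE x in lebesgue. T (\<lambda>y. lift f y + lift f' y) x = T (lift f) x + T (lift f') x"
    by (rule T_linear[unfolded linear_operator_on_def, THEN conjunct1, rule_format,
          OF bbs_L2(1)[OF assms(1)] bbs_L2(1)[OF assms(2)]])
  have m [measurable]: "(\<lambda>x. T (lift h) x * lift g x) \<in> borel_measurable lebesgue" if "h \<in> bbs" for h
    using form_integrable[OF that assms(3)] by (rule borel_measurable_integrable)
  have "form (\<lambda>x. f x + f' x) g = (\<integral>x. T (lift f) x * lift g x + T (lift f') x * lift g x \<partial>lebesgue)"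
    unfolding form_def pairing_def
  proof (rule integral_cong_AE)
    show "(\<lambda>x. T (lift (\<lambda>x. f x + f' x)) x * lift g x) \<in> borel_measurable lebesgue"
      by (intro m bbs_add assms)
    show "(\<lambda>x. T (lift f) x * lift g x + T (lift f') x * lift g x) \<in> borel_measurable lebesgue"
      by (intro borel_measurable_add m assms)
    show "AE x in lebesgue. T (lift (\<lambda>x. f x + f' x)) x * lift g x = T (lift f) x * lift g x + T (lift f') x * lift g x"
      using AE unfolding of_real_add by eventually_elim (simp add: distrib_right)
  qed
  also have "\<dots> = form f g + form f' g"
    unfolding form_def pairing_def by (intro Bochner_Integration.integral_add form_integrable assms)
  finally show ?thesis .
qed

lemma form_add_right:
  assumes "f \<in> bbs" "g \<in> bbs" "g' \<in> bbs"
  shows "form f (\<lambda>x. g x + g' x) = form f g + form f g'"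
  unfolding form_def pairing_def of_real_add distrib_left
  by (intro Bochner_Integration.integral_add form_integrable assms)

lemma form_bound:
  assumes "f \<in> bbs" "g \<in> bbs"
  shows "cmod (form f g) \<le> (\<bar>L2_operator_norm T\<bar> + 1) * (sqrt (\<integral>x. (f x)\<^sup>2 \<partial>lebesgue) * sqrt (\<integral>x. (g x)\<^sup>2 \<partial>lebesgue))"
proof -
  \<comment> \<open>The operator norm is an infimum; above it, by the added 1, there is room for an
    actual bound. The absolute value makes the constant nonnegative for every real value of the
    norm.\<close>
  have "L2_bounds T \<noteq> {}" using T by (simp add: dini_cz_operator_def L2_bounded_linear_def)
  moreover have "Inf (L2_bounds T) < \<bar>L2_operator_norm T\<bar> + 1" unfolding L2_operator_norm_def by linarith
  ultimately obtain N where N: "N \<in> L2_bounds T" "N < \<bar>L2_operator_norm T\<bar> + 1"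
    by (meson cInf_lessD)
  have "L2_norm (T (lift f)) \<le> N * L2_norm (lift f)"
    using N(1) bbs_L2(1)[OF assms(1)] by (simp add: L2_bounds_def)
  also have "\<dots> \<le> (\<bar>L2_operator_norm T\<bar> + 1) * L2_norm (lift f)"
    using N(2) by (intro mult_right_mono) (auto simp: L2_norm_def)
  finally have "L2_norm (T (lift f)) * L2_norm (lift g) \<le> (\<bar>L2_operator_norm T\<bar> + 1) * L2_norm (lift f) * L2_norm (lift g)"
    by (rule mult_right_mono) (simp add: L2_norm_def)
  with L2_cauchy_schwarz(2)[OF T_L2[OF assms(1)] bbs_L2(1)[OF assms(2)]]
  show ?thesis unfolding form_def bbs_L2(2)[OF assms(1)] bbs_L2(2)[OF assms(2)] mult.assoc by linarith
qed

lemma representation: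
  assumes v: "v \<in> bbs" and closed: "closed Z" and Z: "\<And>x. v x \<noteq> 0 \<Longrightarrow> x \<in> Z"
  shows "AE x in lebesgue. x \<notin> Z \<longrightarrow> T (lift v) x = (\<integral>y. K x y * lift v y \<partial>lebesgue)"
proof -
  have supp: "{y. lift v y \<noteq> 0} = {y. v y \<noteq> 0}" by auto
  have "compact (closure {y. lift v y \<noteq> 0})"
    unfolding supp using v by (simp add: bbs_def compact_closure)
  moreover have "bounded (range (lift v))"
    using v by (auto simp: bbs_def bounded_iff)
  moreover have "lift v \<in> borel_measurable lebesgue"
    using bbs_measurable[OF v] by simp
  ultimately have "AE x in lebesgue. x \<notin> closure {y. lift v y \<noteq> 0} \<longrightarrow> T (lift v) x = (\<integral>y. K x y * lift v y \<partial>lebesgue)"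
    using T unfolding dini_cz_operator_def by blast
  moreover have "closure {y. lift v y \<noteq> 0} \<subseteq> Z"
    unfolding supp using Z closed by (intro closure_minimal) auto
  ultimately show ?thesis by (elim eventually_mono) blast
qed

text \<open>The cancellation of \<open>b\<close> lets us replace the kernel by its difference with the value at the
  centre \<open>a\<close>, in the variable that is integrated against \<open>b\<close>.\<close>
lemma form_separated:
  assumes b: "b \<in> bbs" and u: "u \<in> bbs" and b0: "(\<integral>x. b x \<partial>lebesgue) = 0" and \<rho>: "0 < \<rho>"
    and bs: "\<And>y. b y \<noteq> 0 \<Longrightarrow> norm (y - a) \<le> \<rho> / 2"
    and us: "\<And>x. u x \<noteq> 0 \<Longrightarrow> \<rho> \<le> norm (x - a)" and u0: "\<And>x. 0 \<le> u x" and \<Lambda>: "0 \<le> \<Lambda>"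
    and avg: "\<And>r. \<rho> \<le> r \<Longrightarrow> (\<integral>x. u x * indicator (ball a r) x \<partial>lebesgue) \<le> \<Lambda> * r ^ CARD('n)"
  shows "cmod (form b u) \<le> (c * 2 ^ CARD('n) * D) * \<Lambda> * (\<integral>x. \<bar>b x\<bar> \<partial>lebesgue)"
    "cmod (form u b) \<le> (c * 2 ^ CARD('n) * D) * \<Lambda> * (\<integral>x. \<bar>b x\<bar> \<partial>lebesgue)"
proof -
  let ?\<Phi> = "\<lambda>x. c * (1 / norm (x - a) ^ CARD('n)) * \<omega> (\<rho> / (2 * norm (x - a)))"
  obtain \<Psi> where \<Psi>: "integrable lebesgue (\<lambda>x. \<Psi> x * u x)" "\<And>x. u x \<noteq> 0 \<Longrightarrow> ?\<Phi> x \<le> \<Psi> x"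
    "(\<integral>x. \<Psi> x * u x \<partial>lebesgue) \<le> c * 2 ^ CARD('n) * D * \<Lambda>"
    by (rule annuli_majorant[OF \<omega> D_bound c_nonneg u u0 us \<rho> \<Lambda> avg]) (blast intro: that)+
  have sep: "\<rho> / 2 \<le> norm (x - y)" if "\<rho> \<le> norm (x - a)" "norm (y - a) \<le> \<rho> / 2" for x y
    using that norm_triangle_ineq[of "x - y" "y - a"] by simp
  have h: "0 < \<rho> / 2" using \<rho> by simp
  let ?b = "\<integral>x. \<bar>b x\<bar> \<partial>lebesgue"
  show "cmod (form b u) \<le> (c * 2 ^ CARD('n) * D) * \<Lambda> * ?b"
  proof -
    \<comment> \<open>With \<open>b\<close> as the argument of \<open>T\<close> the kernel
      difference is taken in the second variable, for each far \<open>x\<close> separately.\<close>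
    have pointwise: "cmod (\<integral>y. K x y * lift b y \<partial>lebesgue) \<le> ?\<Phi> x * ?b" if x: "\<rho> \<le> norm (x - a)" for x
    proof (rule integral_cancel_le[OF b b0])
      show "integrable lebesgue (\<lambda>y. K x y * lift b y)"
        by (rule kernel_integrable[OF K b h]) (use sep[OF x] bs in auto)
      show "AE y in lebesgue. b y \<noteq> 0 \<longrightarrow> cmod (K x y - K x a) \<le> ?\<Phi> x"
        using dini_kernel_diff_le(1)[OF K \<rho> _ x] bs by (intro AE_I2) blast
    qed
    have "AE x in lebesgue. x \<notin> cball a (\<rho> / 2) \<longrightarrow> T (lift b) x = (\<integral>y. K x y * lift b y \<partial>lebesgue)"
      by (rule representation[OF b]) (use bs in \<open>auto simp: dist_norm norm_minus_commute\<close>)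
    then have AE: "AE x in lebesgue. cmod (T (lift b) x * lift u x) \<le> ?b * (\<Psi> x * u x)"
    proof eventually_elim
      case (elim x)
      show ?case
      proof (cases "u x = 0")
        case False
        have x: "\<rho> \<le> norm (x - a)" by (rule us[OF False])
        then have "x \<notin> cball a (\<rho> / 2)" using \<rho> by (simp add: dist_norm norm_minus_commute)
        then have "cmod (T (lift b) x) \<le> ?\<Phi> x * ?b" using elim pointwise[OF x] by simp
        also have "\<dots> \<le> \<Psi> x * ?b"
          using \<Psi>(2)[OF False] by (rule mult_right_mono) simp
        finally have "cmod (T (lift b) x) * u x \<le> \<Psi> x * ?b * u x"
          using u0 by (rule mult_right_mono)
        then show ?thesis using u0[of x] by (simp add: norm_mult mult_ac)
      qed simp
    qed
    have "cmod (form b u) \<le> (\<integral>x. cmod (T (lift b) x * lift u x) \<partial>lebesgue)"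
      unfolding form_def pairing_def by (rule integral_norm_bound)
    also have "\<dots> \<le> (\<integral>x. ?b * (\<Psi> x * u x) \<partial>lebesgue)"
      by (intro integral_mono_AE AE integrable_norm form_integrable b u integrable_mult_right \<Psi>)
    also have "\<dots> = ?b * (\<integral>x. \<Psi> x * u x \<partial>lebesgue)" by simp
    also have "\<dots> \<le> ?b * (c * 2 ^ CARD('n) * D * \<Lambda>)" by (intro mult_left_mono \<Psi>) simp
    finally show ?thesis by (simp add: mult_ac)
  qed
  show "cmod (form u b) \<le> (c * 2 ^ CARD('n) * D) * \<Lambda> * ?b"
  proof -
    have int: "integrable lebesgue (\<lambda>y. K x y * lift u y)" if "norm (x - a) \<le> \<rho> / 2" for x
      by (rule kernel_integrable[OF K u h]) (use sep[OF us that] in \<open>auto simp: norm_minus_commute\<close>)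
    have pointwise: "cmod ((\<integral>y. K x y * lift u y \<partial>lebesgue) - (\<integral>y. K a y * lift u y \<partial>lebesgue))
        \<le> (\<integral>y. \<Psi> y * u y \<partial>lebesgue)" if x: "norm (x - a) \<le> \<rho> / 2" for x
    proof -
      have i: "integrable lebesgue (\<lambda>y. (K x y - K a y) * lift u y)"
        unfolding left_diff_distrib using \<rho> by (intro Bochner_Integration.integrable_diff int x) simp
      have "(\<integral>y. K x y * lift u y \<partial>lebesgue) - (\<integral>y. K a y * lift u y \<partial>lebesgue)
          = (\<integral>y. (K x y - K a y) * lift u y \<partial>lebesgue)"
        unfolding left_diff_distrib using \<rho>
        by (intro Bochner_Integration.integral_diff[symmetric] int x) simp
      also have "cmod \<dots> \<le> (\<integral>y. cmod ((K x y - K a y) * lift u y) \<partial>lebesgue)"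
        by (rule integral_norm_bound)
      also have "\<dots> \<le> (\<integral>y. \<Psi> y * u y \<partial>lebesgue)"
      proof (rule integral_mono[OF integrable_norm[OF i] \<Psi>(1)])
        fix y
        show "cmod ((K x y - K a y) * lift u y) \<le> \<Psi> y * u y"
        proof (cases "u y = 0")
          case False
          have "cmod (K x y - K a y) \<le> \<Psi> y"
            using dini_kernel_diff_le(2)[OF K \<rho> x us[OF False]] \<Psi>(2)[OF False] by linarith
          then have "cmod (K x y - K a y) * u y \<le> \<Psi> y * u y" using u0 by (rule mult_right_mono)
          then show ?thesis using u0[of y] by (simp add: norm_mult)
        qed simp
      qed
      finally show ?thesis .
    qed
    \<comment> \<open>The support of \<open>u\<close> lies in the closed complement of the ball, so
      the kernel represents \<open>T (lift u)\<close> where \<open>b\<close> lives. There the image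
      is close to the kernel integral at \<open>a\<close>, a constant that the mean-zero
      \<open>b\<close> removes.\<close>
    have "AE x in lebesgue. x \<notin> - ball a \<rho> \<longrightarrow> T (lift u) x = (\<integral>y. K x y * lift u y \<partial>lebesgue)"
      by (rule representation[OF u]) (use us in \<open>auto simp: dist_norm norm_minus_commute not_less\<close>)
    then have "AE x in lebesgue. b x \<noteq> 0 \<longrightarrow>
        cmod (T (lift u) x - (\<integral>y. K a y * lift u y \<partial>lebesgue)) \<le> (\<integral>y. \<Psi> y * u y \<partial>lebesgue)"
    proof eventually_elim
      case (elim x)
      show ?case
      proof
        assume bx: "b x \<noteq> 0"
        have "norm (x - a) < \<rho>" using bs[OF bx] \<rho> by linarith
        then have "x \<notin> - ball a \<rho>" by (simp add: dist_norm norm_minus_commute)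
        with elim pointwise[OF bs[OF bx]]
        show "cmod (T (lift u) x - (\<integral>y. K a y * lift u y \<partial>lebesgue)) \<le> (\<integral>y. \<Psi> y * u y \<partial>lebesgue)" by simp
      qed
    qed
    then have "cmod (form u b) \<le> (\<integral>y. \<Psi> y * u y \<partial>lebesgue) * ?b"
      unfolding form_def pairing_def by (rule integral_cancel_le[OF b b0 form_integrable[OF u b]])
    also have "\<dots> \<le> (c * 2 ^ CARD('n) * D * \<Lambda>) * ?b" by (intro mult_right_mono \<Psi>) simp
    finally show ?thesis .
  qed
qed

lemma cz_form: "cz_form form (\<bar>L2_operator_norm T\<bar> + 1) (c * 2 ^ CARD('n) * D)"
proof
  show "0 \<le> \<bar>L2_operator_norm T\<bar> + 1" by simp
  have "0 \<le> D" using D_bound[of 0] by simp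
  then show "0 \<le> c * 2 ^ CARD('n) * D" using c_nonneg by simp
  fix f g h :: "real^'n \<Rightarrow> real" assume "f \<in> bbs" "g \<in> bbs"
  then show "cmod (form f g) \<le> (\<bar>L2_operator_norm T\<bar> + 1) *
      (sqrt (\<integral>x. (f x)\<^sup>2 \<partial>lebesgue) * sqrt (\<integral>x. (g x)\<^sup>2 \<partial>lebesgue))"
    by (rule form_bound)
  assume "h \<in> bbs"
  with \<open>f \<in> bbs\<close> \<open>g \<in> bbs\<close> show "form (\<lambda>x. f x + g x) h = form f h + form g h"
    "form f (\<lambda>x. g x + h x) = form f g + form f h"
    by (rule form_add_left, rule form_add_right)
next
  fix b u :: "real^'n \<Rightarrow> real" and a :: "real^'n" and \<rho> \<Lambda> :: real
  assume *: "b \<in> bbs" "u \<in> bbs" "(\<integral>x. b x \<partial>lebesgue) = 0" "0 < \<rho>"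
    "\<And>y. b y \<noteq> 0 \<Longrightarrow> norm (y - a) \<le> \<rho> / 2" "\<And>x. u x \<noteq> 0 \<Longrightarrow> \<rho> \<le> norm (x - a)" "\<And>x. 0 \<le> u x" "0 \<le> \<Lambda>"
    "\<And>r. \<rho> \<le> r \<Longrightarrow> (\<integral>x. u x * indicator (ball a r) x \<partial>lebesgue) \<le> \<Lambda> * r ^ CARD('n)"
  show "cmod (form b u) \<le> c * 2 ^ CARD('n) * D * \<Lambda> * (\<integral>x. \<bar>b x\<bar> \<partial>lebesgue) \<and>
      cmod (form u b) \<le> c * 2 ^ CARD('n) * D * \<Lambda> * (\<integral>x. \<bar>b x\<bar> \<partial>lebesgue)"
    by (intro conjI form_separated[OF *])
qed

end

section \<open>The sparse bound for test functions\<close>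

lemma test_functions_bbs:
  assumes "f \<in> test_functions (dcube q)"
  shows "f \<in> bbs" "\<And>x. 0 \<le> f x" "\<And>x. f x \<noteq> 0 \<Longrightarrow> x \<in> dcube q"
proof -
  show "\<And>x. 0 \<le> f x" and s: "\<And>x. f x \<noteq> 0 \<Longrightarrow> x \<in> dcube q"
    using assms by (auto simp: test_functions_def)
  then have "{x. f x \<noteq> 0} \<subseteq> dcube q" by blast
  then have "bounded {x. f x \<noteq> 0}" by (rule bounded_subset[OF bounded_dcube])
  then show "f \<in> bbs" using assms by (simp add: test_functions_def bbs_def)
qed

theorem theorem1:
  "\<exists>\<eta>\<^sub>s::real. 0 < \<eta>\<^sub>s \<and> \<eta>\<^sub>s < 1 \<and>
     (\<forall>\<eta>. 0 < \<eta> \<and> \<eta> < \<eta>\<^sub>s \<longrightarrow>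
       (\<forall>(N::real) C\<^sub>K \<omega>. \<exists>C::real. C > 0 \<and>
         (\<forall>(T\<^sub>0 :: (real^'n \<Rightarrow> complex) \<Rightarrow> real^'n \<Rightarrow> complex) T K.
            dini_cz_operator T\<^sub>0 T K C\<^sub>K \<omega> \<and> L2_operator_norm T = N \<longrightarrow>
            (\<forall>Q\<^sub>0\<in>dyadic_cubes. \<forall>f\<^sub>1\<in>test_functions Q\<^sub>0. \<forall>f\<^sub>2\<in>test_functions Q\<^sub>0.
               \<exists>S. sparse_family \<eta> S \<and>
                 ennreal (cmod (pairing (T (\<lambda>x. complex_of_real (f\<^sub>1 x))) (\<lambda>x. complex_of_real (f\<^sub>2 x))))
                   \<le> ennreal C *
                     (\<Sum>\<^sub>\<infinity>Q\<in>S. ennreal (average Q f\<^sub>1 * average Q f\<^sub>2 * measure lebesgue Q))))))"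
proof -
  \<comment> \<open>Exceptional sets fill at least half of their cubes, and
    \<open>dil_factor\<close> to the power of the dimension is the volume of a dilate relative to
    its cube.\<close>
  define \<eta>\<^sub>s where "\<eta>\<^sub>s = 1 / (2 * dil_factor TYPE('n) ^ CARD('n))"
  have "1 \<le> dil_factor TYPE('n) ^ CARD('n)"
    using dilation_ge[where 'n='n] by (intro one_le_power) simp
  then have \<eta>\<^sub>s: "0 < \<eta>\<^sub>s" "\<eta>\<^sub>s < 1" by (auto simp: \<eta>\<^sub>s_def)
  have main: "\<exists>C::real. C > 0 \<and>
         (\<forall>(T\<^sub>0 :: (real^'n \<Rightarrow> complex) \<Rightarrow> real^'n \<Rightarrow> complex) T K.
            dini_cz_operator T\<^sub>0 T K C\<^sub>K \<omega> \<and> L2_operator_norm T = N \<longrightarrow>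
            (\<forall>Q\<^sub>0\<in>dyadic_cubes. \<forall>f\<^sub>1\<in>test_functions Q\<^sub>0. \<forall>f\<^sub>2\<in>test_functions Q\<^sub>0.
               \<exists>S. sparse_family \<eta> S \<and>
                 ennreal (cmod (pairing (T (\<lambda>x. complex_of_real (f\<^sub>1 x))) (\<lambda>x. complex_of_real (f\<^sub>2 x))))
                   \<le> ennreal C *
                     (\<Sum>\<^sub>\<infinity>Q\<in>S. ennreal (average Q f\<^sub>1 * average Q f\<^sub>2 * measure lebesgue Q))))"
    if \<eta>: "\<eta> < \<eta>\<^sub>s" for \<eta> N C\<^sub>K :: real and \<omega>
  proof -
    \<comment> \<open>\<open>D\<close> has to be fixed before the operator is known; phrasing its
      property as an implication lets it exist for every \<omega>.\<close>
    have "\<exists>D. dini_modulus \<omega> \<longrightarrow> (\<forall>n. (\<Sum>k<n. \<omega> ((1/2) ^ Suc k)) \<le> D)"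
      using dini_modulus_sum_bounded[of \<omega>] by metis
    then obtain D where D: "\<And>n. dini_modulus \<omega> \<Longrightarrow> (\<Sum>k<n. \<omega> ((1/2) ^ Suc k)) \<le> D" by blast
    \<comment> \<open>\<open>N\<close> and \<open>C\<^sub>K\<close> range over all reals here, so
      the absolute values secure positivity; the added 1 is the one in
      \<open>step_const + 1\<close>.\<close>
    define C where "C = \<bar>cz_form.step_const TYPE('n) (\<bar>N\<bar> + 1) (C\<^sub>K * 2 ^ CARD('n) * D)\<bar> + 1"
    have "\<exists>S. sparse_family \<eta> S \<and>
        ennreal (cmod (pairing (T (\<lambda>x. complex_of_real (f\<^sub>1 x))) (\<lambda>x. complex_of_real (f\<^sub>2 x))))
          \<le> ennreal C * (\<Sum>\<^sub>\<infinity>Q\<in>S. ennreal (average Q f\<^sub>1 * average Q f\<^sub>2 * measure lebesgue Q))"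
      if cz: "dini_cz_operator T\<^sub>0 T K C\<^sub>K \<omega>" "L2_operator_norm T = N"
        and Q: "Q\<^sub>0 \<in> dyadic_cubes" "f\<^sub>1 \<in> test_functions Q\<^sub>0" "f\<^sub>2 \<in> test_functions Q\<^sub>0"
      for T\<^sub>0 T :: "(real^'n \<Rightarrow> complex) \<Rightarrow> real^'n \<Rightarrow> complex" and K Q\<^sub>0 f\<^sub>1 f\<^sub>2
    proof -
      have "dini_modulus \<omega>" using cz(1) by (simp add: dini_cz_operator_def dini_kernel_def)
      then interpret dini_operator T\<^sub>0 T K C\<^sub>K \<omega> D
        using cz(1) D by unfold_locales
      interpret F: cz_form form "\<bar>N\<bar> + 1" "C\<^sub>K * 2 ^ CARD('n) * D"
        using cz_form unfolding cz(2) .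
      obtain q where q: "Q\<^sub>0 = dcube q" using Q(1) unfolding dyadic_cubes_eq by blast
      note f = test_functions_bbs[OF Q(2)[unfolded q]] and g = test_functions_bbs[OF Q(3)[unfolded q]]
      have "\<exists>S. finite S \<and> sparse_family \<eta> S \<and> cmod (form f\<^sub>1 f\<^sub>2)
          \<le> (F.step_const + 1) * (\<Sum>Q\<in>S. average Q f\<^sub>1 * average Q f\<^sub>2 * measure lebesgue Q)"
        by (rule F.sparse_domination[OF f g]) (use \<eta> in \<open>simp_all add: \<eta>\<^sub>s_def\<close>)
      then obtain S where S: "finite S" "sparse_family \<eta> S"
        and le: "cmod (form f\<^sub>1 f\<^sub>2) \<le> (F.step_const + 1) * (\<Sum>Q\<in>S. average Q f\<^sub>1 * average Q f\<^sub>2 * measure lebesgue Q)"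
        by blast
      let ?\<Sigma> = "\<Sum>Q\<in>S. average Q f\<^sub>1 * average Q f\<^sub>2 * measure lebesgue Q"
      have nn: "0 \<le> average Q f\<^sub>1 * average Q f\<^sub>2 * measure lebesgue Q" for Q
        by (intro mult_nonneg_nonneg average_nonneg f(2) g(2)) simp
      have "0 \<le> ?\<Sigma>" by (intro sum_nonneg nn)
      then have "cmod (form f\<^sub>1 f\<^sub>2) \<le> C * ?\<Sigma>"
        using le by (elim order_trans) (intro mult_right_mono, auto simp: C_def)
      then have "ennreal (cmod (form f\<^sub>1 f\<^sub>2)) \<le> ennreal (C * ?\<Sigma>)" by (rule ennreal_leI)
      also have "\<dots> = ennreal C * (\<Sum>\<^sub>\<infinity>Q\<in>S. ennreal (average Q f\<^sub>1 * average Q f\<^sub>2 * measure lebesgue Q))"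
        unfolding infsum_finite[OF S(1)] sum_ennreal[OF nn]
        by (intro ennreal_mult \<open>0 \<le> ?\<Sigma>\<close>) (simp add: C_def)
      finally show ?thesis using S(2) unfolding form_def by blast
    qed
    moreover have "0 < C" by (simp add: C_def add_nonneg_pos)
    ultimately show ?thesis by blast
  qed
  show ?thesis
    by (intro exI[of _ \<eta>\<^sub>s] conjI \<eta>\<^sub>s allI impI main) (elim conjE)
qed

end
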